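(* Let $V:\mathbb{R}\to\mathbb{R}$ and $\beta>0$ satisfy the following: (a) $V$ is continuous with $\liminf_{|x|\to\infty}V(x)/x^2>0$, $V$ is locally Lipschitz, differentiable outside a compact set, and there exist $\alpha>0$ and $d\ge 2$ such that $|V'(x)|\sim\alpha|x|^{d-1}$ as $|x|\to+\infty$; (b) the equilibrium measure $\mu_{\frac{2V}{\beta}}$ has finite classical entropy. Then there exist $u,v>0$ such that for any integer $N\ge1$ and any $\theta>v\sqrt{\frac{\ln(1+N)}{N}}$, $$\mathbb{P}^N_{V,\beta}\left(W_1\big(\widehat\mu_N,\mu_{\frac{2V}{\beta}}\big)\ge\theta\right)\le e^{-uN^2\theta^2}.$$
   Context: For $N\ge1$, $\mathbb{P}^N_{V,\beta}$ is the probability measure on $\mathbb{R}^N$ $$\mathbb{P}^N_{V,\beta}(dx_1,\dots,dx_N)=\frac{1}{Z^N_{V,\beta}}\prod_{i<j}|x_i-x_j|^\beta\exp\Big(-N\sum_{i=1}^NV(x_i)\Big)\prod_{i=1}^Ndx_i,$$ with $Z^N_{V,\beta}$ the normalising constant, and $\widehat\mu_N=\frac1N\sum_{i=1}^N\delta_{x_i}$ is the empirical measure. $W_1(\mu,\nu)=\inf_\pi\int_{\mathbb{R}^2}|x-y|\,d\pi(x,y)$ over couplings $\pi$ of $\mu,\nu$. For continuous $W:\mathbb{R}\to\mathbb{R}$ with $\liminf_{|x|\to\infty}W(x)/x^2>0$, the equilibrium measure $\mu_W$ is the unique minimiser over probability measures $\mu$ on $\mathbb{R}$ of $J_W(\mu)=\int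 W\,d\mu-\iint\ln|x-y|\,d\mu(x)\,d\mu(y)$ (with $J_W(\mu)=+\infty$ if $\int W\,d\mu=+\infty$); it is known to exist, be unique and have compact support. $\mu_{\frac{2V}{\beta}}$ is the equilibrium measure of $W=\frac{2V}{\beta}$. The classical entropy $H(\mu)$ is the entropy relative to Lebesgue measure: $H(\mu)=\int\rho\ln\rho\,dx$ if $\mu$ has density $\rho$, and $+\infty$ if $\mu$ is not absolutely continuous. *)

theory Defs
  imports "HOL-Probability.Probability" "HOL-Library.Landau_Symbols"
begin

text \<open>Points of \<open>\<real>\<^sup>N\<close> are functions on the index set \<open>{..<N}\<close>, extended by
  \<open>undefined\<close>; Lebesgue measure on \<open>\<real>\<^sup>N\<close> is the product measure \<open>PiM\<close>.\<close>

definition lebN :: "nat \<Rightarrow> (nat \<Rightarrow> real) measure" where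
  "lebN N = (\<Pi>\<^sub>M i\<in>{..<N}. lborel)"

definition gibbs_weight :: "(real \<Rightarrow> real) \<Rightarrow> real \<Rightarrow> nat \<Rightarrow> (nat \<Rightarrow> real) \<Rightarrow> real" where
  "gibbs_weight V \<beta> N x =
     (\<Prod>j<N. \<Prod>i<j. \<bar>x i - x j\<bar> powr \<beta>) * exp (- real N * (\<Sum>i<N. V (x i)))"

definition partition_function :: "(real \<Rightarrow> real) \<Rightarrow> real \<Rightarrow> nat \<Rightarrow> ennreal" where
  "partition_function V \<beta> N = (\<integral>\<^sup>+x. ennreal (gibbs_weight V \<beta> N x) \<partial>lebN N)"

definition gibbs :: "(real \<Rightarrow> real) \<Rightarrow> real \<Rightarrow> nat \<Rightarrow> (nat \<Rightarrow> real) measure" where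
  "gibbs V \<beta> N =
     density (lebN N) (\<lambda>x. ennreal (gibbs_weight V \<beta> N x) / partition_function V \<beta> N)"

definition prob_measures :: "real measure set" where
  "prob_measures = {\<mu>. prob_space \<mu> \<and> sets \<mu> = sets borel}"

text \<open>The image of the uniform distribution on the indices under \<open>i \<mapsto> x i\<close>; see
  \<open>emeasure_empirical_measure\<close> below.\<close>

definition empirical_measure :: "nat \<Rightarrow> (nat \<Rightarrow> real) \<Rightarrow> real measure" where
  "empirical_measure N x = distr (uniform_count_measure {..<N}) borel x"

lemma emeasure_empirical_measure:
  assumes "N \<ge> 1" "A \<in> sets borel"
  shows "emeasure (empirical_measure N x) A = (\<Sum>i<N. indicator A (x i)) / of_nat N"
proof -
  have "x -` A \<inter> {..<N} = {i\<in>{..<N}. x i \<in> A}"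
    by auto
  moreover have "emeasure (uniform_count_measure {..<N}) {i\<in>{..<N}. x i \<in> A} =
      ennreal (real (card {i\<in>{..<N}. x i \<in> A}) / real N)"
    by (subst emeasure_uniform_count_measure) auto
  moreover have "(\<Sum>i<N. indicator A (x i) :: ennreal) = of_nat (card {i\<in>{..<N}. x i \<in> A})"
    by (simp add: indicator_def sum.If_cases Int_def)
  ultimately show ?thesis
    using assms unfolding empirical_measure_def
    by (subst emeasure_distr)
       (auto simp: space_uniform_count_measure sets_uniform_count_measure
         ennreal_of_nat_eq_real_of_nat divide_ennreal
         cong: measurable_cong_sets intro!: measurableI)
qed

definition couplings :: "real measure \<Rightarrow> real measure \<Rightarrow> (real \<times> real) measure set" where
  "couplings \<mu> \<nu> = {\<pi>. prob_space \<pi> \<and> sets \<pi> = sets (borel \<Otimes>\<^sub>M borel) \<and>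
     distr \<pi> borel fst = \<mu> \<and> distr \<pi> borel snd = \<nu>}"

definition W1 :: "real measure \<Rightarrow> real measure \<Rightarrow> ennreal" where
  "W1 \<mu> \<nu> = (INF \<pi>\<in>couplings \<mu> \<nu>. \<integral>\<^sup>+p. ennreal \<bar>fst p - snd p\<bar> \<partial>\<pi>)"

text \<open>The integral with values in \<open>[-\<infinity>, \<infinity>]\<close>. The function \<open>e2ennreal\<close> is the positive part.
  The integral is meaningful when the positive or the negative part has finite integral;
  otherwise its value is \<open>\<infinity> - \<infinity> = \<infinity>\<close> by the convention of type \<open>ereal\<close>.\<close>

definition eintegral :: "'a measure \<Rightarrow> ('a \<Rightarrow> ereal) \<Rightarrow> ereal" where
  "eintegral M f =
     enn2ereal (\<integral>\<^sup>+x. e2ennreal (f x) \<partial>M) - enn2ereal (\<integral>\<^sup>+x. e2ennreal (- f x) \<partial>M)"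

text \<open>The value on the diagonal has to be given separately, as \<open>ln 0 = 0\<close> in the library.\<close>

definition neg_log_dist :: "real \<Rightarrow> real \<Rightarrow> ereal" where
  "neg_log_dist x y = (if x = y then \<infinity> else ereal (- ln \<bar>x - y\<bar>))"

text \<open>If \<open>W\<close> is continuous and grows at least quadratically, then it is bounded below, and
  \<open>\<integral>W d\<mu> < \<infinity>\<close> implies that the negative part of the second integral is finite.\<close>

definition J :: "(real \<Rightarrow> real) \<Rightarrow> real measure \<Rightarrow> ereal" where
  "J W \<mu> =
     (if eintegral \<mu> (\<lambda>x. ereal (W x)) = \<infinity> then \<infinity>
      else eintegral \<mu> (\<lambda>x. ereal (W x))
         + eintegral (\<mu> \<Otimes>\<^sub>M \<mu>) (\<lambda>(x, y). neg_log_dist x y))"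

definition is_equilibrium_measure :: "(real \<Rightarrow> real) \<Rightarrow> real measure \<Rightarrow> bool" where
  "is_equilibrium_measure W \<mu> \<longleftrightarrow> \<mu> \<in> prob_measures \<and>
     (\<forall>\<nu>\<in>prob_measures. \<nu> \<noteq> \<mu> \<longrightarrow> J W \<mu> < J W \<nu>)"

text \<open>For compactly supported \<open>\<mu>\<close>, such as an equilibrium measure, the negative part of
  \<open>\<rho> ln \<rho>\<close> is integrable, so the entropy is well defined in \<open>(-\<infinity>, \<infinity>]\<close>.\<close>

definition classical_entropy :: "real measure \<Rightarrow> ereal" where
  "classical_entropy \<mu> =
     (if absolutely_continuous lborel \<mu>
      then eintegral lborel (\<lambda>x. let \<rho> = enn2real (RN_deriv lborel \<mu> x) in ereal (\<rho> * ln \<rho>))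
      else \<infinity>)"

definition locally_lipschitz :: "(real \<Rightarrow> real) \<Rightarrow> bool" where
  "locally_lipschitz V \<longleftrightarrow> (\<forall>x. \<exists>r>0. \<exists>L. L-lipschitz_on (ball x r) V)"

text \<open>On the real line the filter \<open>at_infinity\<close> is \<open>\<bar>x\<bar> \<rightarrow> \<infinity>\<close>.\<close>

definition admissible_potential :: "(real \<Rightarrow> real) \<Rightarrow> bool" where
  "admissible_potential V \<longleftrightarrow>
     continuous_on UNIV V \<and>
     Liminf at_infinity (\<lambda>x. ereal (V x / x\<^sup>2)) > 0 \<and>
     locally_lipschitz V \<and>
     (\<exists>K. compact K \<and> (\<forall>x. x \<notin> K \<longrightarrow> V differentiable (at x))) \<and>
     (\<exists>\<alpha>>0. \<exists>d\<ge>2. (\<lambda>x. \<bar>deriv V x\<bar>) \<sim>[at_infinity] (\<lambda>x. \<alpha> * \<bar>x\<bar> powr (d - 1)))"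

end

theory Submission
  imports Defs
begin

text \<open>Put \<open>W = 2 * V / \<beta>\<close> and let \<open>U\<close> be the logarithmic potential of \<open>\<mu>\<close>. As \<open>\<mu>\<close> has a
  density, minimality yields a constant \<open>c\<close> with \<open>W + 2 * U \<ge> c\<close> Lebesgue-almost everywhere and
  equality \<open>\<mu>\<close>-almost everywhere, so \<open>\<mu>\<close> has compact support.

  The kernel \<open>- ln \<bar>a\<bar>\<close> dominates the truncation of \<open>\<integral> (exp (- s * \<bar>a\<bar>) - exp (- s)) / s ds\<close> to
  \<open>s \<le> R\<close>, suitably normalised. This truncated kernel is about \<open>ln R\<close> at \<open>0\<close>, it is conditionally
  positive definite as a mixture of exponential kernels, and it dominates the Poisson regularisation
  \<open>- ln (a\<^sup>2 + 2 / R\<^sup>2) / 2\<close>. Averaging the Euler-Lagrange inequality against the Poisson kernel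
  therefore shows, with \<open>R = N\<^sup>2\<close>, that the energy of \<open>N\<close> points exceeds \<open>N\<^sup>2 * J W \<mu>\<close> by \<open>N\<^sup>2\<close>
  times the truncated energy of the difference of the empirical measure and \<open>\<mu>\<close>, plus a term growing
  quadratically far from the support, up to \<open>O(N ln N)\<close>. The points need not be separated, and only the
  modulus of continuity of \<open>W\<close> near the support enters.

  On a compact interval the truncated energy controls the \<open>L\<^sup>2\<close> norm of an exponentially smoothed
  difference of the distribution functions, from which the difference itself is recovered. Hence the
  energy excess dominates \<open>N\<^sup>2 * W1\<^sup>2\<close>. Jensen's inequality under the \<open>N\<close>-fold power of \<open>\<mu>\<close>, where
  the finite entropy enters, bounds the partition function from below.\<close>

text \<open>Two obstacles shape the argument. The empirical measure has atoms, so its logarithmic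
  energy is infinite and cannot be compared directly with that of \<open>\<mu>\<close>. The
  Euler-Lagrange inequality is known only almost everywhere, whereas the points of a configuration
  are arbitrary. A Cauchy average around a point has a density, which settles the second obstacle. A
  finite kernel squeezed between the averaged logarithm and the logarithm settles the first: the
  bound from below transfers the averaged inequality to the truncated potential, and the bound from
  above loses only the diagonal.

  The price is that the Cauchy law has no first moment. Moduli of continuity are therefore measured
  by \<open>sqrt \<bar>t\<bar>\<close>, and far out \<open>W\<close> has to be replaced by a
  logarithmic barrier. The truncated energy controls distribution functions only on a bounded
  window; mass outside it is charged to the growth of \<open>W\<close>.

  The threshold for \<open>\<theta>\<close> is the point at which the gain, of order
  \<open>N\<^sup>2 * \<theta>\<^sup>2\<close>, overtakes the error, of order
  \<open>N * ln (1 + N)\<close>.\<close>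

section \<open>The exponential integral and the truncated logarithm\<close>

definition expm1_quot :: "real \<Rightarrow> real" where
  "expm1_quot u = (if u = 0 then 1 else (1 - exp (- u)) / u)"

text \<open>The entire exponential integral. For \<open>x > 0\<close> it is \<open>ln x\<close> plus
  the Euler-Mascheroni constant plus the exponentially small \<open>E\<^sub>1 x\<close>, so it
  imitates the logarithm without the singularity at \<open>0\<close>.\<close>

definition Ein :: "real \<Rightarrow> real" where
  "Ein x = integral {0..x} expm1_quot"

lemma isCont_expm1_quot: "isCont expm1_quot u"
proof (cases "u = 0")
  case False
  have "isCont (\<lambda>u::real. (1 - exp (- u)) / u) u"
    using False by (intro continuous_intros) auto
  moreover have "\<forall>\<^sub>F x in nhds u. expm1_quot x = (1 - exp (- x)) / x"
    using t1_space_nhds[OF False] by eventually_elim (auto simp: expm1_quot_def)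
  ultimately show ?thesis
    by (subst isCont_cong) auto
next
  case True
  have "((\<lambda>u::real. 1 - exp (- u)) has_real_derivative 1) (at 0)"
    by (auto intro!: derivative_eq_intros)
  then have "(\<lambda>h::real. (1 - exp (- h)) / h) \<midarrow>0\<rightarrow> 1"
    by (simp add: DERIV_def)
  then have "expm1_quot \<midarrow>0\<rightarrow> 1"
    by (rule Lim_transform_eventually) (auto simp: expm1_quot_def eventually_at_filter)
  then show ?thesis
    using True by (simp add: isCont_def expm1_quot_def)
qed

lemma continuous_on_expm1_quot: "continuous_on A expm1_quot"
  using isCont_expm1_quot by (simp add: continuous_at_imp_continuous_on)

lemma Ein_0 [simp]: "Ein 0 = 0"
  by (simp add: Ein_def)

lemma DERIV_Ein_within:
  assumes "0 \<le> x" "x \<le> b"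
  shows "(Ein has_real_derivative expm1_quot x) (at x within {0..b})"
  unfolding Ein_def
  using assms by (intro integral_has_real_derivative continuous_on_expm1_quot) auto

lemma DERIV_Ein:
  assumes "0 < x"
  shows "(Ein has_real_derivative expm1_quot x) (at x)"
proof -
  have "(Ein has_real_derivative expm1_quot x) (at x within {0..x+1})"
    using assms by (intro DERIV_Ein_within) auto
  then show ?thesis
    using assms by (simp only: at_within_Icc_at[of 0 x "x + 1"])
qed

lemma continuous_on_Ein: "continuous_on {0..} Ein"
proof -
  have "continuous (at x within {0..}) Ein" if "0 \<le> x" for x
  proof -
    have "continuous (at x within {0..x+1}) Ein"
      using DERIV_Ein_within[of x "x+1"] that DERIV_continuous by auto
    moreover have "at x within {0..x+1} = at x within {0..}"
      using that by (intro at_within_nhd[of _ "{..<x+1}"]) auto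
    ultimately show ?thesis by simp
  qed
  then show ?thesis
    by (auto simp: continuous_on_eq_continuous_within)
qed

lemma Ein_nonneg:
  assumes "0 \<le> x"
  shows "0 \<le> Ein x"
  unfolding Ein_def
  by (intro integral_nonneg integrable_continuous_interval continuous_on_expm1_quot)
    (auto simp: expm1_quot_def)

lemma Ein_le:
  assumes "0 \<le> x"
  shows "Ein x \<le> x"
proof -
  have "Ein x \<le> integral {0..x} (\<lambda>_. 1)"
    unfolding Ein_def
  proof (intro integral_le integrable_continuous_interval continuous_on_expm1_quot)
    fix u assume u: "u \<in> {0..x}"
    have "1 - exp (- u) \<le> u" using exp_ge_add_one_self[of "- u"] by simp
    then show "expm1_quot u \<le> 1"
      using u by (auto simp: expm1_quot_def divide_simps)
  qed auto
  then show ?thesis using assms by simp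
qed

text \<open>The limit of \<open>Ein x - ln x\<close>, that is, the Euler-Mascheroni constant. It lies between
  \<open>Ein x - ln (x\<^sup>2 + 2) / 2\<close> and \<open>Ein x - ln x\<close>, and the first of these increases because
  \<open>exp u \<ge> 1 + u\<^sup>2 / 2\<close>.\<close>

definition Ein_const :: real where
  "Ein_const = Inf ((\<lambda>x. Ein x - ln x) ` {0<..})"

text \<open>The derivative is \<open>- exp (- z) / z\<close>.\<close>

lemma Ein_diff_ln_antimono:
  assumes "0 < x" "x \<le> y"
  shows "Ein y - ln y \<le> Ein x - ln x"
proof (rule DERIV_nonpos_imp_nonincreasing[OF assms(2)])
  fix z assume z: "x \<le> z" "z \<le> y"
  then have "z > 0" using assms by simp
  then have "((\<lambda>x. Ein x - ln x) has_real_derivative expm1_quot z - 1 / z) (at z)"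
    by (auto intro!: derivative_eq_intros DERIV_Ein simp: inverse_eq_divide)
  moreover have "expm1_quot z - 1 / z \<le> 0"
    using \<open>z > 0\<close> by (auto simp: expm1_quot_def divide_simps)
  ultimately show "\<exists>d. ((\<lambda>x. Ein x - ln x) has_real_derivative d) (at z) \<and> d \<le> 0"
    by blast
qed

lemma exp_ge_quadratic: 
  assumes "0 \<le> (u::real)"
  shows "1 + u\<^sup>2 / 2 \<le> exp u"
  using exp_lower_Taylor_quadratic[OF assms] assms by linarith

lemma half_ln_diff_Ein_antimono:
  assumes "0 \<le> x" "x \<le> y"
  shows "ln (y\<^sup>2 + 2) / 2 - Ein y \<le> ln (x\<^sup>2 + 2) / 2 - Ein x"
proof (rule DERIV_nonpos_imp_decreasing_open[OF assms(2)])
  fix z assume z: "x < z" "z < y"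
  then have z0: "z > 0" using assms by simp
  have "z\<^sup>2 + 2 > 0" by (simp add: add_nonneg_pos)
  then have "((\<lambda>x. ln (x\<^sup>2 + 2) / 2 - Ein x) has_real_derivative z / (z\<^sup>2 + 2) - expm1_quot z) (at z)"
  proof -
    have "4 * z / (z\<^sup>2 * 4 + 8) = 4 * z / (4 * (z\<^sup>2 + 2))" by (simp add: algebra_simps)
    also have "\<dots> = z / (z\<^sup>2 + 2)" by (subst mult_divide_mult_cancel_left) auto
    finally show ?thesis
      using z0 \<open>z\<^sup>2 + 2 > 0\<close> by (auto intro!: derivative_eq_intros DERIV_Ein)
  qed
  moreover have "z / (z\<^sup>2 + 2) - expm1_quot z \<le> 0"
  proof -
    have "exp (- z) * (z\<^sup>2 + 2) \<le> exp (- z) * (2 * exp z)"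
      using exp_ge_quadratic[of z] z0 by (intro mult_left_mono) auto
    also have "\<dots> = 2" by (simp add: exp_minus)
    finally have "exp (- z) * (z\<^sup>2 + 2) \<le> 2" .
    then have "z * z \<le> (1 - exp (- z)) * (z\<^sup>2 + 2)"
      by (simp add: algebra_simps power2_eq_square)
    then show ?thesis
      using z0 \<open>z\<^sup>2 + 2 > 0\<close> by (simp add: expm1_quot_def divide_simps mult.commute)
  qed
  ultimately show "\<exists>d. ((\<lambda>x. ln (x\<^sup>2 + 2) / 2 - Ein x) has_real_derivative d) (at z) \<and> d \<le> 0"
    by blast
next
  have "z\<^sup>2 + 2 \<noteq> 0" for z :: real
    using zero_le_power2[of z] by linarith
  moreover have "continuous_on {x..y} Ein"
    using assms by (intro continuous_on_subset[OF continuous_on_Ein]) auto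
  ultimately show "continuous_on {x..y} (\<lambda>x. ln (x\<^sup>2 + 2) / 2 - Ein x)"
    by (auto intro!: continuous_intros)
qed

text \<open>The left expression increases, the right one decreases, and at \<open>max x y\<close>
  they are in order. Hence the infimum \<open>Ein_const\<close> separates the two without any limit
  being computed.\<close>

lemma Ein_half_ln_le:
  assumes "0 \<le> x" "0 < y"
  shows "Ein x - ln (x\<^sup>2 + 2) / 2 \<le> Ein y - ln y"
proof -
  define z where "z = max x y"
  have z: "z > 0" "x \<le> z" "y \<le> z" using assms by (auto simp: z_def)
  have "ln (z\<^sup>2) \<le> ln (z\<^sup>2 + 2)" using z(1) by (subst ln_le_cancel_iff) (auto simp: add_nonneg_pos)
  then have "ln z \<le> ln (z\<^sup>2 + 2) / 2" using z(1) by (simp add: ln_realpow)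
  then have "Ein x - ln (x\<^sup>2 + 2) / 2 \<le> Ein z - ln z"
    using half_ln_diff_Ein_antimono[OF assms(1) z(2)] by simp
  also have "\<dots> \<le> Ein y - ln y"
    using assms z by (intro Ein_diff_ln_antimono)
  finally show ?thesis .
qed

lemma Ein_const_le: 
  assumes "0 < x"
  shows "Ein_const \<le> Ein x - ln x"
  unfolding Ein_const_def using assms Ein_half_ln_le[of 0]
  by (intro cInf_lower bdd_belowI2) auto

lemma Ein_const_ge:
  assumes "0 \<le> x"
  shows "Ein x - ln (x\<^sup>2 + 2) / 2 \<le> Ein_const"
  unfolding Ein_const_def using assms Ein_half_ln_le by (intro cInf_greatest) auto

lemma Ein_const_le_1: "Ein_const \<le> 1"
  using Ein_const_le[of 1] Ein_le[of 1] by simp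

text \<open>For \<open>R \<rightarrow> \<infinity>\<close> this kernel increases to \<open>- ln \<bar>a\<bar>\<close>.\<close>

definition trunc_log :: "real \<Rightarrow> real \<Rightarrow> real" where
  "trunc_log R a = Ein_const + ln R - Ein (R * \<bar>a\<bar>)"

lemma trunc_log_le:
  assumes "R > 0" "a \<noteq> 0"
  shows "trunc_log R a \<le> - ln \<bar>a\<bar>"
  using Ein_const_le[of "R * \<bar>a\<bar>"] assms by (simp add: trunc_log_def ln_mult)

text \<open>Rescaling by \<open>R\<close> turns the constant \<open>2\<close> into
  \<open>2 / R\<^sup>2\<close>, which becomes the square of the Cauchy scale
  \<open>sqrt 2 / R\<close>.\<close>

lemma trunc_log_ge:
  assumes "R > 0"
  shows "- ln (a\<^sup>2 + 2 / R\<^sup>2) / 2 \<le> trunc_log R a"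
proof -
  have pos: "a\<^sup>2 + 2 / R\<^sup>2 > 0" using assms by (simp add: add_nonneg_pos)
  have "(R * \<bar>a\<bar>)\<^sup>2 + 2 = R\<^sup>2 * (a\<^sup>2 + 2 / R\<^sup>2)"
    using assms by (simp add: field_simps)
  then have "ln ((R * \<bar>a\<bar>)\<^sup>2 + 2) = ln (R\<^sup>2) + ln (a\<^sup>2 + 2 / R\<^sup>2)"
    using assms pos by (simp add: ln_mult)
  also have "ln (R\<^sup>2) = 2 * ln R" using assms by (simp add: ln_realpow)
  finally show ?thesis
    using Ein_const_ge[of "R * \<bar>a\<bar>"] assms by (simp add: trunc_log_def add_divide_distrib)
qed

text \<open>The price of a diagonal term, where the logarithmic kernel would be infinite.\<close>

lemma trunc_log_0: "R > 0 \<Longrightarrow> trunc_log R 0 \<le> 1 + ln R"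
  using Ein_const_le_1 by (simp add: trunc_log_def)

lemma Ein_measurable: "(\<lambda>a. Ein (R * \<bar>a\<bar>)) \<in> borel_measurable borel" if "R \<ge> 0"
proof (rule borel_measurable_continuous_onI)
  show "continuous_on UNIV (\<lambda>a. Ein (R * \<bar>a\<bar>))"
  proof (rule continuous_on_compose2[OF continuous_on_Ein])
    show "continuous_on UNIV (\<lambda>a. R * \<bar>a\<bar>)" by (intro continuous_intros)
    show "(\<lambda>a. R * \<bar>a\<bar>) ` UNIV \<subseteq> {0..}" using that by auto
  qed
qed

text \<open>After the substitution \<open>u = s * a\<close> the integrand is
  \<open>(1 - exp (- s * a)) / s\<close>. This is the mixture of exponential kernels from which all
  positivity is drawn.\<close>

lemma has_integral_Ein:
  assumes "a \<ge> 0" "R \<ge> 0"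
  shows "((\<lambda>s. a * expm1_quot (s * a)) has_integral Ein (R * a)) {0..R}"
proof -
  have "((\<lambda>s. a * expm1_quot (s * a)) has_integral (Ein (R * a) - Ein (0 * a))) {0..R}"
  proof (rule fundamental_theorem_of_calculus[OF assms(2)])
    fix s assume s: "s \<in> {0..R}"
    \<comment> \<open>At \<open>s = 0\<close> only the one-sided derivative is available, since
      \<open>Ein\<close> is constant on the negative axis; hence the chain rule relative to an image
      set.\<close>
    have "((\<lambda>s. Ein (s * a)) has_real_derivative expm1_quot (s * a) * a) (at s within {0..R})"
    proof (rule DERIV_image_chain[of Ein _ "\<lambda>s. s * a", unfolded o_def])
      have "(\<lambda>s. s * a) ` {0..R} \<subseteq> {0..R * a}"
        using assms by (auto intro: mult_right_mono)
      then show "(Ein has_real_derivative expm1_quot (s * a)) (at (s * a) within (\<lambda>s. s * a) ` {0..R})"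
        using s assms by (intro DERIV_subset[OF DERIV_Ein_within[of _ "R * a"]]) (auto intro: mult_right_mono)
    qed (auto intro!: derivative_eq_intros)
    then show "((\<lambda>s. Ein (s * a)) has_vector_derivative a * expm1_quot (s * a)) (at s within {0..R})"
      by (simp add: has_real_derivative_iff_has_vector_derivative mult.commute)
  qed
  then show ?thesis by simp
qed

subsection \<open>Exponential kernels and the energy distance\<close>

text \<open>A one-sided exponential kernel. At \<open>s = 0\<close> it is the indicator of
  \<open>z < x\<close>, so its average over \<open>x\<close> is a discounted version of the tail
  probability of \<open>{z<..}\<close>.\<close>

definition exp_tail :: "real \<Rightarrow> real \<Rightarrow> real \<Rightarrow> real" where
  "exp_tail s z x = indicator {..<x} z * exp (- s * (x - z))"

lemma exp_tail_alt: "exp_tail s z x = (if z < x then exp (- s * (x - z)) else 0)"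
  by (simp add: exp_tail_def indicator_def)

lemma exp_tail_measurable [measurable]:
  "(\<lambda>(z, x). exp_tail s z x) \<in> borel_measurable (borel \<Otimes>\<^sub>M borel)"
  unfolding exp_tail_alt by measurable

lemma exp_tail_nonneg: "0 \<le> exp_tail s z x"
  by (simp add: exp_tail_alt)

lemma exp_tail_le_1: "0 \<le> s \<Longrightarrow> exp_tail s z x \<le> 1"
  by (auto simp: exp_tail_alt)

text \<open>A convolution square root of the two-sided exponential kernel. It makes that kernel
  positive definite and turns energies into \<open>L\<^sup>2\<close> inner products.\<close>

lemma nn_integral_exp_tail_mult:
  assumes "s > 0"
  shows "(\<integral>\<^sup>+z. ennreal (exp_tail s z x) * ennreal (exp_tail s z y) \<partial>lborel) = ennreal (exp (- s * \<bar>x - y\<bar>) / (2 * s))"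
proof -
  define m where "m = min x y"
  have "(\<integral>\<^sup>+z. ennreal (exp_tail s z x) * ennreal (exp_tail s z y) \<partial>lborel)
      = (\<integral>\<^sup>+w. ennreal (exp_tail s (m - w) x) * ennreal (exp_tail s (m - w) y) \<partial>lborel)"
    using nn_integral_real_affine[of "\<lambda>z. ennreal (exp_tail s z x) * ennreal (exp_tail s z y)" "-1" m]
    by simp
  also have "\<dots> = (\<integral>\<^sup>+w. ennreal (exp (- s * \<bar>x - y\<bar>) * exp (- (2 * s * w))) * indicator {0..} w \<partial>lborel)"
  proof (rule nn_integral_cong_AE)
    show "AE w in lborel. ennreal (exp_tail s (m - w) x) * ennreal (exp_tail s (m - w) y)
      = ennreal (exp (- s * \<bar>x - y\<bar>) * exp (- (2 * s * w))) * indicator {0..} w"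
      using AE_lborel_singleton[of 0]
    proof eventually_elim
      case (elim w)
      have "- s * (x - (m - w)) + - s * (y - (m - w)) = - s * \<bar>x - y\<bar> + - (2 * s * w)"
        by (auto simp: m_def min_def algebra_simps abs_if)
      then have "exp (- s * (x - (m - w))) * exp (- s * (y - (m - w))) = exp (- s * \<bar>x - y\<bar>) * exp (- (2 * s * w))"
        by (simp only: exp_add[symmetric])
      moreover have "0 < w \<longleftrightarrow> m - w < x \<and> m - w < y"
        by (auto simp: m_def min_def)
      ultimately show ?case
        using elim by (auto simp: exp_tail_alt indicator_def ennreal_mult[symmetric])
    qed
  qed
  also have "\<dots> = ennreal (0 - (- exp (- s * \<bar>x - y\<bar>) * exp (- (2 * s * 0)) / (2 * s)))"
  proof (rule nn_integral_FTC_atLeast)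
    fix w :: real
    show "((\<lambda>w. - exp (- s * \<bar>x - y\<bar>) * exp (- (2 * s * w)) / (2 * s)) has_real_derivative
        exp (- s * \<bar>x - y\<bar>) * exp (- (2 * s * w))) (at w)"
      using assms by (auto intro!: derivative_eq_intros)
    show "0 \<le> exp (- s * \<bar>x - y\<bar>) * exp (- (2 * s * w))" by simp
  next
    have "filterlim (\<lambda>w. 2 * s * w) at_top at_top"
      using assms by (intro filterlim_tendsto_pos_mult_at_top[OF tendsto_const] filterlim_ident) auto
    then have "((\<lambda>w. exp (- (2 * s * w))) \<longlongrightarrow> 0) at_top"
      by (intro filterlim_compose[OF exp_at_bot] filterlim_compose[OF filterlim_uminus_at_bot_at_top])
    then have "((\<lambda>w. - exp (- s * \<bar>x - y\<bar>) * exp (- (2 * s * w)) / (2 * s)) \<longlongrightarrow> - exp (- s * \<bar>x - y\<bar>) * 0 / (2 * s)) at_top"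
      using assms by (intro tendsto_intros) auto
    then show "((\<lambda>w. - exp (- s * \<bar>x - y\<bar>) * exp (- (2 * s * w)) / (2 * s)) \<longlongrightarrow> 0) at_top"
      by simp
  qed simp
  finally show ?thesis by simp
qed

lemma nn_integral_exp_tail_atLeast:
  assumes "s > 0"
  shows "(\<integral>\<^sup>+w. ennreal (exp_tail s w x) * indicator {z..} w \<partial>lborel)
    = ennreal ((indicator {z<..} x - exp_tail s z x) / s)"
proof (cases "z < x")
  case True
  have "(\<integral>\<^sup>+w. ennreal (exp_tail s w x) * indicator {z..} w \<partial>lborel)
      = (\<integral>\<^sup>+w. ennreal (exp (- s * (x - w))) * indicator {z..x} w \<partial>lborel)"
  proof (rule nn_integral_cong_AE)
    show "AE w in lborel. ennreal (exp_tail s w x) * indicator {z..} w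
        = ennreal (exp (- s * (x - w))) * indicator {z..x} w"
      using AE_lborel_singleton[of x]
      by eventually_elim (auto simp: exp_tail_alt indicator_def)
  qed
  also have "\<dots> = ennreal (exp (- s * (x - x)) / s - exp (- s * (x - z)) / s)"
    using True assms
    by (intro nn_integral_FTC_Icc) (auto intro!: derivative_eq_intros)
  finally show ?thesis
    using True by (simp add: exp_tail_alt diff_divide_distrib)
next
  case False
  then have *: "ennreal (exp_tail s w x) * indicator {z..} w = 0" for w
    by (auto simp: exp_tail_alt indicator_def)
  show ?thesis
    unfolding * using False by (simp add: exp_tail_alt)
qed

context real_distribution
begin

lemma prob_UNIV [simp]: "prob UNIV = 1"
  using prob_space by simp

lemma integrable_bounded:
  fixes f :: "real \<Rightarrow> real"
  assumes "f \<in> borel_measurable borel" "\<And>x. \<bar>f x\<bar> \<le> B"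
  shows "integrable M f"
  using assms by (intro integrable_const_bound[where B=B]) auto

lemma integrable_exp_tail: "0 \<le> s \<Longrightarrow> integrable M (exp_tail s z)"
  using exp_tail_nonneg exp_tail_le_1 by (intro integrable_bounded[where B=1]) auto

definition lap :: "real \<Rightarrow> real \<Rightarrow> real" where
  "lap s z = (\<integral>x. exp_tail s z x \<partial>M)"

lemma lap_measurable [measurable]: "lap s \<in> borel_measurable borel"
  unfolding lap_def by measurable

lemma lap_nonneg: "0 \<le> lap s z"
  unfolding lap_def by (intro Bochner_Integration.integral_nonneg exp_tail_nonneg)

lemma ennreal_lap: "0 \<le> s \<Longrightarrow> ennreal (lap s z) = (\<integral>\<^sup>+x. ennreal (exp_tail s z x) \<partial>M)"
  unfolding lap_def by (intro nn_integral_eq_integral[symmetric] integrable_exp_tail) (auto simp: exp_tail_nonneg)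

text \<open>The factor \<open>exp_tail\<close> is a fundamental solution of \<open>f' = s * f - \<delta>\<close>, so the tail function
  is recovered from its transform.\<close>

lemma has_bochner_integral_lap_atLeast:
  assumes "s > 0"
  shows "has_bochner_integral lborel (\<lambda>w. lap s w * indicator {z..} w) ((prob {z<..} - lap s z) / s)"
proof (rule has_bochner_integral_nn_integral)
  have "(\<integral>\<^sup>+w. ennreal (lap s w * indicator {z..} w) \<partial>lborel)
      = (\<integral>\<^sup>+w. (\<integral>\<^sup>+x. ennreal (exp_tail s w x) * indicator {z..} w \<partial>M) \<partial>lborel)"
    using assms
    by (intro nn_integral_cong) (auto simp: ennreal_mult' lap_nonneg ennreal_lap nn_integral_multc ennreal_indicator)
  also have "\<dots> = (\<integral>\<^sup>+x. (\<integral>\<^sup>+w. ennreal (exp_tail s w x) * indicator {z..} w \<partial>lborel) \<partial>M)"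
  proof -
    interpret P: pair_sigma_finite lborel M
      by unfold_locales
    show ?thesis by (intro P.Fubini'[symmetric]) measurable
  qed
  also have "\<dots> = (\<integral>\<^sup>+x. ennreal ((indicator {z<..} x - exp_tail s z x) / s) \<partial>M)"
    using assms by (simp add: nn_integral_exp_tail_atLeast)
  also have "\<dots> = ennreal (\<integral>x. (indicator {z<..} x - exp_tail s z x) / s \<partial>M)"
    using assms integrable_exp_tail[of s z]
    by (intro nn_integral_eq_integral)
      (auto intro!: integrable_bounded[where B=1] Bochner_Integration.integrable_diff integrable_divide simp: exp_tail_alt indicator_def)
  also have "(\<integral>x. (indicator {z<..} x - exp_tail s z x) / s \<partial>M) = (prob {z<..} - lap s z) / s"
    using assms integrable_exp_tail[of s z]
    by (simp add: lap_def Bochner_Integration.integral_diff integrable_bounded[where B=1])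
  finally show "(\<integral>\<^sup>+w. ennreal (lap s w * indicator {z..} w) \<partial>lborel) = ennreal ((prob {z<..} - lap s z) / s)" .
  have "lap s z \<le> prob {z<..}"
  proof -
    have "lap s z \<le> (\<integral>x. indicator {z<..} x \<partial>M)"
      unfolding lap_def using assms
      by (intro integral_mono integrable_exp_tail integrable_bounded[where B=1])
        (auto simp: exp_tail_alt indicator_def)
    then show ?thesis by simp
  qed
  then show "0 \<le> (prob {z<..} - lap s z) / s"
    using assms by simp
qed (auto simp: lap_nonneg)

end

text \<open>Cross energies of a pair. The locale is also instantiated with equal arguments, which
  yields the self-energies.\<close>

locale two_distributions = A: real_distribution \<alpha> + B: real_distribution \<beta> for \<alpha> \<beta> :: "real measure"
begin

abbreviation exp_pot :: "real \<Rightarrow> real \<Rightarrow> real" where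
  "exp_pot s x \<equiv> (\<integral>y. exp (- s * \<bar>x - y\<bar>) \<partial>\<beta>)"

definition exp_energy :: "real \<Rightarrow> real" where
  "exp_energy s = (\<integral>x. exp_pot s x \<partial>\<alpha>)"

definition Ein_energy :: "real \<Rightarrow> real" where
  "Ein_energy R = (\<integral>x. \<integral>y. Ein (R * \<bar>x - y\<bar>) \<partial>\<beta> \<partial>\<alpha>)"

lemma integrable_exp: 
  assumes "0 \<le> s"
  shows "integrable \<beta> (\<lambda>y. exp (- s * \<bar>x - y\<bar>))"
    "integrable \<alpha> (\<lambda>x. exp_pot s x)"
proof -
  show 1: "integrable \<beta> (\<lambda>y. exp (- s * \<bar>x - y\<bar>))" for x
    using assms by (intro B.integrable_bounded[where B=1]) auto
  show "integrable \<alpha> (\<lambda>x. exp_pot s x)"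
  proof (intro A.integrable_bounded[where B=1])
    fix x
    have "exp_pot s x \<le> (\<integral>y. 1 \<partial>\<beta>)"
      using assms by (intro integral_mono 1) auto
    then show "\<bar>exp_pot s x\<bar> \<le> 1"
      by (simp add: B.prob_space)
  qed measurable
qed

text \<open>The factorisation of the exponential kernel, averaged over both measures by Tonelli's
  theorem.\<close>

lemma has_bochner_integral_lap_mult:
  assumes "s > 0"
  shows "has_bochner_integral lborel (\<lambda>z. A.lap s z * B.lap s z) (exp_energy s / (2 * s))"
proof (rule has_bochner_integral_nn_integral)
  interpret P: pair_sigma_finite lborel \<alpha> by unfold_locales
  interpret Q: pair_sigma_finite lborel \<beta> by unfold_locales
  have "(\<integral>\<^sup>+z. ennreal (A.lap s z * B.lap s z) \<partial>lborel)
      = (\<integral>\<^sup>+z. (\<integral>\<^sup>+x. (\<integral>\<^sup>+y. ennreal (exp_tail s z x) * ennreal (exp_tail s z y) \<partial>\<beta>) \<partial>\<alpha>) \<partial>lborel)"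
    using assms
    by (intro nn_integral_cong)
      (simp add: ennreal_mult A.lap_nonneg B.lap_nonneg A.ennreal_lap B.ennreal_lap nn_integral_cmult nn_integral_multc)
  also have "\<dots> = (\<integral>\<^sup>+x. (\<integral>\<^sup>+z. (\<integral>\<^sup>+y. ennreal (exp_tail s z x) * ennreal (exp_tail s z y) \<partial>\<beta>) \<partial>lborel) \<partial>\<alpha>)"
    by (intro P.Fubini'[symmetric]) measurable
  also have "\<dots> = (\<integral>\<^sup>+x. (\<integral>\<^sup>+y. (\<integral>\<^sup>+z. ennreal (exp_tail s z x) * ennreal (exp_tail s z y) \<partial>lborel) \<partial>\<beta>) \<partial>\<alpha>)"
    by (intro nn_integral_cong Q.Fubini'[symmetric]) measurable
  also have "\<dots> = (\<integral>\<^sup>+x. (\<integral>\<^sup>+y. ennreal (exp (- s * \<bar>x - y\<bar>) / (2 * s)) \<partial>\<beta>) \<partial>\<alpha>)"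
    using assms by (simp add: nn_integral_exp_tail_mult)
  also have "\<dots> = (\<integral>\<^sup>+x. ennreal (\<integral>y. exp (- s * \<bar>x - y\<bar>) / (2 * s) \<partial>\<beta>) \<partial>\<alpha>)"
    using assms integrable_exp
    by (intro nn_integral_cong nn_integral_eq_integral) auto
  also have "\<dots> = ennreal (\<integral>x. \<integral>y. exp (- s * \<bar>x - y\<bar>) / (2 * s) \<partial>\<beta> \<partial>\<alpha>)"
    using assms integrable_exp
    by (intro nn_integral_eq_integral) auto
  also have "(\<integral>x. \<integral>y. exp (- s * \<bar>x - y\<bar>) / (2 * s) \<partial>\<beta> \<partial>\<alpha>) = exp_energy s / (2 * s)"
    by (simp add: exp_energy_def)
  finally show "(\<integral>\<^sup>+z. ennreal (A.lap s z * B.lap s z) \<partial>lborel) = ennreal (exp_energy s / (2 * s))" .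
  show "0 \<le> exp_energy s / (2 * s)"
    using assms by (auto simp: exp_energy_def intro!: divide_nonneg_nonneg Bochner_Integration.integral_nonneg)
qed (auto simp: A.lap_nonneg B.lap_nonneg)

lemma integrable_Ein:
  assumes R: "0 \<le> R" and int: "integrable \<alpha> (\<lambda>x. x)" "integrable \<beta> (\<lambda>x. x)"
  shows "integrable \<beta> (\<lambda>y. Ein (R * \<bar>x - y\<bar>))"
    "integrable \<alpha> (\<lambda>x. \<integral>y. Ein (R * \<bar>x - y\<bar>) \<partial>\<beta>)"
proof -
  note Ein_measurable[OF R, measurable]
  note nn = Ein_nonneg[OF mult_nonneg_nonneg[OF R abs_ge_zero]]
  have le: "Ein (R * \<bar>x - y\<bar>) \<le> R * \<bar>x\<bar> + R * \<bar>y\<bar>" for x y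
  proof -
    have "Ein (R * \<bar>x - y\<bar>) \<le> R * \<bar>x - y\<bar>" using R by (intro Ein_le) auto
    also have "\<dots> \<le> R * (\<bar>x\<bar> + \<bar>y\<bar>)" using R by (intro mult_left_mono) auto
    finally show ?thesis by (simp add: algebra_simps)
  qed
  show 1: "integrable \<beta> (\<lambda>y. Ein (R * \<bar>x - y\<bar>))" for x
  proof (rule Bochner_Integration.integrable_bound[of _ "\<lambda>y. R * \<bar>x\<bar> + R * \<bar>y\<bar>"])
    show "integrable \<beta> (\<lambda>y. R * \<bar>x\<bar> + R * \<bar>y\<bar>)"
      using int(2) by (intro Bochner_Integration.integrable_add integrable_mult_right integrable_abs) auto
    have "norm (Ein (R * \<bar>x - y\<bar>)) \<le> norm (R * \<bar>x\<bar> + R * \<bar>y\<bar>)" for y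
      using nn[of "x - y"] le[of x y] by simp
    then show "AE y in \<beta>. norm (Ein (R * \<bar>x - y\<bar>)) \<le> norm (R * \<bar>x\<bar> + R * \<bar>y\<bar>)"
      by simp
  qed measurable
  show "integrable \<alpha> (\<lambda>x. \<integral>y. Ein (R * \<bar>x - y\<bar>) \<partial>\<beta>)"
  proof (rule Bochner_Integration.integrable_bound[of _ "\<lambda>x. R * \<bar>x\<bar> + R * (\<integral>y. \<bar>y\<bar> \<partial>\<beta>)"])
    show "integrable \<alpha> (\<lambda>x. R * \<bar>x\<bar> + R * (\<integral>y. \<bar>y\<bar> \<partial>\<beta>))"
      using int(1) by (intro Bochner_Integration.integrable_add integrable_mult_right integrable_abs) auto
    have "norm (\<integral>y. Ein (R * \<bar>x - y\<bar>) \<partial>\<beta>) \<le> norm (R * \<bar>x\<bar> + R * (\<integral>y. \<bar>y\<bar> \<partial>\<beta>))" for x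
    proof -
      have "(\<integral>y. Ein (R * \<bar>x - y\<bar>) \<partial>\<beta>) \<le> (\<integral>y. R * \<bar>x\<bar> + R * \<bar>y\<bar> \<partial>\<beta>)"
        using int(2) by (intro integral_mono 1 le) auto
      also have "\<dots> = R * \<bar>x\<bar> + R * (\<integral>y. \<bar>y\<bar> \<partial>\<beta>)"
        using int(2) by (simp add: B.prob_space)
      finally show ?thesis
        using nn by (simp add: Bochner_Integration.integral_nonneg)
    qed
    then show "AE x in \<alpha>. norm (\<integral>y. Ein (R * \<bar>x - y\<bar>) \<partial>\<beta>) \<le> norm (R * \<bar>x\<bar> + R * (\<integral>y. \<bar>y\<bar> \<partial>\<beta>))"
      by simp
  qed measurable
qed

text \<open>Tonelli's theorem applies to the nonnegative difference
  \<open>1 - exp (- s * \<bar>a\<bar>)\<close>. The two terms must be kept together, because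
  \<open>1 / s\<close> alone is not integrable at \<open>0\<close>.\<close>

lemma has_bochner_integral_Ein_energy:
  assumes R: "0 \<le> R" and int: "integrable \<alpha> (\<lambda>x. x)" "integrable \<beta> (\<lambda>x. x)"
  shows "has_bochner_integral lborel (\<lambda>s. indicator {0<..R} s * ((1 - exp_energy s) / s)) (Ein_energy R)"
proof (rule has_bochner_integral_nn_integral)
  interpret P: pair_sigma_finite \<alpha> lborel by unfold_locales
  interpret Q: pair_sigma_finite \<beta> lborel by unfold_locales
  define q where "q s a = indicator {0<..R} s * ((1 - exp (- s * \<bar>a\<bar>)) / s)" for s a :: real
  have [measurable]: "(\<lambda>(s, a). q s a) \<in> borel_measurable (borel \<Otimes>\<^sub>M borel)"
    unfolding q_def by measurable
  have q_nn: "0 \<le> q s a" for s a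
    by (auto simp: q_def indicator_def)
  note nn = Ein_nonneg[OF mult_nonneg_nonneg[OF R abs_ge_zero]]
  have Ein_eq: "(\<integral>\<^sup>+s. ennreal (q s a) \<partial>lborel) = ennreal (Ein (R * \<bar>a\<bar>))" for a
  proof -
    have "(\<integral>\<^sup>+s. ennreal (q s a) \<partial>lborel)
       = (\<integral>\<^sup>+s. ennreal (\<bar>a\<bar> * expm1_quot (s * \<bar>a\<bar>)) * indicator {0..R} s \<partial>lborel)"
    proof (rule nn_integral_cong_AE)
      show "AE s in lborel. ennreal (q s a) = ennreal (\<bar>a\<bar> * expm1_quot (s * \<bar>a\<bar>)) * indicator {0..R} s"
        using AE_lborel_singleton[of 0]
        by eventually_elim (auto simp: q_def indicator_def expm1_quot_def)
    qed
    also have "\<dots> = ennreal (Ein (R * \<bar>a\<bar>))"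
    proof (rule nn_integral_has_integral_lebesgue'[OF _ has_integral_Ein])
      show "0 \<le> \<bar>a\<bar> * expm1_quot (x * \<bar>a\<bar>)" if "x \<in> {0..R}" for x
        using that by (auto simp: expm1_quot_def)
    qed (use R in auto)
    finally show ?thesis .
  qed
  have bound: "exp_energy s \<le> 1" if "s \<ge> 0" for s
  proof -
    have "(\<integral>x. exp_pot s x \<partial>\<alpha>) \<le> (\<integral>x. \<integral>y. 1 \<partial>\<beta> \<partial>\<alpha>)"
      using that by (intro integral_mono integrable_exp) auto
    then show ?thesis by (simp add: exp_energy_def A.prob_space B.prob_space)
  qed
  have q_eq: "(\<integral>\<^sup>+x. (\<integral>\<^sup>+y. ennreal (q s (x - y)) \<partial>\<beta>) \<partial>\<alpha>) = ennreal (indicator {0<..R} s * ((1 - exp_energy s) / s))" for s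
  proof (cases "s \<in> {0<..R}")
    case True
    then have s: "0 < s" by simp
    have "(\<integral>\<^sup>+x. (\<integral>\<^sup>+y. ennreal (q s (x - y)) \<partial>\<beta>) \<partial>\<alpha>) = (\<integral>\<^sup>+x. ennreal (\<integral>y. (1 - exp (- s * \<bar>x - y\<bar>)) / s \<partial>\<beta>) \<partial>\<alpha>)"
      using True s integrable_exp[of s]
      by (intro nn_integral_cong) (subst nn_integral_eq_integral[symmetric], auto simp: q_def)
    also have "\<dots> = (\<integral>\<^sup>+x. ennreal ((1 - exp_pot s x) / s) \<partial>\<alpha>)"
      using s integrable_exp[of s] by (simp add: B.prob_space)
    also have "\<dots> = ennreal (\<integral>x. (1 - exp_pot s x) / s \<partial>\<alpha>)"
    proof (rule nn_integral_eq_integral)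
      have "exp_pot s x \<le> (\<integral>y. 1 \<partial>\<beta>)" for x
        using s by (intro integral_mono integrable_exp) auto
      then show "AE x in \<alpha>. 0 \<le> (1 - exp_pot s x) / s"
        using s by (simp add: B.prob_space)
    qed (use s integrable_exp[of s] in auto)
    also have "(\<integral>x. (1 - exp_pot s x) / s \<partial>\<alpha>) = (1 - exp_energy s) / s"
      using s integrable_exp[of s] by (simp add: A.prob_space exp_energy_def)
    finally show ?thesis using True by simp
  qed (auto simp: q_def)
  have "ennreal (Ein_energy R) = (\<integral>\<^sup>+x. (\<integral>\<^sup>+y. ennreal (Ein (R * \<bar>x - y\<bar>)) \<partial>\<beta>) \<partial>\<alpha>)"
    unfolding Ein_energy_def using integrable_Ein[OF assms] nn
    by (subst nn_integral_eq_integral, auto intro!: nn_integral_eq_integral[symmetric] Bochner_Integration.integral_nonneg)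
  also have "\<dots> = (\<integral>\<^sup>+x. (\<integral>\<^sup>+y. (\<integral>\<^sup>+s. ennreal (q s (x - y)) \<partial>lborel) \<partial>\<beta>) \<partial>\<alpha>)"
    by (simp add: Ein_eq)
  also have "\<dots> = (\<integral>\<^sup>+x. (\<integral>\<^sup>+s. (\<integral>\<^sup>+y. ennreal (q s (x - y)) \<partial>\<beta>) \<partial>lborel) \<partial>\<alpha>)"
    by (intro nn_integral_cong Q.Fubini'[symmetric]) measurable
  also have "\<dots> = (\<integral>\<^sup>+s. (\<integral>\<^sup>+x. (\<integral>\<^sup>+y. ennreal (q s (x - y)) \<partial>\<beta>) \<partial>\<alpha>) \<partial>lborel)"
    by (intro P.Fubini'[symmetric]) measurable
  also have "\<dots> = (\<integral>\<^sup>+s. ennreal (indicator {0<..R} s * ((1 - exp_energy s) / s)) \<partial>lborel)"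
    by (simp add: q_eq)
  finally show "(\<integral>\<^sup>+s. ennreal (indicator {0<..R} s * ((1 - exp_energy s) / s)) \<partial>lborel) = ennreal (Ein_energy R)"
    by simp
  show "AE s in lborel. 0 \<le> indicator {0<..R} s * ((1 - exp_energy s) / s)"
    using bound by (auto simp: indicator_def)
  show "0 \<le> Ein_energy R"
    unfolding Ein_energy_def using nn by (intro Bochner_Integration.integral_nonneg) auto
  show "(\<lambda>s. indicator {0<..R} s * ((1 - exp_energy s) / s)) \<in> borel_measurable lborel"
    unfolding exp_energy_def by measurable
qed

end

section \<open>From the energy distance to the distribution functions\<close>

lemma abs_le_one_plus_square: "\<bar>x\<bar> \<le> 1 + (x::real)\<^sup>2"
  using zero_le_power2[of "\<bar>x\<bar> - 1"] by (simp add: power2_eq_square algebra_simps abs_mult_self_eq)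

lemma integrable_indicator_Icc [simp, intro]: "integrable lborel (indicat_real {a..b::real})"
  by (intro integrable_real_indicator) (auto simp: emeasure_lborel_Icc_eq)

context two_distributions
begin

lemma two_distributions_same: "two_distributions \<alpha> \<alpha>" "two_distributions \<beta> \<beta>"
  by unfold_locales

definition lap_diff :: "real \<Rightarrow> real \<Rightarrow> real" where
  "lap_diff s z = A.lap s z - B.lap s z"

lemma lap_diff_measurable [measurable]: "lap_diff s \<in> borel_measurable borel"
  unfolding lap_diff_def by measurable

abbreviation lap_norm_sq :: "real \<Rightarrow> real" where
  "lap_norm_sq s \<equiv> (\<integral>z. (lap_diff s z)\<^sup>2 \<partial>lborel)"

abbreviation lap_dist :: "real \<Rightarrow> real \<Rightarrow> real" where
  "lap_dist M s \<equiv> (\<integral>w. indicator {-M..M} w * \<bar>lap_diff s w\<bar> \<partial>lborel)"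

text \<open>The energy of the signed measure \<open>\<alpha> - \<beta>\<close> for the kernel
  \<open>trunc_log R\<close>: the additive constant of that kernel cancels because both measures
  have mass one.\<close>

definition energy_dist :: "real \<Rightarrow> real" where
  "energy_dist R = 2 * Ein_energy R - two_distributions.Ein_energy \<alpha> \<alpha> R - two_distributions.Ein_energy \<beta> \<beta> R"

lemma has_bochner_integral_lap_diff_sq:
  assumes "s > 0"
  shows "has_bochner_integral lborel (\<lambda>z. (lap_diff s z)\<^sup>2)
    ((two_distributions.exp_energy \<alpha> \<alpha> s + two_distributions.exp_energy \<beta> \<beta> s - 2 * exp_energy s) / (2 * s))"
proof -
  interpret AA: two_distributions \<alpha> \<alpha> by (rule two_distributions_same)
  interpret BB: two_distributions \<beta> \<beta> by (rule two_distributions_same)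
  have "has_bochner_integral lborel (\<lambda>z. A.lap s z * A.lap s z + B.lap s z * B.lap s z - 2 * (A.lap s z * B.lap s z))
     (AA.exp_energy s / (2 * s) + BB.exp_energy s / (2 * s) - 2 * (exp_energy s / (2 * s)))"
    using assms
    by (intro has_bochner_integral_diff has_bochner_integral_add has_bochner_integral_mult_right
        has_bochner_integral_lap_mult AA.has_bochner_integral_lap_mult BB.has_bochner_integral_lap_mult)
  then show ?thesis
    by (simp add: lap_diff_def power2_eq_square algebra_simps diff_divide_distrib add_divide_distrib)
qed

text \<open>The terms \<open>1 / s\<close> cancel, since two cross energies face two self-energies.
  What is left is a sum of squares over the frequencies \<open>s\<close>, that is, the conditional
  positive definiteness of the kernel.\<close>

lemma has_bochner_integral_energy_dist:
  assumes R: "0 \<le> R" and int: "integrable \<alpha> (\<lambda>x. x)" "integrable \<beta> (\<lambda>x. x)"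
  shows "has_bochner_integral lborel (\<lambda>s. indicator {0<..R} s * (2 * lap_norm_sq s)) (energy_dist R)"
proof -
  interpret AA: two_distributions \<alpha> \<alpha> by (rule two_distributions_same)
  interpret BB: two_distributions \<beta> \<beta> by (rule two_distributions_same)
  have "has_bochner_integral lborel (\<lambda>s. 2 * (indicator {0<..R} s * ((1 - exp_energy s) / s))
     - indicator {0<..R} s * ((1 - AA.exp_energy s) / s) - indicator {0<..R} s * ((1 - BB.exp_energy s) / s)) (energy_dist R)"
    unfolding energy_dist_def using assms
    by (intro has_bochner_integral_diff has_bochner_integral_mult_right
        has_bochner_integral_Ein_energy AA.has_bochner_integral_Ein_energy BB.has_bochner_integral_Ein_energy)
  moreover have "2 * (indicator {0<..R} s * ((1 - exp_energy s) / s))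
     - indicator {0<..R} s * ((1 - AA.exp_energy s) / s) - indicator {0<..R} s * ((1 - BB.exp_energy s) / s)
     = indicator {0<..R} s * (2 * lap_norm_sq s)" for s
  proof (cases "s \<in> {0<..R}")
    case True
    then have "s > 0" by simp
    show ?thesis
      unfolding has_bochner_integral_integral_eq[OF has_bochner_integral_lap_diff_sq[OF \<open>s > 0\<close>]]
      using True by (simp add: field_simps)
  qed auto
  ultimately show ?thesis by simp
qed

abbreviation tail_diff :: "real \<Rightarrow> real" where
  "tail_diff z \<equiv> \<bar>A.prob {z<..} - B.prob {z<..}\<bar>"

text \<open>Inverting the transform gives the difference of the tails as \<open>lap_diff s z\<close>
  plus \<open>s\<close> times the integral of \<open>lap_diff s\<close> over \<open>{z..}\<close>.
  The integral is cut at \<open>M\<close>: beyond it \<open>\<beta>\<close> has no mass and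
  \<open>\<alpha>\<close> contributes at most its tail probability divided by
  \<open>s\<close>.\<close>

lemma tail_diff_le:
  assumes s: "s > 0" and M: "B.prob {M<..} = 0" and z: "-M \<le> z" "z \<le> M"
  shows "tail_diff z
    \<le> \<bar>lap_diff s z\<bar> + s * lap_dist M s + A.prob {M<..}"
    and "integrable lborel (\<lambda>w. indicator {-M..M} w * \<bar>lap_diff s w\<bar>)"
proof -
  note A = A.has_bochner_integral_lap_atLeast[OF s] and B = B.has_bochner_integral_lap_atLeast[OF s]
  note Ai = A[THEN integrable.intros] and Bi = B[THEN integrable.intros]
  have Aeq: "(\<integral>w. A.lap s w * indicator {z..} w \<partial>lborel) = (A.prob {z<..} - A.lap s z) / s" for z
    using A by (rule has_bochner_integral_integral_eq)
  have Beq: "(\<integral>w. B.lap s w * indicator {z..} w \<partial>lborel) = (B.prob {z<..} - B.lap s z) / s" for z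
    using B by (rule has_bochner_integral_integral_eq)
  show int: "integrable lborel (\<lambda>w. indicator {-M..M} w * \<bar>lap_diff s w\<bar>)"
  proof (rule Bochner_Integration.integrable_bound[OF Bochner_Integration.integrable_add[OF Ai[of "-M"] Bi[of "-M"]]])
    show "AE w in lborel. norm (indicator {-M..M} w * \<bar>lap_diff s w\<bar>)
        \<le> norm (A.lap s w * indicator {-M..} w + B.lap s w * indicator {-M..} w)"
      using A.lap_nonneg[of s] B.lap_nonneg[of s] by (intro AE_I2) (auto simp: indicator_def lap_diff_def abs_le_iff add_increasing add_increasing2)
  qed measurable
  define D where "D = (\<integral>w. A.lap s w * indicator {z..} w - B.lap s w * indicator {z..} w \<partial>lborel)"
  have "D = (A.prob {z<..} - A.lap s z) / s - (B.prob {z<..} - B.lap s z) / s"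
    unfolding D_def by (subst Bochner_Integration.integral_diff) (auto simp: Ai Bi Aeq Beq)
  then have "D = ((A.prob {z<..} - A.lap s z) - (B.prob {z<..} - B.lap s z)) / s"
    by (simp only: diff_divide_distrib)
  then have "s * D = (A.prob {z<..} - A.lap s z) - (B.prob {z<..} - B.lap s z)"
    using s by simp
  then have D: "A.prob {z<..} - B.prob {z<..} = lap_diff s z + s * D"
    by (simp add: lap_diff_def)
  have "\<bar>D\<bar> \<le> (\<integral>w. indicator {-M..M} w * \<bar>lap_diff s w\<bar> + A.lap s w * indicator {M..} w + B.lap s w * indicator {M..} w \<partial>lborel)"
  proof -
    have "\<bar>D\<bar> \<le> (\<integral>w. \<bar>A.lap s w * indicator {z..} w - B.lap s w * indicator {z..} w\<bar> \<partial>lborel)"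
      unfolding D_def using integral_norm_bound[of lborel "\<lambda>w. A.lap s w * indicator {z..} w - B.lap s w * indicator {z..} w"] by simp
    also have "\<dots> \<le> (\<integral>w. indicator {-M..M} w * \<bar>lap_diff s w\<bar> + A.lap s w * indicator {M..} w + B.lap s w * indicator {M..} w \<partial>lborel)"
      using z A.lap_nonneg[of s] B.lap_nonneg[of s]
      by (intro integral_mono Bochner_Integration.integrable_add int Ai Bi integrable_abs Bochner_Integration.integrable_diff)
        (auto simp: indicator_def lap_diff_def abs_le_iff add_increasing add_increasing2)
    finally show ?thesis .
  qed
  also have "\<dots> = lap_dist M s + (A.prob {M<..} - A.lap s M) / s + (B.prob {M<..} - B.lap s M) / s"
    by (simp add: int Ai Bi Aeq Beq)
  also have "\<dots> \<le> lap_dist M s + A.prob {M<..} / s + 0"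
    using s M A.lap_nonneg[of s M] B.lap_nonneg[of s M]
    by (intro add_mono) (auto simp: divide_simps)
  finally have "s * \<bar>D\<bar> \<le> s * (lap_dist M s + A.prob {M<..} / s + 0)"
    using s by (intro mult_left_mono) auto
  also have "\<dots> = s * lap_dist M s + A.prob {M<..}"
    using s by (simp add: algebra_simps)
  finally have "s * \<bar>D\<bar> \<le> s * lap_dist M s + A.prob {M<..}" .
  moreover have "\<bar>lap_diff s z + s * D\<bar> \<le> \<bar>lap_diff s z\<bar> + s * \<bar>D\<bar>"
    using s abs_triangle_ineq[of "lap_diff s z" "s * D"] by (simp add: abs_mult)
  ultimately show "tail_diff z
    \<le> \<bar>lap_diff s z\<bar> + s * lap_dist M s + A.prob {M<..}"
    unfolding D by linarith
qed

definition tail_dist :: "real \<Rightarrow> real" where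
  "tail_dist M = (\<integral>z. indicator {-M..M} z * tail_diff z \<partial>lborel)"

lemma tail_prob_measurable [measurable]:
  "(\<lambda>z. A.prob {z<..}) \<in> borel_measurable borel" "(\<lambda>z. B.prob {z<..}) \<in> borel_measurable borel"
proof -
  have *: "A.prob {z<..} = A.prob UNIV - cdf \<alpha> z" "B.prob {z<..} = B.prob UNIV - cdf \<beta> z" for z
    unfolding cdf_def
    by (subst A.finite_measure_Diff[symmetric] B.finite_measure_Diff[symmetric]; auto intro: arg_cong[where f="measure _"])+
  have "cdf \<alpha> \<in> borel_measurable borel" "cdf \<beta> \<in> borel_measurable borel"
    by (auto intro!: borel_measurable_mono monoI A.cdf_nondecreasing B.cdf_nondecreasing)
  then show "(\<lambda>z. A.prob {z<..}) \<in> borel_measurable borel" "(\<lambda>z. B.prob {z<..}) \<in> borel_measurable borel"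
    unfolding * by auto
qed

lemma integrable_tail_diff: "integrable lborel (\<lambda>z. indicator {-M..M} z * tail_diff z)"
proof (rule Bochner_Integration.integrable_bound[of _ "\<lambda>z. indicator {-M..M} z :: real"])
  have "tail_diff z \<le> 1" for z
    using A.prob_le_1[of "{z<..}"] B.prob_le_1[of "{z<..}"] by (simp add: abs_le_iff measure_nonneg add_increasing2 diff_le_eq)
  then show "AE z in lborel. norm (indicator {-M..M} z * tail_diff z) \<le> norm (indicator {-M..M} z :: real)"
    by (auto simp: indicator_def)
qed auto

lemma tail_dist_nonneg: "0 \<le> tail_dist M"
  unfolding tail_dist_def by (intro Bochner_Integration.integral_nonneg) auto

lemma tail_dist_le:
  assumes s: "s > 0" and M: "B.prob {M<..} = 0" "M > 0"
  shows "tail_dist M \<le> (1 + 2 * M * s) * sqrt (2 * M * lap_norm_sq s) + 2 * M * A.prob {M<..}"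
proof -
  define I where "I = lap_dist M s"
  have int: "integrable lborel (\<lambda>w. indicator {-M..M} w * \<bar>lap_diff s w\<bar>)"
    using tail_diff_le(2)[OF s M(1), of 0] M by auto
  have int2: "integrable lborel (\<lambda>w. (lap_diff s w)\<^sup>2)"
    using has_bochner_integral_lap_diff_sq[OF s] by (rule integrable.intros)
  have "I \<ge> 0" unfolding I_def by (intro Bochner_Integration.integral_nonneg) auto
  have "tail_dist M \<le> (\<integral>z. indicator {-M..M} z * \<bar>lap_diff s z\<bar> + indicator {-M..M} z * (s * I + A.prob {M<..}) \<partial>lborel)"
    unfolding tail_dist_def
  proof (intro integral_mono integrable_tail_diff Bochner_Integration.integrable_add int)
    show "indicator {-M..M} z * tail_diff z
      \<le> indicator {-M..M} z * \<bar>lap_diff s z\<bar> + indicator {-M..M} z * (s * I + A.prob {M<..})" for z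
      using tail_diff_le(1)[OF s M(1), of z] by (auto simp: indicator_def I_def)
  qed auto
  also have "\<dots> = I + 2 * M * (s * I + A.prob {M<..})"
    using M int by (simp add: I_def)
  finally have 1: "tail_dist M \<le> (1 + 2 * M * s) * I + 2 * M * A.prob {M<..}"
    by (simp add: algebra_simps)
  \<comment> \<open>Cauchy-Schwarz on \<open>{-M..M}\<close> by expanding a square; \<open>m\<close>
    is the mean of \<open>\<bar>lap_diff s\<bar>\<close> over the window, the best constant to
    subtract.\<close>
  define m where "m = I / (2 * M)"
  have "0 \<le> (\<integral>w. (lap_diff s w)\<^sup>2 - 2 * m * (indicator {-M..M} w * \<bar>lap_diff s w\<bar>) + m\<^sup>2 * indicator {-M..M} w \<partial>lborel)"
  proof (intro Bochner_Integration.integral_nonneg)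
    show "0 \<le> (lap_diff s w)\<^sup>2 - 2 * m * (indicator {-M..M} w * \<bar>lap_diff s w\<bar>) + m\<^sup>2 * indicator {-M..M} w" for w
      using zero_le_power2[of "\<bar>lap_diff s w\<bar> - m"] by (auto simp: indicator_def power2_eq_square algebra_simps)
  qed
  also have "\<dots> = lap_norm_sq s - 2 * m * I + m\<^sup>2 * (2 * M)"
  proof (intro has_bochner_integral_integral_eq has_bochner_integral_add has_bochner_integral_diff has_bochner_integral_mult_right)
    show "has_bochner_integral lborel (\<lambda>w. indicator {-M..M} w * \<bar>lap_diff s w\<bar>) I"
      unfolding I_def using int by (rule has_bochner_integral_integrable)
    show "has_bochner_integral lborel (indicat_real {-M..M}) (2 * M)"
      using M by (simp add: has_bochner_integral_iff)
  qed (use int2 in \<open>rule has_bochner_integral_integrable\<close>)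
  finally have "0 \<le> lap_norm_sq s - 2 * m * I + m\<^sup>2 * (2 * M)" .
  moreover have "2 * m * I = I\<^sup>2 / (2 * M) + I\<^sup>2 / (2 * M)" "m\<^sup>2 * (2 * M) = I\<^sup>2 / (2 * M)"
    using M by (simp_all add: m_def power2_eq_square)
  ultimately have "I\<^sup>2 / (2 * M) \<le> lap_norm_sq s"
    by linarith
  then have "I\<^sup>2 \<le> 2 * M * lap_norm_sq s"
    using M by (simp add: divide_simps mult.commute)
  then have "I \<le> sqrt (2 * M * lap_norm_sq s)"
    by (rule real_le_rsqrt)
  then have "(1 + 2 * M * s) * I \<le> (1 + 2 * M * s) * sqrt (2 * M * lap_norm_sq s)"
    using M s by (intro mult_left_mono) auto
  with 1 show ?thesis by linarith
qed

definition far_moment :: "nat \<Rightarrow> real \<Rightarrow> real" where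
  "far_moment k M = (\<integral>x. indicator {x. M < \<bar>x\<bar>} x * \<bar>x\<bar> ^ k \<partial>\<alpha>)"

text \<open>The errors outside the window enter squared estimates. Both are brought down to the
  second moment, which is what a quadratically growing potential controls.\<close>

lemma
  assumes int: "integrable \<alpha> (\<lambda>x. x\<^sup>2)" and M: "1 \<le> M"
  shows integrable_far: "integrable \<alpha> (\<lambda>x. indicator {x. M < \<bar>x\<bar>} x * \<bar>x\<bar>\<^sup>2)" "integrable \<alpha> (\<lambda>x. indicator {x. M < \<bar>x\<bar>} x * \<bar>x\<bar>)"
    and far_moment_1_sq: "(far_moment 1 M)\<^sup>2 \<le> far_moment 2 M"
    and tail_prob_sq: "(A.prob {M<..})\<^sup>2 \<le> far_moment 2 M"
proof -
  show i2: "integrable \<alpha> (\<lambda>x. indicator {x. M < \<bar>x\<bar>} x * \<bar>x\<bar>\<^sup>2)"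
    by (rule Bochner_Integration.integrable_bound[OF int]) (auto simp: indicator_def)
  have sq: "\<bar>x\<bar> \<le> x\<^sup>2" if "M < \<bar>x\<bar>" for x
    using that M mult_left_mono[of 1 "\<bar>x\<bar>" "\<bar>x\<bar>"] by (simp add: power2_eq_square abs_mult_self_eq)
  show i1: "integrable \<alpha> (\<lambda>x. indicator {x. M < \<bar>x\<bar>} x * \<bar>x\<bar>)"
    by (rule Bochner_Integration.integrable_bound[OF int]) (auto simp: indicator_def sq)
  let ?m = "far_moment 1 M"
  \<comment> \<open>Nonnegativity of a variance.\<close>
  have "0 \<le> (\<integral>x. (indicator {x. M < \<bar>x\<bar>} x * \<bar>x\<bar> - ?m)\<^sup>2 \<partial>\<alpha>)"
    by (intro Bochner_Integration.integral_nonneg) auto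
  also have "\<dots> = (\<integral>x. indicator {x. M < \<bar>x\<bar>} x * \<bar>x\<bar>\<^sup>2 - 2 * ?m * (indicator {x. M < \<bar>x\<bar>} x * \<bar>x\<bar>) + ?m\<^sup>2 \<partial>\<alpha>)"
    by (intro Bochner_Integration.integral_cong) (auto simp: indicator_def power2_eq_square algebra_simps)
  also have "\<dots> = far_moment 2 M - 2 * ?m * ?m + ?m\<^sup>2"
  proof -
    have "(\<integral>x. indicator {x. M < \<bar>x\<bar>} x * \<bar>x\<bar> \<partial>\<alpha>) = ?m" by (simp add: far_moment_def)
    moreover have "(\<integral>x. indicator {x. M < \<bar>x\<bar>} x * \<bar>x\<bar>\<^sup>2 \<partial>\<alpha>) = far_moment 2 M" by (simp only: far_moment_def)
    ultimately show ?thesis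
      using i1 i2 by (subst Bochner_Integration.integral_add Bochner_Integration.integral_diff;
        (intro Bochner_Integration.integrable_add Bochner_Integration.integrable_diff integrable_mult_right)?)+ auto
  qed
  finally show "(far_moment 1 M)\<^sup>2 \<le> far_moment 2 M"
    by (simp add: power2_eq_square)
  have "A.prob {M<..} = (\<integral>x. indicator {M<..} x \<partial>\<alpha>)" by simp
  also have "\<dots> \<le> far_moment 2 M"
    unfolding far_moment_def
  proof (intro integral_mono i2 A.integrable_bounded[where B=1])
    fix x
    show "indicat_real {M<..} x \<le> indicator {x. M < \<bar>x\<bar>} x * \<bar>x\<bar>\<^sup>2"
      using sq[of x] M by (auto simp: indicator_def)
  qed (auto simp: indicator_def)
  finally have "A.prob {M<..} \<le> far_moment 2 M" .
  moreover have "(A.prob {M<..})\<^sup>2 \<le> A.prob {M<..}"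
    by (simp add: power2_eq_square mult_left_le_one_le)
  ultimately show "(A.prob {M<..})\<^sup>2 \<le> far_moment 2 M" by simp
qed

text \<open>Only frequencies \<open>s \<le> 1\<close> are used. There the factor
  \<open>1 + 2 * M * s\<close> is at most \<open>1 + 2 * M\<close>, so a single lower bound holds
  for all the norms and survives integration over \<open>{0<..1}\<close>, whatever
  \<open>R \<ge> 1\<close> is.\<close>

lemma energy_dist_ge:
  assumes int: "integrable \<alpha> (\<lambda>x. x\<^sup>2)" "integrable \<beta> (\<lambda>x. x)" and R: "1 \<le> R" and M: "1 \<le> M" "B.prob {M<..} = 0"
  shows "(tail_dist M + far_moment 1 M)\<^sup>2 \<le> 6 * M * (1 + 2 * M)\<^sup>2 * energy_dist R + (12 * M\<^sup>2 + 3) * far_moment 2 M"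
proof -
  define w where "w = tail_dist M + far_moment 1 M"
  define K where "K = 6 * M * (1 + 2 * M)\<^sup>2"
  \<comment> \<open>The lower bound for \<open>lap_norm_sq s\<close> obtained by solving the squared
    estimate. The constants come from \<open>(a + b + c)\<^sup>2 \<le> 3 * a\<^sup>2 + 3 * b\<^sup>2
    + 3 * c\<^sup>2\<close>.\<close>
  define q where "q = (w\<^sup>2 - (12 * M\<^sup>2 + 3) * far_moment 2 M) / K"
  have K: "K > 0" using M by (simp add: K_def)
  have int1: "integrable \<alpha> (\<lambda>x. x)"
  proof (rule Bochner_Integration.integrable_bound[of _ "\<lambda>x. 1 + x\<^sup>2"])
    show "AE x in \<alpha>. norm x \<le> norm (1 + x\<^sup>2)"
      using abs_le_one_plus_square by (intro AE_I2) (auto intro: order_trans[OF _ abs_ge_self])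
    show "integrable \<alpha> (\<lambda>x. 1 + x\<^sup>2)"
      using int(1) by (intro Bochner_Integration.integrable_add) auto
  qed measurable
  have q_le: "q \<le> lap_norm_sq s" if s: "0 < s" "s \<le> 1" for s
  proof -
    define L where "L = lap_norm_sq s"
    have "L \<ge> 0" unfolding L_def by (intro Bochner_Integration.integral_nonneg) auto
    have "2 * M * s \<le> 2 * M" using s M mult_left_le[of s "2 * M"] by simp
    then have "(1 + 2 * M * s) * sqrt (2 * M * L) \<le> (1 + 2 * M) * sqrt (2 * M * L)"
      using M \<open>L \<ge> 0\<close> by (intro mult_right_mono) auto
    then have "w \<le> (1 + 2 * M) * sqrt (2 * M * L) + 2 * M * A.prob {M<..} + far_moment 1 M"
      using tail_dist_le[OF s(1) M(2)] M by (simp add: w_def L_def)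
    moreover have "0 \<le> far_moment 1 M"
      unfolding far_moment_def by (intro Bochner_Integration.integral_nonneg) auto
    then have "0 \<le> w" using tail_dist_nonneg by (simp add: w_def)
    ultimately have "w\<^sup>2 \<le> ((1 + 2 * M) * sqrt (2 * M * L) + 2 * M * A.prob {M<..} + far_moment 1 M)\<^sup>2"
      by (rule power_mono)
    also have "\<dots> \<le> 3 * ((1 + 2 * M) * sqrt (2 * M * L))\<^sup>2 + 3 * (2 * M * A.prob {M<..})\<^sup>2 + 3 * (far_moment 1 M)\<^sup>2"
    proof -
      have "(a + b + c)\<^sup>2 \<le> 3 * a\<^sup>2 + 3 * b\<^sup>2 + 3 * c\<^sup>2" for a b c :: real
        using zero_le_power2[of "a - b"] zero_le_power2[of "b - c"] zero_le_power2[of "a - c"]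
        by (simp add: power2_eq_square algebra_simps)
      then show ?thesis .
    qed
    also have "\<dots> = K * L + 12 * M\<^sup>2 * (A.prob {M<..})\<^sup>2 + 3 * (far_moment 1 M)\<^sup>2"
      using M \<open>L \<ge> 0\<close> by (simp add: power_mult_distrib K_def)
    also have "\<dots> \<le> K * L + 12 * M\<^sup>2 * far_moment 2 M + 3 * far_moment 2 M"
      using far_moment_1_sq[OF int(1) M(1)] tail_prob_sq[OF int(1) M(1)] K \<open>L \<ge> 0\<close>
      by (intro add_mono mult_left_mono) auto
    finally have "w\<^sup>2 - (12 * M\<^sup>2 + 3) * far_moment 2 M \<le> K * L"
      by (simp add: algebra_simps)
    then show ?thesis
      using K by (simp add: q_def L_def divide_simps mult.commute)
  qed
  have E: "has_bochner_integral lborel (\<lambda>s. indicator {0<..R} s * (2 * lap_norm_sq s)) (energy_dist R)"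
    using R int int1 by (intro has_bochner_integral_energy_dist) auto
  have "(\<integral>s. indicator {0<..1::real} s * (2 * max q 0) \<partial>lborel) \<le> (\<integral>s. indicator {0<..R} s * (2 * lap_norm_sq s) \<partial>lborel)"
  proof (rule integral_mono)
    show "indicator {0<..1} s * (2 * max q 0) \<le> indicator {0<..R} s * (2 * lap_norm_sq s)" for s
      using q_le[of s] R by (auto simp: indicator_def)
  qed (use E in \<open>auto intro: integrable.intros\<close>)
  then have "2 * max q 0 \<le> energy_dist R"
    using has_bochner_integral_integral_eq[OF E] by simp
  then have "q \<le> energy_dist R" by (auto simp: max_def split: if_splits)
  then show ?thesis
    using K by (simp add: q_def w_def K_def divide_simps algebra_simps)
qed

end

subsection \<open>Bounding the transport cost\<close>

text \<open>The monotone coupling: both quantile functions are evaluated at the same uniform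
  variable. Its cost is the area between the two graphs, and Tonelli's theorem measures that area
  either by quantiles or by distribution functions.\<close>

lemma W1_le_cdf:
  assumes "real_distribution \<alpha>" "real_distribution \<beta>"
  shows "W1 \<alpha> \<beta> \<le> (\<integral>\<^sup>+z. ennreal \<bar>cdf \<alpha> z - cdf \<beta> z\<bar> \<partial>lborel)"
proof -
  interpret A: cdf_distribution \<alpha> using assms by (simp add: cdf_distribution_def)
  interpret B: cdf_distribution \<beta> using assms by (simp add: cdf_distribution_def)
  let ?d = "\<lambda>z u. ennreal \<bar>indicator {u..} (cdf \<alpha> z) - indicator {u..} (cdf \<beta> z)\<bar>"
  let ?\<Omega> = "restrict_space lborel {0<..<1::real}"
  interpret \<Omega>: prob_space ?\<Omega>
    by (auto simp add: emeasure_restrict_space space_restrict_space intro!: prob_spaceI)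
  have mA [measurable]: "A.I \<in> borel_measurable ?\<Omega>" and mB [measurable]: "B.I \<in> borel_measurable ?\<Omega>"
    using A.measurable_CI B.measurable_CI by (auto simp: measurable_def space_restrict_space sets_restrict_space)
  let ?\<pi> = "distr ?\<Omega> (borel \<Otimes>\<^sub>M borel) (\<lambda>u. (A.I u, B.I u))"
  have pm: "(\<lambda>u. (A.I u, B.I u)) \<in> ?\<Omega> \<rightarrow>\<^sub>M borel \<Otimes>\<^sub>M borel" by measurable
  have "?\<pi> \<in> couplings \<alpha> \<beta>"
    unfolding couplings_def
    using A.distr_I_eq_M B.distr_I_eq_M pm
    by (auto intro!: \<Omega>.prob_space_distr simp: distr_distr o_def)
  then have "W1 \<alpha> \<beta> \<le> (\<integral>\<^sup>+p. ennreal \<bar>fst p - snd p\<bar> \<partial>?\<pi>)"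
    unfolding W1_def by (rule INF_lower)
  also have "\<dots> = (\<integral>\<^sup>+u. ennreal \<bar>A.I u - B.I u\<bar> \<partial>?\<Omega>)"
    by (subst nn_integral_distr) auto
  also have "\<dots> = (\<integral>\<^sup>+u. (\<integral>\<^sup>+z. ?d z u \<partial>lborel) \<partial>?\<Omega>)"
  proof (rule nn_integral_cong)
    fix u assume "u \<in> space ?\<Omega>"
    then have u: "0 < u" "u < 1" by (auto simp: space_restrict_space)
    have "ennreal \<bar>A.I u - B.I u\<bar> = emeasure lborel {min (A.I u) (B.I u)..<max (A.I u) (B.I u)}"
      by (simp add: min_def max_def)
    also have "\<dots> = (\<integral>\<^sup>+z. indicator {min (A.I u) (B.I u)..<max (A.I u) (B.I u)} z \<partial>lborel)"
      by simp
    also have "\<dots> = (\<integral>\<^sup>+z. ?d z u \<partial>lborel)"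
    proof (rule nn_integral_cong)
      fix z
      show "indicator {min (A.I u) (B.I u)..<max (A.I u) (B.I u)} z
          = ?d z u"
        using A.pseudoinverse[OF u, of z] B.pseudoinverse[OF u, of z]
        by (auto simp: indicator_def min_le_iff_disj less_max_iff_disj)
    qed
    finally show "ennreal \<bar>A.I u - B.I u\<bar> = (\<integral>\<^sup>+z. ?d z u \<partial>lborel)" .
  qed
  also have "\<dots> = (\<integral>\<^sup>+z. (\<integral>\<^sup>+u. ?d z u \<partial>?\<Omega>) \<partial>lborel)"
  proof -
    interpret P: pair_sigma_finite ?\<Omega> lborel
      by unfold_locales
    have [measurable]: "(\<lambda>u. u) \<in> borel_measurable ?\<Omega>"
      by (rule measurable_restrict_space1) simp
    have "(\<lambda>(u, z). ennreal \<bar>(if u \<le> cdf \<alpha> z then 1 else 0) - (if u \<le> cdf \<beta> z then 1 else 0)\<bar>) \<in> borel_measurable (?\<Omega> \<Otimes>\<^sub>M lborel)"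
      by measurable
    then show ?thesis
      by (intro P.Fubini'[symmetric]) (simp add: indicator_def)
  qed
  also have "\<dots> = (\<integral>\<^sup>+z. ennreal \<bar>cdf \<alpha> z - cdf \<beta> z\<bar> \<partial>lborel)"
  proof (rule nn_integral_cong)
    fix z
    have bnd: "0 \<le> cdf \<alpha> z" "cdf \<alpha> z \<le> 1" "0 \<le> cdf \<beta> z" "cdf \<beta> z \<le> 1"
      using A.cdf_bounded_prob B.cdf_bounded_prob by (auto simp: cdf_def)
    have "(\<integral>\<^sup>+u. ?d z u \<partial>?\<Omega>)
        = (\<integral>\<^sup>+u. ?d z u * indicator {0<..<1} u \<partial>lborel)"
      by (subst nn_integral_restrict_space) auto
    also have "\<dots> = (\<integral>\<^sup>+u. indicator {min (cdf \<alpha> z) (cdf \<beta> z)<..max (cdf \<alpha> z) (cdf \<beta> z)} u \<partial>lborel)"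
    proof (rule nn_integral_cong_AE)
      show "AE u in lborel. ?d z u * indicator {0<..<1} u
        = indicator {min (cdf \<alpha> z) (cdf \<beta> z)<..max (cdf \<alpha> z) (cdf \<beta> z)} u"
        using AE_lborel_singleton[of 1]
        by eventually_elim (use bnd in \<open>auto simp: indicator_def min_less_iff_disj le_max_iff_disj\<close>)
    qed
    also have "\<dots> = ennreal \<bar>cdf \<alpha> z - cdf \<beta> z\<bar>"
      by (simp add: min_def max_def)
    finally show "(\<integral>\<^sup>+u. ?d z u \<partial>?\<Omega>) = ennreal \<bar>cdf \<alpha> z - cdf \<beta> z\<bar>" .
  qed
  finally show ?thesis .
qed

context two_distributions
begin

text \<open>Outside the window the distribution function of \<open>\<beta>\<close> is
  \<open>0\<close> or \<open>1\<close>, so only the tails of \<open>\<alpha>\<close> remain.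
  Integrating them in layers produces the first moment of \<open>\<alpha>\<close> outside the
  window.\<close>

lemma W1_le_tail_dist:
  assumes int: "integrable \<alpha> (\<lambda>x. x\<^sup>2)" and M: "1 \<le> M" "B.prob {M<..} = 0" "B.prob {..<-M} = 0"
  shows "W1 \<alpha> \<beta> \<le> ennreal (tail_dist M + far_moment 1 M)"
proof -
  have A: "A.prob {z<..} = 1 - cdf \<alpha> z" and B: "B.prob {z<..} = 1 - cdf \<beta> z" for z
    unfolding cdf_def
    by (subst A.prob_compl[symmetric] B.prob_compl[symmetric]; auto intro: arg_cong[where f="measure _"])+
  have Bl: "cdf \<beta> z = 0" if "z < -M" for z
  proof -
    have "B.prob {..z} \<le> B.prob {..<-M}" using that by (intro B.finite_measure_mono) auto
    then show ?thesis using M(3) by (simp add: cdf_def measure_le_0_iff)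
  qed
  have Br: "cdf \<beta> z = 1" if "M < z" for z
  proof -
    have "B.prob {z<..} \<le> B.prob {M<..}" using that by (intro B.finite_measure_mono) auto
    then show ?thesis using M(2) B[of z] measure_nonneg[of \<beta> "{z<..}"] by simp
  qed
  interpret P: pair_sigma_finite lborel \<alpha> by unfold_locales
  \<comment> \<open>Averaged over \<open>x\<close>, this is the upper tail of
    \<open>\<alpha>\<close> for \<open>z > M\<close> and the lower tail for \<open>z < -M\<close>;
    integrated over \<open>z\<close>, it is the distance of \<open>x\<close> from the
    window.\<close>
  let ?f = "\<lambda>z x. indicator {z. M < z \<and> z < x} z + indicator {z. z < -M \<and> x \<le> z} z :: ennreal"
  have "W1 \<alpha> \<beta> \<le> (\<integral>\<^sup>+z. ennreal \<bar>cdf \<alpha> z - cdf \<beta> z\<bar> \<partial>lborel)"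
    by (intro W1_le_cdf A.real_distribution_axioms B.real_distribution_axioms)
  also have "\<dots> \<le> (\<integral>\<^sup>+z. ennreal (indicator {-M..M} z * tail_diff z) + (\<integral>\<^sup>+x. ?f z x \<partial>\<alpha>) \<partial>lborel)"
  proof (rule nn_integral_mono)
    fix z :: real
    have *: "(\<integral>\<^sup>+x. ?f z x \<partial>\<alpha>) = ennreal (A.prob {z<..})" if "M < z"
    proof -
      have "(\<integral>\<^sup>+x. ?f z x \<partial>\<alpha>) = (\<integral>\<^sup>+x. indicator {z<..} x \<partial>\<alpha>)"
        using that M by (intro nn_integral_cong) (auto simp: indicator_def)
      then show ?thesis by (simp add: A.emeasure_eq_measure)
    qed
    have **: "(\<integral>\<^sup>+x. ?f z x \<partial>\<alpha>) = ennreal (cdf \<alpha> z)" if "z < -M"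
    proof -
      have "(\<integral>\<^sup>+x. ?f z x \<partial>\<alpha>) = (\<integral>\<^sup>+x. indicator {..z} x \<partial>\<alpha>)"
        using that M by (intro nn_integral_cong) (auto simp: indicator_def)
      then show ?thesis by (simp add: A.emeasure_eq_measure cdf_def)
    qed
    consider "z < -M" | "z \<in> {-M..M}" | "M < z" by fastforce
    then show "ennreal \<bar>cdf \<alpha> z - cdf \<beta> z\<bar>
      \<le> ennreal (indicator {-M..M} z * tail_diff z) + (\<integral>\<^sup>+x. ?f z x \<partial>\<alpha>)"
    proof cases
      case 1
      then show ?thesis using **[OF 1] Bl[OF 1] by (simp add: cdf_def)
    next
      case 2
      then have "\<bar>cdf \<alpha> z - cdf \<beta> z\<bar> = indicator {-M..M} z * tail_diff z"
        by (simp add: A B)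
      then show ?thesis by (simp add: add_increasing2)
    next
      case 3
      have "\<bar>cdf \<alpha> z - 1\<bar> = A.prob {z<..}"
        using A[of z] measure_nonneg[of \<alpha> "{z<..}"] by linarith
      then show ?thesis using *[OF 3] Br[OF 3] by simp
    qed
  qed
  also have "\<dots> = (\<integral>\<^sup>+z. ennreal (indicator {-M..M} z * tail_diff z) \<partial>lborel)
      + (\<integral>\<^sup>+z. (\<integral>\<^sup>+x. ?f z x \<partial>\<alpha>) \<partial>lborel)"
    by (intro nn_integral_add) measurable
  also have "(\<integral>\<^sup>+z. ennreal (indicator {-M..M} z * tail_diff z) \<partial>lborel) = ennreal (tail_dist M)"
    unfolding tail_dist_def by (intro nn_integral_eq_integral integrable_tail_diff) auto
  also have "(\<integral>\<^sup>+z. (\<integral>\<^sup>+x. ?f z x \<partial>\<alpha>) \<partial>lborel) = (\<integral>\<^sup>+x. (\<integral>\<^sup>+z. ?f z x \<partial>lborel) \<partial>\<alpha>)"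
    by (intro P.Fubini'[symmetric]) measurable
  also have "\<dots> \<le> (\<integral>\<^sup>+x. ennreal (indicator {x. M < \<bar>x\<bar>} x * \<bar>x\<bar>) \<partial>\<alpha>)"
  proof (rule nn_integral_mono)
    fix x :: real
    have "(\<integral>\<^sup>+z. ?f z x \<partial>lborel) = (\<integral>\<^sup>+z. indicator {M<..<x} z + indicator {x..<-M} z \<partial>lborel)"
      by (intro nn_integral_cong) (auto simp: indicator_def)
    also have "\<dots> = emeasure lborel {M<..<x} + emeasure lborel {x..<-M}"
      by (subst nn_integral_add) auto
    also have "\<dots> \<le> ennreal (indicator {x. M < \<bar>x\<bar>} x * \<bar>x\<bar>)"
      using M(1) by (cases "M < x"; cases "x < -M") (auto simp: indicator_def intro!: ennreal_leI)
    finally show "(\<integral>\<^sup>+z. ?f z x \<partial>lborel) \<le> ennreal (indicator {x. M < \<bar>x\<bar>} x * \<bar>x\<bar>)" .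
  qed
  also have "\<dots> = ennreal (far_moment 1 M)"
    unfolding far_moment_def using integrable_far(2)[OF int M(1)]
    by (subst nn_integral_eq_integral) auto
  also have "ennreal (tail_dist M) + ennreal (far_moment 1 M) = ennreal (tail_dist M + far_moment 1 M)"
    by (intro ennreal_plus[symmetric] tail_dist_nonneg) (auto simp: far_moment_def intro!: Bochner_Integration.integral_nonneg)
  finally show ?thesis by (auto simp: add_left_mono)
qed

end

subsection \<open>The Poisson integral of the logarithm\<close>

lemma integrable_inverse_sqrt:
  "integrable lborel (\<lambda>u. indicator {0..c} u * (1 / sqrt u))"
proof (cases "c \<ge> 0")
  case True
  have hi: "((\<lambda>u. u powr (-1/2)) has_integral (c powr (-1/2+1) / (-1/2+1))) {0..c}"
    using True by (intro has_integral_powr_from_0) auto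
  have "has_bochner_integral lborel (\<lambda>u. indicator {0..c} u * (1 / sqrt u)) (c powr (-1/2+1) / (-1/2+1))"
  proof (rule has_bochner_integral_nn_integral)
    have "(\<integral>\<^sup>+u. ennreal (indicator {0..c} u * (1 / sqrt u)) \<partial>lborel)
        = (\<integral>\<^sup>+u. ennreal (u powr (-1/2)) * indicator {0..c} u \<partial>lborel)"
      by (intro nn_integral_cong) (auto simp: indicator_def powr_minus powr_half_sqrt divide_simps)
    also have "\<dots> = ennreal (c powr (-1/2+1) / (-1/2+1))"
      using hi by (intro nn_integral_has_integral_lebesgue') auto
    finally show "(\<integral>\<^sup>+u. ennreal (indicator {0..c} u * (1 / sqrt u)) \<partial>lborel) = ennreal (c powr (-1/2+1) / (-1/2+1))" .
  qed (auto simp: indicator_def)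
  then show ?thesis by (rule integrable.intros)
qed auto

lemma neg_ln_le:
  assumes "0 < (c::real)"
  shows "- ln c \<le> 2 * (1 / sqrt c)"
proof -
  have "ln (1 / sqrt c) \<le> 1 / sqrt c"
    using assms ln_le_minus_one[of "1 / sqrt c"] by simp
  then show ?thesis
    using assms by (simp add: ln_div ln_sqrt)
qed

text \<open>An integrable majorant of the singularity of \<open>ln \<bar>u\<bar>\<close> at
  \<open>0\<close>, with a power in place of the logarithm.\<close>

definition ln_sing :: "real \<Rightarrow> real" where
  "ln_sing u = indicator {-1..1} u * (2 * (1 / sqrt \<bar>u\<bar>))"

lemma ln_sing_measurable [measurable]: "ln_sing \<in> borel_measurable borel"
  unfolding ln_sing_def by measurable

lemma ln_sing_nonneg: "0 \<le> ln_sing u"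
  by (simp add: ln_sing_def)

lemma integrable_ln_sing: "integrable lborel ln_sing"
proof (rule Bochner_Integration.integrable_bound)
  let ?g = "\<lambda>u. indicator {0..1} u * (1 / sqrt u)"
  show "integrable lborel (\<lambda>u. 2 * (?g u + ?g (0 + (-1) * u)))"
    by (intro integrable_mult_right Bochner_Integration.integrable_add lborel_integrable_real_affine integrable_inverse_sqrt) auto
  show "AE u in lborel. norm (ln_sing u) \<le> norm (2 * (?g u + ?g (0 + (-1) * u)))"
    by (intro AE_I2) (auto simp: ln_sing_def indicator_def)
qed measurable

lemma abs_ln_abs_le: "\<bar>ln \<bar>u\<bar>\<bar> \<le> \<bar>u\<bar> + ln_sing (u::real)"
proof (cases "u = 0 \<or> 1 \<le> \<bar>u\<bar>")
  case True
  then show ?thesis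
  proof
    assume "1 \<le> \<bar>u\<bar>"
    then have "\<bar>ln \<bar>u\<bar>\<bar> \<le> \<bar>u\<bar>" using ln_bound[of "\<bar>u\<bar>"] by (auto simp: abs_of_nonneg)
    then show ?thesis using ln_sing_nonneg[of u] by linarith
  qed (simp add: ln_sing_nonneg)
next
  case False
  then have "ln_sing u = 2 * (1 / sqrt \<bar>u\<bar>)" by (auto simp: ln_sing_def indicator_def)
  then show ?thesis
    using False neg_ln_le[of "\<bar>u\<bar>"] ln_less_zero[of "\<bar>u\<bar>"] by auto
qed

abbreviation half_circle :: "real set" where
  "half_circle \<equiv> {- (pi / 2)<..<pi / 2}"

lemma has_bochner_integral_half_circle: "has_bochner_integral lborel (indicat_real half_circle) pi"
  by (simp add: has_bochner_integral_iff integrable_real_indicator)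

text \<open>In terms of the distance \<open>y\<close> to the nearer endpoint the claim is
  \<open>sin y \<ge> y / 2\<close>. It follows from the half-angle formula,
  \<open>tan (y / 2) \<ge> y / 2\<close> and \<open>cos (y / 2) \<ge> sqrt 2 / 2\<close>. The linear
  bound reduces integrability at the endpoints to that of \<open>1 / sqrt u\<close>.\<close>

lemma cos_lower:
  assumes "\<theta> \<in> half_circle"
  shows "(pi / 2 - \<bar>\<theta>\<bar>) / 2 \<le> cos \<theta>"
proof -
  define y where "y = pi / 2 - \<bar>\<theta>\<bar>"
  have y: "0 < y" "y \<le> pi / 2" using assms by (auto simp: y_def)
  have "cos \<theta> = sin y" by (simp add: y_def sin_diff)
  also have "sin y = 2 * sin (y / 2) * cos (y / 2)" using sin_double[of "y / 2"] by simp
  also have "\<dots> \<ge> y / 2"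
  proof -
    have c: "cos (y / 2) \<ge> sqrt 2 / 2"
      using cos_monotone_0_pi_le[of "y / 2" "pi / 4"] y by (simp add: cos_45)
    have "y / 2 \<le> tan (y / 2)"
    proof -
      have "y / 2 < pi / 2" using y by simp
      moreover have "0 < y / 2" using y by simp
      ultimately have "arctan (tan (y / 2)) \<le> tan (y / 2)"
        by (intro arctan_le_self tan_gt_zero[THEN less_imp_le])
      then show ?thesis using y by (simp add: arctan_tan)
    qed
    moreover have "cos (y / 2) > 0" by (rule less_le_trans[OF _ c]) simp
    ultimately have "y / 2 * cos (y / 2) \<le> sin (y / 2)" by (simp add: tan_def field_simps)
    then have "y / 2 * cos (y / 2) * cos (y / 2) \<le> sin (y / 2) * cos (y / 2)"
      using \<open>cos (y / 2) > 0\<close> by (intro mult_right_mono) auto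
    moreover have "1 / 2 \<le> cos (y / 2) * cos (y / 2)"
      using mult_mono[OF c c] \<open>cos (y / 2) > 0\<close> by simp
    then have "y / 2 * (1 / 2) \<le> y / 2 * (cos (y / 2) * cos (y / 2))"
      using y by (intro mult_left_mono) auto
    ultimately show ?thesis by (simp add: algebra_simps)
  qed
  finally show ?thesis by (simp add: y_def)
qed

lemma cos_pos_half_circle: "\<theta> \<in> half_circle \<Longrightarrow> 0 < cos \<theta>"
  using cos_gt_zero_pi by auto

lemma integrable_inverse_sqrt_cos:
  "integrable lborel (\<lambda>\<theta>. indicator half_circle \<theta> * (1 / sqrt (cos \<theta>)))"
proof (rule Bochner_Integration.integrable_bound)
  let ?g = "\<lambda>u. indicator {0..pi} u * (1 / sqrt u)"
  show "integrable lborel (\<lambda>u. sqrt 2 * (?g (pi / 2 + 1 * u) + ?g (pi / 2 + (-1) * u)))"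
    by (intro integrable_mult_right Bochner_Integration.integrable_add lborel_integrable_real_affine integrable_inverse_sqrt) auto
  have "indicator half_circle u * (1 / sqrt (cos u)) \<le> sqrt 2 * (?g (pi / 2 + 1 * u) + ?g (pi / 2 + (-1) * u))" for u
  proof (cases "u \<in> half_circle")
    case True
    define \<delta> where "\<delta> = pi / 2 - \<bar>u\<bar>"
    have \<delta>: "0 < \<delta>" "\<delta> \<le> pi" using True by (auto simp: \<delta>_def)
    have "1 / sqrt (cos u) \<le> 1 / sqrt (\<delta> / 2)"
      using cos_lower[OF True] cos_pos_half_circle[OF True] \<delta>
      by (intro divide_left_mono) (auto simp: \<delta>_def)
    also have "\<dots> = sqrt 2 * (1 / sqrt \<delta>)"
      by (simp add: real_sqrt_divide)
    also have "1 / sqrt \<delta> = ?g \<delta>" using \<delta> by (simp add: indicator_def)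
    also have "?g \<delta> \<le> ?g (pi / 2 + 1 * u) + ?g (pi / 2 + (-1) * u)"
    proof (cases "u \<ge> 0")
      case True
      then have "?g \<delta> = ?g (pi / 2 + (-1) * u)" by (simp add: \<delta>_def)
      moreover have "0 \<le> ?g (pi / 2 + 1 * u)" by (auto simp: indicator_def)
      ultimately show ?thesis by linarith
    next
      case False
      then have "?g \<delta> = ?g (pi / 2 + 1 * u)" by (simp add: \<delta>_def)
      moreover have "0 \<le> ?g (pi / 2 + (-1) * u)" by (auto simp: indicator_def)
      ultimately show ?thesis by linarith
    qed
    finally show ?thesis using True by simp
  qed (auto simp: indicator_def)
  moreover have "0 \<le> indicator half_circle u * (1 / sqrt (cos u))" for u
    using cos_pos_half_circle[of u] by (auto simp: indicator_def)
  ultimately show "AE u in lborel. norm (indicator half_circle u * (1 / sqrt (cos u)))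
      \<le> norm (sqrt 2 * (?g (pi / 2 + 1 * u) + ?g (pi / 2 + (-1) * u)))"
    by (intro AE_I2) (smt (verit) real_norm_def)
qed measurable

lemma integrable_ln_cos:
  "integrable lborel (\<lambda>\<theta>. indicator half_circle \<theta> * ln \<bar>cos \<theta>\<bar>)"
proof (rule Bochner_Integration.integrable_bound)
  show "integrable lborel (\<lambda>\<theta>. 2 * (indicator half_circle \<theta> * (1 / sqrt (cos \<theta>))))"
    by (intro integrable_mult_right integrable_inverse_sqrt_cos)
  have "\<bar>ln \<bar>cos \<theta>\<bar>\<bar> \<le> 2 * (1 / sqrt (cos \<theta>))" if "\<theta> \<in> half_circle" for \<theta>
    using cos_pos_half_circle[OF that] neg_ln_le[of "cos \<theta>"] ln_le_zero_iff[of "cos \<theta>"] by auto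
  then show "AE \<theta> in lborel. norm (indicator half_circle \<theta> * ln \<bar>cos \<theta>\<bar>) \<le> norm (2 * (indicator half_circle \<theta> * (1 / sqrt (cos \<theta>))))"
    using cos_pos_half_circle by (intro AE_I2) (simp add: indicator_def abs_of_pos)
qed measurable

text \<open>\<open>\<bar>cos\<bar>\<close> has period \<open>pi\<close>. The part of the shifted
  interval below \<open>- (pi / 2)\<close> is moved up by \<open>pi\<close> and becomes
  \<open>?l\<close>; the rest is \<open>?r\<close>. Together they fill the half circle up to one
  point.\<close>

lemma has_bochner_integral_ln_cos_shift:
  assumes \<phi>: "0 \<le> \<phi>" "\<phi> \<le> pi"
  shows "has_bochner_integral lborel (\<lambda>\<theta>. indicator half_circle \<theta> * ln \<bar>cos (\<theta> - \<phi>)\<bar>)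
    (\<integral>\<theta>. indicator half_circle \<theta> * ln \<bar>cos \<theta>\<bar> \<partial>lborel)"
proof -
  let ?c = "\<lambda>\<theta>. ln \<bar>cos \<theta>\<bar> :: real"
  let ?l = "\<lambda>\<theta>. indicator {pi / 2 - \<phi><..<pi / 2} \<theta> * ?c \<theta>"
  let ?r = "\<lambda>\<theta>. indicator {- (pi / 2)<..<pi / 2 - \<phi>} \<theta> * ?c \<theta>"
  have sub: "integrable lborel (\<lambda>\<theta>. indicator A \<theta> * ?c \<theta>)" if "A \<in> sets borel" "A \<subseteq> half_circle" for A
  proof -
    have "indicator A \<theta> *\<^sub>R (indicator half_circle \<theta> * ?c \<theta>) = indicator A \<theta> * ?c \<theta>" for \<theta>
      using that(2) by (simp add: indicator_def subset_iff)
    then show ?thesis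
      using integrable_mult_indicator[OF _ integrable_ln_cos, of A] that(1) by (simp only: sets_lborel)
  qed
  have il: "integrable lborel ?l" and ir: "integrable lborel ?r"
    using \<phi> by (intro sub; force)+
  have "has_bochner_integral lborel (\<lambda>\<theta>. ?l (pi + 1 * \<theta>)) (integral\<^sup>L lborel ?l /\<^sub>R \<bar>1\<bar>)"
    using il by (intro lborel_has_bochner_integral_real_affine_iff[THEN iffD1] has_bochner_integral_integrable) auto
  moreover have "has_bochner_integral lborel ?r (integral\<^sup>L lborel ?r)"
    using ir by (rule has_bochner_integral_integrable)
  ultimately have "has_bochner_integral lborel (\<lambda>\<theta>. ?l (pi + 1 * \<theta>) + ?r \<theta>) (integral\<^sup>L lborel ?l /\<^sub>R \<bar>1\<bar> + integral\<^sup>L lborel ?r)"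
    by (rule has_bochner_integral_add)
  then have "has_bochner_integral lborel (\<lambda>\<theta>. ?l (pi + 1 * (- \<phi> + 1 * \<theta>)) + ?r (- \<phi> + 1 * \<theta>)) ((integral\<^sup>L lborel ?l /\<^sub>R \<bar>1\<bar> + integral\<^sup>L lborel ?r) /\<^sub>R \<bar>1\<bar>)"
    by (subst (asm) lborel_has_bochner_integral_real_affine_iff[of 1 _ _ "- \<phi>"]) auto
  moreover have "integral\<^sup>L lborel ?l + integral\<^sup>L lborel ?r = (\<integral>\<theta>. ?l \<theta> + ?r \<theta> \<partial>lborel)"
    using il ir by simp
  moreover have "(\<integral>\<theta>. ?l \<theta> + ?r \<theta> \<partial>lborel) = (\<integral>\<theta>. indicator half_circle \<theta> * ?c \<theta> \<partial>lborel)"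
  proof (rule Bochner_Integration.integral_cong_AE)
    show "AE \<theta> in lborel. ?l \<theta> + ?r \<theta> = indicator half_circle \<theta> * ?c \<theta>"
      using AE_lborel_singleton[of "pi / 2 - \<phi>"]
    proof eventually_elim
      case (elim \<theta>)
      then have "indicator {pi / 2 - \<phi><..<pi / 2} \<theta> + indicator {- (pi / 2)<..<pi / 2 - \<phi>} \<theta>
         = (indicator half_circle \<theta> :: real)"
        using \<phi> by (auto simp: indicator_def)
      from this[symmetric] show ?case by (simp add: algebra_simps)
    qed
  qed measurable
  ultimately have 1: "has_bochner_integral lborel (\<lambda>\<theta>. ?l (pi + 1 * (- \<phi> + 1 * \<theta>)) + ?r (- \<phi> + 1 * \<theta>)) (\<integral>\<theta>. indicator half_circle \<theta> * ?c \<theta> \<partial>lborel)"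
    by simp
  show ?thesis
  proof (rule has_bochner_integral_cong_AE[THEN iffD1, OF _ _ _ 1])
    show "AE \<theta> in lborel. ?l (pi + 1 * (- \<phi> + 1 * \<theta>)) + ?r (- \<phi> + 1 * \<theta>) = indicator half_circle \<theta> * ?c (\<theta> - \<phi>)"
      using AE_lborel_singleton[of "\<phi> - pi / 2"] AE_lborel_singleton[of "pi / 2"]
    proof eventually_elim
      case (elim \<theta>)
      have "cos (pi + (\<theta> - \<phi>)) = - cos (\<theta> - \<phi>)" by (simp add: cos_add)
      then have eq: "\<bar>cos (pi + (- \<phi> + \<theta>))\<bar> = \<bar>cos (\<theta> - \<phi>)\<bar>" "\<bar>cos (- \<phi> + \<theta>)\<bar> = \<bar>cos (\<theta> - \<phi>)\<bar>"
        by (auto simp: algebra_simps)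
      have i: "indicator {pi / 2 - \<phi><..<pi / 2} (pi + (- \<phi> + \<theta>)) + indicator {- (pi / 2)<..<pi / 2 - \<phi>} (- \<phi> + \<theta>)
         = (indicator half_circle \<theta> :: real)"
        using elim \<phi> by (auto simp: indicator_def)
      show ?case
        unfolding mult_1 eq i[symmetric] by (simp add: algebra_simps)
    qed
  qed measurable
qed

lemma tan_measurable [measurable]: "(tan :: real \<Rightarrow> real) \<in> borel_measurable borel"
  unfolding tan_def[abs_def] by measurable

text \<open>Writing \<open>a * cos \<theta> + \<epsilon> * sin \<theta> = r * cos (\<theta> - \<phi>)\<close>, the Poisson integral of the logarithm reduces to
  the periodicity of \<open>ln \<bar>cos\<bar>\<close>. The variable \<open>\<epsilon> * tan \<theta>\<close> has a Cauchy distribution for uniform \<open>\<theta>\<close>.\<close>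

lemma has_bochner_integral_ln_tan:
  assumes "\<epsilon> > 0"
  shows "has_bochner_integral lborel (\<lambda>\<theta>. indicator half_circle \<theta> * ln \<bar>a + \<epsilon> * tan \<theta>\<bar>) (pi * (ln (a\<^sup>2 + \<epsilon>\<^sup>2) / 2))"
proof -
  define r where "r = sqrt (a\<^sup>2 + \<epsilon>\<^sup>2)"
  define \<phi> where "\<phi> = arccos (a / r)"
  have pos: "a\<^sup>2 + \<epsilon>\<^sup>2 > 0" using assms by (simp add: add_nonneg_pos)
  then have r: "r > 0" "r\<^sup>2 = a\<^sup>2 + \<epsilon>\<^sup>2" by (auto simp: r_def)
  have "\<bar>a\<bar> \<le> r" unfolding r_def by (rule real_le_rsqrt) simp
  then have ar: "-1 \<le> a / r" "a / r \<le> 1" using r by (auto simp: divide_simps)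
  have \<phi>: "0 \<le> \<phi>" "\<phi> \<le> pi" using arccos_bounded[OF ar] by (auto simp: \<phi>_def)
  have c: "r * cos \<phi> = a" using r ar by (simp add: \<phi>_def cos_arccos)
  have s: "r * sin \<phi> = \<epsilon>"
  proof -
    have "(a / r)\<^sup>2 + (\<epsilon> / r)\<^sup>2 = (a\<^sup>2 + \<epsilon>\<^sup>2) / r\<^sup>2" by (simp add: power_divide add_divide_distrib)
    also have "\<dots> = 1" unfolding r(2) using pos by (intro divide_self) linarith
    finally have "1 - (a / r)\<^sup>2 = (\<epsilon> / r)\<^sup>2" by simp
    then have "sin \<phi> = \<epsilon> / r" using ar r assms by (simp add: \<phi>_def sin_arccos)
    then show ?thesis using r by simp
  qed
  let ?I = "\<integral>\<theta>. indicator half_circle \<theta> * ln \<bar>cos \<theta>\<bar> \<partial>lborel"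
  have "has_bochner_integral lborel (\<lambda>\<theta>. indicator half_circle \<theta> * ln r + indicator half_circle \<theta> * ln \<bar>cos (\<theta> - \<phi>)\<bar>
      - indicator half_circle \<theta> * ln \<bar>cos \<theta>\<bar>) (pi * ln r + ?I - ?I)"
    by (intro has_bochner_integral_add has_bochner_integral_diff has_bochner_integral_mult_left
        has_bochner_integral_half_circle has_bochner_integral_ln_cos_shift \<phi>
        has_bochner_integral_integrable integrable_ln_cos)
  then have 1: "has_bochner_integral lborel (\<lambda>\<theta>. indicator half_circle \<theta> * ln r + indicator half_circle \<theta> * ln \<bar>cos (\<theta> - \<phi>)\<bar>
      - indicator half_circle \<theta> * ln \<bar>cos \<theta>\<bar>) (pi * (ln (a\<^sup>2 + \<epsilon>\<^sup>2) / 2))"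
    using pos by (simp add: r_def ln_sqrt)
  show ?thesis
  proof (rule has_bochner_integral_cong_AE[THEN iffD1, OF _ _ _ 1])
    show "AE \<theta> in lborel. indicator half_circle \<theta> * ln r + indicator half_circle \<theta> * ln \<bar>cos (\<theta> - \<phi>)\<bar>
      - indicator half_circle \<theta> * ln \<bar>cos \<theta>\<bar> = indicator half_circle \<theta> * ln \<bar>a + \<epsilon> * tan \<theta>\<bar>"
      \<comment> \<open>The only angle at which \<open>cos (\<theta> - \<phi>)\<close> vanishes.
        There the logarithm of the product does not split, as \<open>ln 0 = 0\<close>.\<close>
      using AE_lborel_singleton[of "\<phi> - pi / 2"]
    proof eventually_elim
      case (elim \<theta>)
      show ?case
      proof (cases "\<theta> \<in> half_circle")
        case True
        then have th: "cos \<theta> > 0" by (rule cos_pos_half_circle)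
        have "cos (\<theta> - \<phi>) \<noteq> 0"
        proof (cases "\<theta> - \<phi> > - (pi / 2)")
          case True
          then show ?thesis using \<open>\<theta> \<in> half_circle\<close> \<phi> cos_gt_zero_pi[of "\<theta> - \<phi>"] by auto
        next
          case False
          then have "cos (\<theta> - \<phi> + pi) > 0" using elim \<open>\<theta> \<in> half_circle\<close> \<phi> by (intro cos_gt_zero_pi) auto
          then show ?thesis by simp
        qed
        moreover have "r * cos (\<theta> - \<phi>) = a * cos \<theta> + \<epsilon> * sin \<theta>"
          unfolding cos_diff using c s by (simp add: algebra_simps flip: c s)
        then have "a + \<epsilon> * tan \<theta> = r * cos (\<theta> - \<phi>) / cos \<theta>"
          using th by (simp add: tan_def field_simps)
        ultimately have "ln \<bar>a + \<epsilon> * tan \<theta>\<bar> = ln r + ln \<bar>cos (\<theta> - \<phi>)\<bar> - ln \<bar>cos \<theta>\<bar>"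
          using th r by (simp add: abs_mult abs_divide ln_mult ln_div)
        then show ?thesis using True by simp
      qed auto
    qed
  qed measurable
qed

text \<open>The Cauchy law has a finite moment of order \<open>1 / 2\<close> but none of order
  \<open>1\<close>. This dictates the modulus \<open>sqrt \<bar>t\<bar>\<close> in all later
  estimates of potentials.\<close>

lemma integrable_sqrt_tan: "integrable lborel (\<lambda>\<theta>. indicator half_circle \<theta> * sqrt \<bar>tan \<theta>\<bar>)"
proof (rule Bochner_Integration.integrable_bound[OF integrable_inverse_sqrt_cos])
  have "sqrt \<bar>tan \<theta>\<bar> \<le> 1 / sqrt (cos \<theta>)" if "\<theta> \<in> half_circle" for \<theta>
  proof -
    have "\<bar>tan \<theta>\<bar> \<le> 1 / cos \<theta>"
      using cos_pos_half_circle[OF that] abs_sin_le_one[of \<theta>] by (simp add: tan_def abs_divide divide_right_mono)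
    then show ?thesis by (metis real_sqrt_divide real_sqrt_le_iff real_sqrt_one)
  qed
  then show "AE \<theta> in lborel. norm (indicator half_circle \<theta> * sqrt \<bar>tan \<theta>\<bar>) \<le> norm (indicator half_circle \<theta> * (1 / sqrt (cos \<theta>)))"
    using cos_pos_half_circle by (intro AE_I2) (simp add: indicator_def abs_of_pos)
qed measurable

abbreviation tan_moment :: real where
  "tan_moment \<equiv> (\<integral>\<theta>. indicator half_circle \<theta> * sqrt \<bar>tan \<theta>\<bar> \<partial>lborel)"

text \<open>Absolute continuity of the Cauchy law: the bad angles lie in the image of a null set
  under a differentiable map built from \<open>arctan\<close>. This lets an almost-everywhere
  inequality be averaged around every point \<open>x\<close>.\<close>

lemma AE_tan:
  assumes "AE z in lborel. P z" and \<epsilon>: "\<epsilon> > 0"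
  shows "AE \<theta> in lborel. \<theta> \<in> half_circle \<longrightarrow> P (x + \<epsilon> * tan \<theta>)"
proof -
  from assms obtain N where N: "N \<in> null_sets lborel" "{z. \<not> P z} \<subseteq> N"
    by (auto elim!: AE_E simp: null_sets_def)
  have neg: "negligible ((\<lambda>z. arctan ((z - x) / \<epsilon>)) ` N)"
  proof (rule negligible_differentiable_image_negligible)
    show "negligible N" using N(1) by (simp add: negligible_iff_null_sets null_sets_completionI)
    have "((\<lambda>z. arctan ((z - x) / \<epsilon>)) has_real_derivative inverse (1 + ((z - x) / \<epsilon>)\<^sup>2) * (1 / \<epsilon>)) (at z within N)" for z
      using \<epsilon> by (auto intro!: derivative_eq_intros)
    then show "(\<lambda>z. arctan ((z - x) / \<epsilon>)) differentiable_on N"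
      by (auto simp: differentiable_on_def intro!: differentiableI has_field_derivative_imp_has_derivative)
  qed simp
  then have "(\<lambda>z. arctan ((z - x) / \<epsilon>)) ` N \<in> null_sets lebesgue"
    by (simp add: negligible_iff_null_sets)
  then have "AE \<theta> in lebesgue. \<theta> \<notin> (\<lambda>z. arctan ((z - x) / \<epsilon>)) ` N"
    by (rule AE_not_in)
  then have "AE \<theta> in lborel. \<theta> \<notin> (\<lambda>z. arctan ((z - x) / \<epsilon>)) ` N"
    by (simp add: AE_completion_iff)
  then show ?thesis
  proof eventually_elim
    case (elim \<theta>)
    show ?case
    proof (intro impI, rule ccontr)
      assume \<theta>: "\<theta> \<in> half_circle" and "\<not> P (x + \<epsilon> * tan \<theta>)"
      then have "x + \<epsilon> * tan \<theta> \<in> N" using N(2) by auto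
      moreover have "arctan ((x + \<epsilon> * tan \<theta> - x) / \<epsilon>) = \<theta>"
        using \<theta> \<epsilon> by (simp add: arctan_tan)
      ultimately have "\<theta> \<in> (\<lambda>z. arctan ((z - x) / \<epsilon>)) ` N"
        by (intro image_eqI[where x = "x + \<epsilon> * tan \<theta>"]) (simp only:)
      with elim show False by contradiction
    qed
  qed
qed

subsection \<open>The Euler-Lagrange conditions\<close>

lemma eintegral_eq_integral:
  assumes "integrable M g" "AE x in M. f x = ereal (g x)"
  shows "eintegral M f = ereal (integral\<^sup>L M g)"
proof -
  have "(\<integral>\<^sup>+x. e2ennreal (f x) \<partial>M) = (\<integral>\<^sup>+x. ennreal (g x) \<partial>M)"
    using assms(2) by (intro nn_integral_cong_AE) (auto simp: e2ennreal_ereal)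
  moreover have "(\<integral>\<^sup>+x. e2ennreal (- f x) \<partial>M) = (\<integral>\<^sup>+x. ennreal (- g x) \<partial>M)"
    using assms(2) by (intro nn_integral_cong_AE) (auto simp: e2ennreal_ereal)
  moreover have "(\<integral>\<^sup>+x. ennreal (g x) \<partial>M) \<noteq> \<infinity>" "(\<integral>\<^sup>+x. ennreal (- g x) \<partial>M) \<noteq> \<infinity>"
    using assms(1) by (auto simp: real_integrable_def)
  ultimately show ?thesis
    unfolding eintegral_def real_lebesgue_integral_def[OF assms(1)]
    by (cases "\<integral>\<^sup>+x. ennreal (g x) \<partial>M"; cases "\<integral>\<^sup>+x. ennreal (- g x) \<partial>M")
      (auto simp: enn2ereal_ennreal)
qed

text \<open>An infinite positive part would give \<open>eintegral M f = \<infinity>\<close> even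
  against an infinite negative part, by the convention
  \<open>\<infinity> - \<infinity> = \<infinity>\<close>. The function \<open>h\<close> takes care
  of the negative part.\<close>

lemma integrable_of_eintegral:
  assumes "g \<in> borel_measurable M" "AE x in M. f x = ereal (g x)"
    and h: "integrable M h" "AE x in M. - h x \<le> g x"
    and "eintegral M f \<noteq> \<infinity>"
  shows "integrable M g"
proof -
  have 1: "(\<integral>\<^sup>+x. e2ennreal (f x) \<partial>M) = (\<integral>\<^sup>+x. ennreal (g x) \<partial>M)"
    using assms(2) by (intro nn_integral_cong_AE) (auto simp: e2ennreal_ereal)
  have 2: "(\<integral>\<^sup>+x. ennreal (g x) \<partial>M) \<noteq> \<infinity>"
    using assms(5) unfolding eintegral_def 1 by auto
  have "(\<integral>\<^sup>+x. ennreal (- g x) \<partial>M) \<le> (\<integral>\<^sup>+x. ennreal (h x) \<partial>M)"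
    using h(2) by (intro nn_integral_mono_AE) (auto elim!: eventually_mono intro!: ennreal_leI)
  also have "\<dots> < \<infinity>"
    using h(1) by (auto simp: real_integrable_def less_top)
  finally have "(\<integral>\<^sup>+x. ennreal (- g x) \<partial>M) \<noteq> \<infinity>" by auto
  with 2 assms(1) show ?thesis by (simp add: real_integrable_def)
qed

lemma nonneg_of_quadratic:
  fixes L Q :: real
  assumes "\<And>t. 0 < t \<Longrightarrow> t < 1 \<Longrightarrow> 0 \<le> t * L + t\<^sup>2 * Q"
  shows "0 \<le> L"
proof (rule ccontr)
  assume L: "\<not> 0 \<le> L"
  \<comment> \<open>Small enough that the quadratic term uses at most half of the negative linear
    term; \<open>\<bar>Q\<bar> + 1\<close> avoids a zero denominator.\<close>
  define t where "t = min (1 / 2) (- L / (2 * (\<bar>Q\<bar> + 1)))"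
  have t: "0 < t" "t < 1" using L by (auto simp: t_def divide_less_0_iff min_less_iff_disj)
  have "t * \<bar>Q\<bar> \<le> t * (\<bar>Q\<bar> + 1)" using t by simp
  also have "\<dots> \<le> - L / (2 * (\<bar>Q\<bar> + 1)) * (\<bar>Q\<bar> + 1)" by (intro mult_right_mono) (auto simp: t_def)
  also have "\<dots> = - L / 2" by (simp add: field_simps)
  finally have "t * \<bar>Q\<bar> \<le> - L / 2" .
  moreover have "t * Q \<le> t * \<bar>Q\<bar>" using t by (intro mult_left_mono) auto
  ultimately have "L + t * Q < 0" using L by linarith
  then have "t * (L + t * Q) < 0" using t by (simp add: mult_pos_neg)
  then show False using assms[OF t] by (simp add: power2_eq_square algebra_simps)
qed

text \<open>A real-valued substitute for \<open>neg_log_dist\<close>. The two differ on the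
  diagonal, where this one is \<open>0\<close>, so passing from one to the other needs a null
  diagonal.\<close>

abbreviation neg_log :: "real \<Rightarrow> real \<Rightarrow> real" where
  "neg_log x y \<equiv> - ln \<bar>x - y\<bar>"

abbreviation pair_energy :: "nat \<Rightarrow> (nat \<Rightarrow> real) \<Rightarrow> real" where
  "pair_energy N x \<equiv> (\<Sum>j<N. \<Sum>i<j. neg_log (x i) (x j))"

lemma ln_abs_diff_le: "ln \<bar>x - y\<bar> \<le> ln (1 + \<bar>x\<bar>) + ln (1 + \<bar>y::real\<bar>)"
proof (cases "x = y")
  case False
  have "\<bar>x - y\<bar> \<le> (1 + \<bar>x\<bar>) * (1 + \<bar>y\<bar>)"
    using abs_triangle_ineq4[of x y] mult_nonneg_nonneg[OF abs_ge_zero[of x] abs_ge_zero[of y]]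
    unfolding distrib_left distrib_right by linarith
  then have "ln \<bar>x - y\<bar> \<le> ln ((1 + \<bar>x\<bar>) * (1 + \<bar>y\<bar>))"
    using False by (subst ln_le_cancel_iff) auto
  moreover have "1 + \<bar>x\<bar> > 0" "1 + \<bar>y\<bar> > 0" by linarith+
  ultimately show ?thesis by (simp add: ln_mult)
qed (simp add: ln_ge_zero)

lemma ln_one_plus_abs_bounds: "0 \<le> ln (1 + \<bar>x::real\<bar>)" "ln (1 + \<bar>x\<bar>) \<le> \<bar>x\<bar>"
  using ln_add_one_self_le_self[of "\<bar>x\<bar>"] by auto

abbreviation lborel2 :: "(real \<times> real) measure" where
  "lborel2 \<equiv> lborel \<Otimes>\<^sub>M lborel"

text \<open>A density makes the diagonal a null set for the product measure, so the infinite values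
  there disappear and \<open>J\<close> becomes a sum of ordinary integrals. This serves the
  perturbations of \<open>\<mu>\<close> in the first variation.\<close>

lemma J_density:
  assumes f[measurable]: "f \<in> borel_measurable borel" "\<And>x. 0 \<le> f x"
    and W[measurable]: "W \<in> borel_measurable borel"
    and intW: "integrable lborel (\<lambda>x. f x * W x)"
    and intL: "integrable lborel2 (\<lambda>(x, y). f x * f y * neg_log x y)"
    and prob: "prob_space (density lborel (\<lambda>x. ennreal (f x)))"
  shows "J W (density lborel (\<lambda>x. ennreal (f x)))
    = ereal ((\<integral>x. f x * W x \<partial>lborel) + (\<integral>(x, y). f x * f y * neg_log x y \<partial>lborel2))"
proof -
  let ?D = "density lborel (\<lambda>x. ennreal (f x))"
  interpret D: prob_space ?D by (rule prob)
  interpret PD: pair_sigma_finite ?D ?D by unfold_locales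
  have DD: "?D \<Otimes>\<^sub>M ?D = density lborel2 (\<lambda>(x, y). ennreal (f x) * ennreal (f y))"
    by (rule pair_measure_density) (auto intro: D.sigma_finite_measure_axioms sigma_finite_lborel)
  have DD': "?D \<Otimes>\<^sub>M ?D = density lborel2 (\<lambda>p. ennreal (f (fst p) * f (snd p)))"
    unfolding DD by (intro arg_cong2[where f = density] ext) (auto simp: ennreal_mult f)
  have 1: "integrable ?D W" "integral\<^sup>L ?D W = (\<integral>x. f x * W x \<partial>lborel)"
    using intW f by (auto simp: integrable_density integral_density)
  have "eintegral ?D (\<lambda>x. ereal (W x)) = ereal (\<integral>x. f x * W x \<partial>lborel)"
    using eintegral_eq_integral[OF 1(1)] 1(2) by auto
  moreover have "eintegral (?D \<Otimes>\<^sub>M ?D) (\<lambda>(x, y). neg_log_dist x y)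
      = ereal (\<integral>(x, y). f x * f y * neg_log x y \<partial>lborel2)"
  proof -
    have i: "integrable (?D \<Otimes>\<^sub>M ?D) (\<lambda>(x, y). neg_log x y)"
      unfolding DD' using intL f
      by (subst integrable_density) (auto simp: case_prod_beta')
    have "AE p in ?D \<Otimes>\<^sub>M ?D. fst p \<noteq> snd p"
    proof (rule PD.AE_pair_measure)
      have "{p \<in> space (borel \<Otimes>\<^sub>M borel). fst p \<noteq> (snd p :: real)} \<in> sets (borel \<Otimes>\<^sub>M borel)"
        by measurable
      moreover have "sets (?D \<Otimes>\<^sub>M ?D) = sets (borel \<Otimes>\<^sub>M borel)" "space (?D \<Otimes>\<^sub>M ?D) = space (borel \<Otimes>\<^sub>M borel)"
        by (auto intro: sets_pair_measure_cong simp: space_pair_measure)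
      ultimately show "{p \<in> space (?D \<Otimes>\<^sub>M ?D). fst p \<noteq> snd p} \<in> sets (?D \<Otimes>\<^sub>M ?D)" by simp
      have "AE y in ?D. x \<noteq> y" for x
        using AE_lborel_singleton[of x] by (subst AE_density) (auto elim!: eventually_mono)
      then show "AE x in ?D. AE y in ?D. fst (x, y) \<noteq> snd (x, y)" by simp
    qed
    then have ae: "AE p in ?D \<Otimes>\<^sub>M ?D. (\<lambda>(x, y). neg_log_dist x y) p = ereal ((\<lambda>(x, y). neg_log x y) p)"
      by eventually_elim (auto simp: neg_log_dist_def split: prod.splits)
    have "integral\<^sup>L (?D \<Otimes>\<^sub>M ?D) (\<lambda>(x, y). neg_log x y) = (\<integral>(x, y). f x * f y * neg_log x y \<partial>lborel2)"
      unfolding DD' using f by (subst integral_density) (auto simp: case_prod_beta')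
    then show ?thesis using eintegral_eq_integral[OF i ae] by simp
  qed
  ultimately show ?thesis by (simp add: J_def)
qed

locale equilibrium =
  fixes W \<rho> :: "real \<Rightarrow> real" and \<mu> :: "real measure" and c\<^sub>0 C\<^sub>0 :: real
  assumes W_cont: "continuous_on UNIV W"
    and c0: "0 < c\<^sub>0" and growth: "\<And>x. c\<^sub>0 * x\<^sup>2 - C\<^sub>0 \<le> W x"
    and \<rho>_meas [measurable]: "\<rho> \<in> borel_measurable borel"
    and \<rho>_nonneg: "\<And>x. 0 \<le> \<rho> x"
    and \<mu>_eq: "\<mu> = density lborel (\<lambda>x. ennreal (\<rho> x))"
    and eq: "is_equilibrium_measure W \<mu>"
begin

lemma W_meas [measurable]: "W \<in> borel_measurable borel"
  using W_cont by (rule borel_measurable_continuous_onI)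

lemma sets_\<mu> [measurable_cong, simp]: "sets \<mu> = sets borel"
  by (simp add: \<mu>_eq)

lemma space_\<mu> [simp]: "space \<mu> = UNIV"
  by (simp add: \<mu>_eq)

lemma real_distribution_\<mu>: "real_distribution \<mu>"
  using eq by (auto simp: is_equilibrium_measure_def prob_measures_def real_distribution_def real_distribution_axioms_def)

sublocale \<mu>: real_distribution \<mu>
  by (rule real_distribution_\<mu>)

sublocale \<mu>\<mu>: pair_prob_space \<mu> \<mu>
  by unfold_locales

text \<open>Strict minimality is itself the source: some probability measure differs from
  \<open>\<mu>\<close>, since two Dirac measures are distinct, and its value of \<open>J\<close> is
  strictly larger.\<close>

lemma J_finite: "J W \<mu> \<noteq> \<infinity>"
proof -
  have "\<exists>\<nu>\<in>prob_measures. \<nu> \<noteq> \<mu>"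
  proof -
    have "return borel 0 \<noteq> (return borel 1 :: real measure)"
    proof
      assume "return borel 0 = (return borel 1 :: real measure)"
      then have "emeasure (return borel 0) {0::real} = emeasure (return borel 1) {0::real}"
        by (rule arg_cong[where f = "\<lambda>M. emeasure M {0}"])
      then show False by (simp add: emeasure_return)
    qed
    moreover have "return borel x \<in> prob_measures" for x
      by (simp add: prob_measures_def prob_space_return)
    ultimately show ?thesis by metis
  qed
  then obtain \<nu> where "J W \<mu> < J W \<nu>"
    using eq by (auto simp: is_equilibrium_measure_def)
  then show ?thesis by auto
qed

lemma integrable_W: "integrable \<mu> W"
proof (rule integrable_of_eintegral[where f = "\<lambda>x. ereal (W x)" and h = "\<lambda>_. C\<^sub>0"])
  show "AE x in \<mu>. - C\<^sub>0 \<le> W x"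
    using growth c0 by (intro AE_I2) (smt (verit) mult_nonneg_nonneg zero_le_power2)
  show "eintegral \<mu> (\<lambda>x. ereal (W x)) \<noteq> \<infinity>"
    using J_finite by (auto simp: J_def)
qed auto

lemma integrable_square: "integrable \<mu> (\<lambda>x. x\<^sup>2)"
proof (rule Bochner_Integration.integrable_bound[of _ "\<lambda>x. (W x + C\<^sub>0) / c\<^sub>0"])
  show "integrable \<mu> (\<lambda>x. (W x + C\<^sub>0) / c\<^sub>0)" using integrable_W by auto
  have "x\<^sup>2 \<le> (W x + C\<^sub>0) / c\<^sub>0" for x
    using growth[of x] c0 by (simp add: pos_le_divide_eq mult.commute)
  then show "AE x in \<mu>. norm (x\<^sup>2) \<le> norm ((W x + C\<^sub>0) / c\<^sub>0)"
    by (intro AE_I2) (simp only: real_norm_def abs_of_nonneg[OF zero_le_power2] order_trans[OF _ abs_ge_self])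
qed measurable

lemma integrable_abs_\<mu>: "integrable \<mu> (\<lambda>x. \<bar>x\<bar>)"
proof (rule Bochner_Integration.integrable_bound[of _ "\<lambda>x. 1 + x\<^sup>2"])
  show "integrable \<mu> (\<lambda>x. 1 + x\<^sup>2)" using integrable_square by auto
  show "AE x in \<mu>. norm \<bar>x\<bar> \<le> norm (1 + x\<^sup>2)"
    using abs_le_one_plus_square by (intro AE_I2) (auto intro: order_trans[OF _ abs_ge_self])
qed measurable

lemma integrable_ln_one_plus: "integrable \<mu> (\<lambda>x. ln (1 + \<bar>x\<bar>))"
  by (rule Bochner_Integration.integrable_bound[OF integrable_abs_\<mu>])
    (use ln_one_plus_abs_bounds in \<open>auto intro!: AE_I2\<close>)

definition I\<^sub>W :: real where "I\<^sub>W = integral\<^sup>L \<mu> W"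
definition I\<^sub>L :: real where "I\<^sub>L = (\<integral>(x, y). neg_log x y \<partial>(\<mu> \<Otimes>\<^sub>M \<mu>))"

lemma AE_\<mu>: "AE x in lborel. P x \<Longrightarrow> AE x in \<mu>. P x"
  unfolding \<mu>_eq by (subst AE_density) (auto elim!: eventually_mono)

lemma AE_off_diagonal: "AE p in \<mu> \<Otimes>\<^sub>M \<mu>. fst p \<noteq> snd p"
proof (rule \<mu>\<mu>.AE_pair_measure)
  show "{p \<in> space (\<mu> \<Otimes>\<^sub>M \<mu>). fst p \<noteq> snd p} \<in> sets (\<mu> \<Otimes>\<^sub>M \<mu>)"
    by measurable
  have "AE y in \<mu>. x \<noteq> y" for x
    using AE_lborel_singleton[of x] by (intro AE_\<mu>) (auto elim!: eventually_mono)
  then show "AE x in \<mu>. AE y in \<mu>. fst (x, y) \<noteq> snd (x, y)" by simp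
qed

lemma AE_neg_log_dist: "AE p in \<mu> \<Otimes>\<^sub>M \<mu>. (\<lambda>(x, y). neg_log_dist x y) p = ereal ((\<lambda>(x, y). neg_log x y) p)"
  using AE_off_diagonal by eventually_elim (auto simp: neg_log_dist_def split: prod.splits)

lemma integrable_neg_log: "integrable (\<mu> \<Otimes>\<^sub>M \<mu>) (\<lambda>(x, y). neg_log x y)"
proof (rule integrable_of_eintegral[OF _ AE_neg_log_dist])
  show "integrable (\<mu> \<Otimes>\<^sub>M \<mu>) (\<lambda>(x, y). ln (1 + \<bar>x\<bar>) + ln (1 + \<bar>y\<bar>))"
  proof (rule \<mu>\<mu>.Fubini_integrable)
    show "AE x in \<mu>. integrable \<mu> (\<lambda>y. case (x, y) of (x, y) \<Rightarrow> ln (1 + \<bar>x\<bar>) + ln (1 + \<bar>y\<bar>))"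
      using integrable_ln_one_plus by auto
    show "integrable \<mu> (\<lambda>x. \<integral>y. norm (case (x, y) of (x, y) \<Rightarrow> ln (1 + \<bar>x\<bar>) + ln (1 + \<bar>y\<bar>)) \<partial>\<mu>)"
      using integrable_ln_one_plus by simp
  qed measurable
  show "AE p in \<mu> \<Otimes>\<^sub>M \<mu>. - (case p of (x, y) \<Rightarrow> ln (1 + \<bar>x\<bar>) + ln (1 + \<bar>y\<bar>)) \<le> (case p of (x, y) \<Rightarrow> neg_log x y)"
  proof (intro AE_I2)
    fix p :: "real \<times> real"
    show "- (case p of (x, y) \<Rightarrow> ln (1 + \<bar>x\<bar>) + ln (1 + \<bar>y\<bar>)) \<le> (case p of (x, y) \<Rightarrow> neg_log x y)"
      using ln_abs_diff_le[of "fst p" "snd p"] by (simp add: case_prod_beta')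
  qed
  show "eintegral (\<mu> \<Otimes>\<^sub>M \<mu>) (\<lambda>(x, y). neg_log_dist x y) \<noteq> \<infinity>"
    using J_finite eintegral_eq_integral[OF integrable_W, of "\<lambda>x. ereal (W x)"] by (auto simp: J_def)
qed measurable

lemma J_eq: "J W \<mu> = ereal (I\<^sub>W + I\<^sub>L)"
  using eintegral_eq_integral[OF integrable_W, of "\<lambda>x. ereal (W x)"]
    eintegral_eq_integral[OF integrable_neg_log AE_neg_log_dist]
  by (simp add: J_def I\<^sub>W_def I\<^sub>L_def)

definition U :: "real \<Rightarrow> real" where
  "U x = (\<integral>y. neg_log x y \<partial>\<mu>)"

lemma U_meas [measurable]: "U \<in> borel_measurable borel"
  unfolding U_def by measurable

lemma integrable_U: "integrable \<mu> U" "integral\<^sup>L \<mu> U = I\<^sub>L"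
  using \<mu>\<mu>.integrable_fst[OF integrable_neg_log] \<mu>\<mu>.integral_fst[OF integrable_neg_log]
  by (auto simp: U_def[abs_def] I\<^sub>L_def)

text \<open>The modified Robin constant, that is, the integral of \<open>W + 2 * U\<close> against
  \<open>\<mu>\<close>.\<close>

definition robin :: real where "robin = I\<^sub>W + 2 * I\<^sub>L"

lemma \<mu>_pair: "\<mu> \<Otimes>\<^sub>M \<mu> = density lborel2 (\<lambda>(x, y). ennreal (\<rho> x) * ennreal (\<rho> y))"
  unfolding \<mu>_eq using \<mu>.sigma_finite_measure_axioms
  by (intro pair_measure_density) (auto simp: \<mu>_eq intro: sigma_finite_lborel)

lemma lborel_\<rho>:
  "integrable lborel (\<lambda>x. \<rho> x * W x)" "(\<integral>x. \<rho> x * W x \<partial>lborel) = I\<^sub>W"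
  "integrable lborel \<rho>" "integral\<^sup>L lborel \<rho> = 1"
  "integrable lborel (\<lambda>x. \<rho> x * \<bar>x\<bar>)"
  "integrable lborel2 (\<lambda>(x, y). \<rho> x * \<rho> y * neg_log x y)"
  "(\<integral>(x, y). \<rho> x * \<rho> y * neg_log x y \<partial>lborel2) = I\<^sub>L"
proof -
  show "integrable lborel (\<lambda>x. \<rho> x * W x)" "(\<integral>x. \<rho> x * W x \<partial>lborel) = I\<^sub>W"
  proof -
    have "integrable (density lborel (\<lambda>x. ennreal (\<rho> x))) W" using integrable_W by (simp only: \<mu>_eq)
    then show "integrable lborel (\<lambda>x. \<rho> x * W x)" using \<rho>_nonneg by (simp add: integrable_density)
    have "I\<^sub>W = integral\<^sup>L (density lborel (\<lambda>x. ennreal (\<rho> x))) W" unfolding I\<^sub>W_def by (rule arg_cong[OF \<mu>_eq])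
    then show "(\<integral>x. \<rho> x * W x \<partial>lborel) = I\<^sub>W" using \<rho>_nonneg by (simp add: integral_density)
  qed
  have "has_bochner_integral lborel \<rho> 1"
  proof (rule has_bochner_integral_nn_integral)
    have "(\<integral>\<^sup>+x. ennreal (\<rho> x) \<partial>lborel) = emeasure (density lborel (\<lambda>x. ennreal (\<rho> x))) UNIV"
      by (subst emeasure_density) auto
    also have "\<dots> = emeasure \<mu> (space \<mu>)" by (simp add: \<mu>_eq)
    finally show "(\<integral>\<^sup>+x. ennreal (\<rho> x) \<partial>lborel) = ennreal 1" using \<mu>.emeasure_space_1 by simp
  qed (use \<rho>_nonneg in auto)
  then show "integrable lborel \<rho>" "integral\<^sup>L lborel \<rho> = 1"
    by (auto simp: has_bochner_integral_iff)
  show "integrable lborel (\<lambda>x. \<rho> x * \<bar>x\<bar>)"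
    using integrable_abs_\<mu> \<rho>_nonneg by (auto simp: \<mu>_eq integrable_density)
  have *: "\<mu> \<Otimes>\<^sub>M \<mu> = density lborel2 (\<lambda>p. ennreal (\<rho> (fst p) * \<rho> (snd p)))"
    unfolding \<mu>_pair by (intro arg_cong2[where f = density] ext) (auto simp: ennreal_mult \<rho>_nonneg)
  show "integrable lborel2 (\<lambda>(x, y). \<rho> x * \<rho> y * neg_log x y)"
    "(\<integral>(x, y). \<rho> x * \<rho> y * neg_log x y \<partial>lborel2) = I\<^sub>L"
    using integrable_neg_log \<rho>_nonneg unfolding I\<^sub>L_def *
    by (auto simp: integrable_density integral_density case_prod_beta')
qed

end

lemma continuous_on_Icc_bounded:
  fixes f :: "real \<Rightarrow> real"
  assumes "continuous_on {a..b} f"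
  obtains K where "\<And>x. x \<in> {a..b} \<Longrightarrow> \<bar>f x\<bar> \<le> K"
proof -
  have "bounded (f ` {a..b})"
    using assms by (intro compact_imp_bounded compact_continuous_image) auto
  then obtain K where "\<forall>y\<in>f ` {a..b}. norm y \<le> K" unfolding bounded_iff by blast
  then show ?thesis using that by (metis imageI real_norm_def)
qed

text \<open>Makes the cross terms of the first variation finite. The logarithm is split into linear
  growth, controlled by the first moment of \<open>h\<close>, and a translate of
  \<open>ln_sing\<close>, whose integral does not depend on \<open>x\<close>.\<close>

lemma integrable_neg_log_indicator:
  assumes h[measurable]: "h \<in> borel_measurable borel" and h0: "\<And>x. 0 \<le> h x"
    and hi: "integrable lborel h" "integrable lborel (\<lambda>x. h x * \<bar>x\<bar>)"
    and B[measurable]: "B \<in> sets borel" "B \<subseteq> {-n..n}"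
  shows "integrable lborel2 (\<lambda>(x, y). h x * indicator B y * neg_log x y)"
proof -
  let ?S = "integral\<^sup>L lborel ln_sing"
  let ?g = "\<lambda>(x, y). h x * (indicator {-n..n} y * (\<bar>x\<bar> + \<bar>n\<bar>) + ln_sing (x - y))"
  have ls: "integrable lborel (\<lambda>y. ln_sing (x - y))" "(\<integral>y. ln_sing (x - y) \<partial>lborel) = ?S" for x
    using lborel_integrable_real_affine[OF integrable_ln_sing, of "-1" x]
      lborel_integral_real_affine[of "-1" ln_sing x] by simp_all
  have "integrable lborel2 ?g"
  proof (rule lborel_pair.Fubini_integrable)
    have 1: "integrable lborel (\<lambda>y. indicator {-n..n} y * (\<bar>x\<bar> + \<bar>n\<bar>) + ln_sing (x - y))" for x
      by (intro Bochner_Integration.integrable_add ls integrable_mult_left) auto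
    then show "AE x in lborel. integrable lborel (\<lambda>y. ?g (x, y))" by auto
    have "(\<integral>y. norm (?g (x, y)) \<partial>lborel) = (measure lborel {-n..n} * (h x * \<bar>x\<bar> + \<bar>n\<bar> * h x) + h x * ?S)" for x
    proof -
      have "(\<integral>y. norm (?g (x, y)) \<partial>lborel) = (\<integral>y. h x * (indicator {-n..n} y * (\<bar>x\<bar> + \<bar>n\<bar>) + ln_sing (x - y)) \<partial>lborel)"
        using h0 ln_sing_nonneg by (intro Bochner_Integration.integral_cong) (auto simp: abs_mult indicator_def)
      also have "\<dots> = h x * (measure lborel {-n..n} * (\<bar>x\<bar> + \<bar>n\<bar>) + ?S)"
        using ls[of x] by (subst integral_mult_right_zero, subst Bochner_Integration.integral_add) (auto intro!: integrable_mult_left)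
      finally show ?thesis by (simp add: algebra_simps)
    qed
    then show "integrable lborel (\<lambda>x. \<integral>y. norm (?g (x, y)) \<partial>lborel)"
      using hi by auto
  qed measurable
  then show ?thesis
  proof (rule Bochner_Integration.integrable_bound)
    have *: "h x * (indicator B y * \<bar>ln \<bar>x - y\<bar>\<bar>) \<le> h x * (indicator {-n..n} y * (\<bar>x\<bar> + \<bar>n\<bar>) + ln_sing (x - y))" for x y
    proof (intro mult_left_mono h0)
      show "indicator B y * \<bar>ln \<bar>x - y\<bar>\<bar> \<le> indicator {-n..n} y * (\<bar>x\<bar> + \<bar>n\<bar>) + ln_sing (x - y)"
        using abs_ln_abs_le[of "x - y"] B(2) ln_sing_nonneg[of "x - y"]
        by (cases "y \<in> B") (force simp: indicator_def)+
    qed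
    show "AE p in lborel2. norm (case p of (x, y) \<Rightarrow> h x * indicator B y * neg_log x y) \<le> norm (?g p)"
    proof (intro AE_I2)
      fix p :: "real \<times> real"
      show "norm (case p of (x, y) \<Rightarrow> h x * indicator B y * neg_log x y) \<le> norm (?g p)"
        using *[of "fst p" "snd p"] h0[of "fst p"] ln_sing_nonneg[of "fst p - snd p"]
        by (simp add: case_prod_beta' abs_mult mult.assoc abs_of_nonneg)
    qed
  qed measurable
qed

context equilibrium
begin

lemma U_eq: "U x = (\<integral>y. \<rho> y * neg_log x y \<partial>lborel)"
proof -
  have "U x = (\<integral>y. neg_log x y \<partial>density lborel (\<lambda>x. ennreal (\<rho> x)))"
    unfolding U_def by (rule arg_cong[OF \<mu>_eq])
  then show ?thesis using \<rho>_nonneg by (simp add: integral_density)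
qed

text \<open>First variation along \<open>(1 - t) * \<rho> + t * \<eta>\<close>, with
  \<open>\<eta>\<close> the uniform density on \<open>B\<close>. The increment of \<open>J\<close>
  is a quadratic polynomial in \<open>t\<close>, so minimality forces its linear coefficient to be
  nonnegative.\<close>

lemma euler_lagrange_test:
  assumes B[measurable]: "B \<in> sets borel" "B \<subseteq> {-n..n}" and pos: "measure lborel B > 0"
  shows "integrable lborel (\<lambda>x. indicator B x * (W x + 2 * U x))"
    and "robin * measure lborel B \<le> (\<integral>x. indicator B x * (W x + 2 * U x) \<partial>lborel)"
proof -
  define m where "m = measure lborel B"
  have m: "m > 0" using pos by (simp add: m_def)
  define \<eta> where "\<eta> x = indicator B x / m" for x :: real
  have [measurable]: "\<eta> \<in> borel_measurable borel" unfolding \<eta>_def[abs_def] by measurable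
  have \<eta>0: "0 \<le> \<eta> x" for x using m by (simp add: \<eta>_def)
  have "emeasure lborel B \<le> emeasure lborel {-n..n}" by (intro emeasure_mono) (use B in auto)
  also have "\<dots> < \<infinity>" by (simp add: emeasure_lborel_Icc_eq)
  finally have iB: "integrable lborel (indicat_real B)" by (intro integrable_real_indicator) auto
  have bdd: "integrable lborel (\<lambda>x. indicator B x * f x)" if f: "continuous_on {-n..n} f" "f \<in> borel_measurable borel" for f :: "real \<Rightarrow> real"
  proof -
    obtain K where K: "\<And>x. x \<in> {-n..n} \<Longrightarrow> \<bar>f x\<bar> \<le> K"
      using continuous_on_Icc_bounded[OF f(1)] by blast
    show ?thesis
    proof (rule Bochner_Integration.integrable_bound[of _ "\<lambda>x. indicator B x * K"])
      show "AE x in lborel. norm (indicator B x * f x) \<le> norm (indicator B x * K)"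
        using K B(2) by (intro AE_I2) (force simp: indicator_def)
    qed (use iB that(2) in auto)
  qed
  have \<eta>i: "integrable lborel \<eta>" "integrable lborel (\<lambda>x. \<eta> x * \<bar>x\<bar>)" "integrable lborel (\<lambda>x. \<eta> x * W x)"
  proof -
    have "continuous_on {-n..n} (\<lambda>x::real. \<bar>x\<bar>)" by (intro continuous_intros)
    then have "integrable lborel (\<lambda>x. indicator B x * \<bar>x\<bar>)" by (intro bdd) auto
    moreover have "integrable lborel (\<lambda>x. indicator B x * W x)"
      by (intro bdd continuous_on_subset[OF W_cont]) auto
    ultimately show "integrable lborel \<eta>" "integrable lborel (\<lambda>x. \<eta> x * \<bar>x\<bar>)" "integrable lborel (\<lambda>x. \<eta> x * W x)"
      using iB by (auto simp: \<eta>_def[abs_def])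
  qed
  have \<eta>1: "integral\<^sup>L lborel \<eta> = 1" using m by (simp add: \<eta>_def[abs_def] m_def)
  have div: "integrable lborel2 (\<lambda>(x, y). h x * \<eta> y * neg_log x y)"
    if "h \<in> borel_measurable borel" "\<And>x. 0 \<le> h x" "integrable lborel h" "integrable lborel (\<lambda>x. h x * \<bar>x\<bar>)" for h
  proof -
    have "integrable lborel2 (\<lambda>p. (case p of (x, y) \<Rightarrow> h x * indicator B y * neg_log x y) / m)"
      by (intro integrable_divide integrable_neg_log_indicator[OF that B])
    then show ?thesis by (simp add: \<eta>_def case_prod_beta')
  qed
  have i1: "integrable lborel2 (\<lambda>(x, y). \<rho> x * \<eta> y * neg_log x y)"
    using \<rho>_nonneg lborel_\<rho> by (intro div) auto
  have i2: "integrable lborel2 (\<lambda>(x, y). \<eta> x * \<eta> y * neg_log x y)"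
    using \<eta>0 \<eta>i by (intro div) auto
  have i3: "integrable lborel2 (\<lambda>(x, y). \<eta> x * \<rho> y * neg_log x y)"
    using lborel_pair.integrable_product_swap[OF i1] by (simp add: case_prod_beta' abs_minus_commute mult.commute)
  define X where "X = (\<integral>(x, y). \<eta> x * \<rho> y * neg_log x y \<partial>lborel2)"
  define Y where "Y = (\<integral>(x, y). \<eta> x * \<eta> y * neg_log x y \<partial>lborel2)"
  define b where "b = (\<integral>x. \<eta> x * W x \<partial>lborel)"
  have X': "(\<integral>(x, y). \<rho> x * \<eta> y * neg_log x y \<partial>lborel2) = X"
    unfolding X_def using lborel_pair.integral_product_swap[of "\<lambda>(x, y). \<rho> x * \<eta> y * neg_log x y"]
    by (simp add: case_prod_beta' abs_minus_commute mult.commute)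
  have XU: "integrable lborel (\<lambda>x. \<eta> x * U x)" "X = (\<integral>x. \<eta> x * U x \<partial>lborel)"
    using lborel_pair.integrable_fst[OF i3] lborel_pair.integral_fst[OF i3]
    by (simp_all add: X_def U_eq mult.assoc)
  have "0 \<le> t * (b - I\<^sub>W - 2 * I\<^sub>L + 2 * X) + t\<^sup>2 * (I\<^sub>L - 2 * X + Y)" if t: "0 < t" "t < 1" for t
  proof -
    define f where "f x = (1 - t) * \<rho> x + t * \<eta> x" for x
    have f[measurable]: "f \<in> borel_measurable borel" unfolding f_def by measurable
    have f0: "0 \<le> f x" for x using t \<rho>_nonneg \<eta>0 by (auto simp: f_def intro!: add_nonneg_nonneg mult_nonneg_nonneg)
    have fi: "has_bochner_integral lborel f ((1 - t) * 1 + t * 1)"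
      unfolding f_def using lborel_\<rho> \<eta>i \<eta>1
      by (intro has_bochner_integral_add has_bochner_integral_mult_right) (auto simp: has_bochner_integral_iff)
    have "emeasure (density lborel (\<lambda>x. ennreal (f x))) UNIV = (\<integral>\<^sup>+x. ennreal (f x) \<partial>lborel)"
      by (subst emeasure_density) auto
    also have "\<dots> = ennreal (integral\<^sup>L lborel f)"
      using fi f0 by (intro nn_integral_eq_integral) (auto simp: has_bochner_integral_iff)
    also have "\<dots> = 1" using fi by (simp add: has_bochner_integral_iff)
    finally have prob: "prob_space (density lborel (\<lambda>x. ennreal (f x)))"
      by (intro prob_spaceI) simp
    have fW: "has_bochner_integral lborel (\<lambda>x. f x * W x) ((1 - t) * I\<^sub>W + t * b)"
    proof -
      have "has_bochner_integral lborel (\<lambda>x. (1 - t) * (\<rho> x * W x) + t * (\<eta> x * W x)) ((1 - t) * I\<^sub>W + t * b)"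
        using lborel_\<rho> \<eta>i
        by (intro has_bochner_integral_add has_bochner_integral_mult_right) (auto simp: has_bochner_integral_iff b_def)
      then show ?thesis by (simp add: f_def algebra_simps)
    qed
    have fL: "has_bochner_integral lborel2 (\<lambda>(x, y). f x * f y * neg_log x y)
        ((1 - t)\<^sup>2 * I\<^sub>L + (t * (1 - t)) * X + (t * (1 - t)) * X + t\<^sup>2 * Y)"
    proof -
      have "has_bochner_integral lborel2
         (\<lambda>p. (1 - t)\<^sup>2 * (case p of (x, y) \<Rightarrow> \<rho> x * \<rho> y * neg_log x y) + (t * (1 - t)) * (case p of (x, y) \<Rightarrow> \<rho> x * \<eta> y * neg_log x y)
           + (t * (1 - t)) * (case p of (x, y) \<Rightarrow> \<eta> x * \<rho> y * neg_log x y) + t\<^sup>2 * (case p of (x, y) \<Rightarrow> \<eta> x * \<eta> y * neg_log x y))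
        ((1 - t)\<^sup>2 * I\<^sub>L + (t * (1 - t)) * X + (t * (1 - t)) * X + t\<^sup>2 * Y)"
        using i1 i2 i3 X' lborel_\<rho>
        by (intro has_bochner_integral_add has_bochner_integral_mult_right) (simp_all add: has_bochner_integral_iff X_def Y_def)
      moreover have "(\<lambda>p. (1 - t)\<^sup>2 * (case p of (x, y) \<Rightarrow> \<rho> x * \<rho> y * neg_log x y) + (t * (1 - t)) * (case p of (x, y) \<Rightarrow> \<rho> x * \<eta> y * neg_log x y)
           + (t * (1 - t)) * (case p of (x, y) \<Rightarrow> \<eta> x * \<rho> y * neg_log x y) + t\<^sup>2 * (case p of (x, y) \<Rightarrow> \<eta> x * \<eta> y * neg_log x y))
        = (\<lambda>(x, y). f x * f y * neg_log x y)"
        by (rule ext) (simp only: case_prod_beta' f_def, algebra)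
      ultimately show ?thesis by simp
    qed
    have "J W (density lborel (\<lambda>x. ennreal (f x)))
      = ereal ((1 - t) * I\<^sub>W + t * b + ((1 - t)\<^sup>2 * I\<^sub>L + (t * (1 - t)) * X + (t * (1 - t)) * X + t\<^sup>2 * Y))"
      using J_density[OF f f0 W_meas _ _ prob] fW fL by (simp add: has_bochner_integral_iff)
    moreover have "J W \<mu> \<le> J W (density lborel (\<lambda>x. ennreal (f x)))"
    proof (cases "density lborel (\<lambda>x. ennreal (f x)) = \<mu>")
      case False
      then show ?thesis
        using eq prob by (auto simp: is_equilibrium_measure_def prob_measures_def intro: less_imp_le)
    qed simp
    ultimately have "I\<^sub>W + I\<^sub>L \<le> (1 - t) * I\<^sub>W + t * b + ((1 - t)\<^sup>2 * I\<^sub>L + (t * (1 - t)) * X + (t * (1 - t)) * X + t\<^sup>2 * Y)"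
      by (simp add: J_eq)
    then show ?thesis by (simp add: power2_eq_square algebra_simps)
  qed
  then have "0 \<le> b - I\<^sub>W - 2 * I\<^sub>L + 2 * X" by (rule nonneg_of_quadratic)
  then have le: "robin \<le> b + 2 * X" by (simp add: robin_def)
  have "has_bochner_integral lborel (\<lambda>x. m * (\<eta> x * W x + 2 * (\<eta> x * U x))) (m * (b + 2 * X))"
    using XU \<eta>i by (intro has_bochner_integral_add has_bochner_integral_mult_right) (auto simp: has_bochner_integral_iff b_def)
  then have *: "has_bochner_integral lborel (\<lambda>x. indicator B x * (W x + 2 * U x)) (m * (b + 2 * X))"
    using m by (simp add: \<eta>_def algebra_simps)
  then show "integrable lborel (\<lambda>x. indicator B x * (W x + 2 * U x))" by (rule integrable.intros)
  show "robin * measure lborel B \<le> (\<integral>x. indicator B x * (W x + 2 * U x) \<partial>lborel)"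
    using le m unfolding has_bochner_integral_integral_eq[OF *] m_def[symmetric] by (simp add: mult.commute)
qed

text \<open>If the set of violation inside a bounded window had positive measure, it could serve as
  the test set and would contradict the averaged inequality. Countably many windows cover the
  line.\<close>

lemma euler_lagrange: "AE x in lborel. robin \<le> W x + 2 * U x"
proof -
  have "AE x in lborel. x \<in> {- real n..real n} \<longrightarrow> robin \<le> W x + 2 * U x" for n :: nat
  proof -
    define B where "B = {x \<in> {- real n..real n}. W x + 2 * U x < robin}"
    have [measurable]: "B \<in> sets borel" unfolding B_def by measurable
    have B: "B \<subseteq> {- real n..real n}" by (auto simp: B_def)
    have "emeasure lborel B \<le> emeasure lborel {- real n..real n}" by (intro emeasure_mono) (use B in auto)
    also have "\<dots> < \<infinity>" by (simp add: emeasure_lborel_Icc_eq)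
    finally have fin: "emeasure lborel B < \<infinity>" .
    have "measure lborel B = 0"
    proof (rule ccontr)
      assume "measure lborel B \<noteq> 0"
      then have pos: "measure lborel B > 0" by (simp add: less_le)
      have iB: "integrable lborel (indicat_real B)" using fin by (intro integrable_real_indicator) auto
      have i: "integrable lborel (\<lambda>x. robin * indicator B x - indicator B x * (W x + 2 * U x))"
        using iB by (intro Bochner_Integration.integrable_diff euler_lagrange_test[OF _ B pos]) auto
      have nn: "0 \<le> robin * indicator B x - indicator B x * (W x + 2 * U x)" for x
        by (auto simp: B_def indicator_def)
      have "(\<integral>x. robin * indicator B x - indicator B x * (W x + 2 * U x) \<partial>lborel) \<le> 0"
        using euler_lagrange_test[OF _ B pos] iB by simp
      then have "(\<integral>x. robin * indicator B x - indicator B x * (W x + 2 * U x) \<partial>lborel) = 0"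
        using nn by (intro antisym Bochner_Integration.integral_nonneg)
      then have "AE x in lborel. robin * indicator B x - indicator B x * (W x + 2 * U x) = 0"
        using i nn by (subst (asm) integral_nonneg_eq_0_iff_AE) auto
      then have "AE x in lborel. x \<notin> B" by eventually_elim (auto simp: B_def)
      then have "emeasure lborel B = 0" by (subst (asm) AE_iff_measurable[of B]) auto
      then show False using pos by (simp add: measure_def)
    qed
    then have "emeasure lborel B = 0" using fin by (simp add: emeasure_eq_ennreal_measure)
    then have "AE x in lborel. x \<notin> B" by (subst AE_iff_measurable[of B]) auto
    then show ?thesis by eventually_elim (auto simp: B_def not_less)
  qed
  then have "AE x in lborel. \<forall>n::nat. x \<in> {- real n..real n} \<longrightarrow> robin \<le> W x + 2 * U x"
    by (intro AE_all_countable[THEN iffD2] allI)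
  then show ?thesis
  proof eventually_elim
    case (elim x)
    obtain n where "\<bar>x\<bar> \<le> real n" using real_arch_simple by blast
    then show ?case using elim by (auto simp: abs_le_iff)
  qed
qed

end

section \<open>The truncated potential and the compact support\<close>

lemma locally_lipschitz_on_Icc:
  assumes "locally_lipschitz f"
  obtains L where "0 \<le> L" "\<And>x y. x \<in> {a..b} \<Longrightarrow> y \<in> {a..b} \<Longrightarrow> \<bar>f x - f y\<bar> \<le> L * \<bar>x - y\<bar>"
proof -
  \<comment> \<open>A dummy time in \<open>{0}\<close> presents \<open>f\<close> as a time-dependent
    field, for which compactness yields a single Lipschitz constant.\<close>
  have ll: "local_lipschitz {0::real} {a..b} (\<lambda>_. f)"
  proof (rule local_lipschitzI)
    fix t x :: real
    obtain r L where r: "r > 0" "L-lipschitz_on (ball x r) f"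
      using assms unfolding locally_lipschitz_def by blast
    have "L-lipschitz_on (cball x (r / 2) \<inter> {a..b}) f"
      by (rule lipschitz_on_subset[OF r(2)]) (use r(1) in auto)
    then show "\<exists>u>0. \<exists>L. \<forall>t\<in>cball t u \<inter> {0}. L-lipschitz_on (cball x u \<inter> {a..b}) f"
      using r(1) by (intro exI[of _ "r / 2"]) auto
  qed
  obtain L where L: "\<And>t. t \<in> {0::real} \<Longrightarrow> L-lipschitz_on {a..b} f"
    by (rule local_lipschitz_compact_implies_lipschitz[of "{0::real}" "{a..b}" "\<lambda>_. f"]) (use ll in auto)
  then have "L-lipschitz_on {a..b} f" by blast
  then have "0 \<le> L" "\<And>x y. x \<in> {a..b} \<Longrightarrow> y \<in> {a..b} \<Longrightarrow> \<bar>f x - f y\<bar> \<le> L * \<bar>x - y\<bar>"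
    by (auto simp: lipschitz_on_def dist_real_def)
  then show ?thesis using that by blast
qed

lemma le_sqrt_self: "0 \<le> (u::real) \<Longrightarrow> u \<le> 1 \<Longrightarrow> u \<le> sqrt u"
  by (intro real_le_rsqrt) (simp add: power2_eq_square mult_left_le)

lemma ln_one_plus_le_sqrt:
  assumes "0 \<le> (u::real)"
  shows "ln (1 + u) \<le> 2 * sqrt u"
proof -
  have "1 + u \<le> (1 + sqrt u)\<^sup>2" using assms by (simp add: power2_eq_square algebra_simps)
  then have "ln (1 + u) \<le> ln ((1 + sqrt u)\<^sup>2)" using assms by (subst ln_le_cancel_iff) (auto intro: add_pos_nonneg)
  also have "\<dots> = 2 * ln (1 + sqrt u)" using assms by (subst ln_realpow) (auto intro: add_pos_nonneg)
  also have "\<dots> \<le> 2 * sqrt u" using assms ln_add_one_self_le_self[of "sqrt u"] by simp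
  finally show ?thesis .
qed

context equilibrium
begin

definition C\<^sub>1 :: real where "C\<^sub>1 = (\<integral>y. ln (1 + \<bar>y\<bar>) \<partial>\<mu>)"

lemma C1_nonneg: "0 \<le> C\<^sub>1"
  unfolding C\<^sub>1_def by (intro Bochner_Integration.integral_nonneg) auto

lemma U_lower: "- ln (1 + \<bar>x\<bar>) - C\<^sub>1 \<le> U x"
proof (cases "integrable \<mu> (\<lambda>y. neg_log x y)")
  case True
  have "- ln (1 + \<bar>x\<bar>) - C\<^sub>1 = (\<integral>y. - ln (1 + \<bar>x\<bar>) - ln (1 + \<bar>y\<bar>) \<partial>\<mu>)"
    using integrable_ln_one_plus by (simp add: C\<^sub>1_def)
  also have "\<dots> \<le> U x"
    unfolding U_def
  proof (intro integral_mono True Bochner_Integration.integrable_diff integrable_ln_one_plus)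
    show "- ln (1 + \<bar>x\<bar>) - ln (1 + \<bar>y\<bar>) \<le> neg_log x y" for y
      using ln_abs_diff_le[of x y] by simp
  qed auto
  finally show ?thesis .
next
  case False
  \<comment> \<open>The integral of a nonintegrable function is \<open>0\<close> by convention, and
    the claimed lower bound is nonpositive.\<close>
  then have "U x = 0" by (simp add: U_def not_integrable_integral_eq)
  then show ?thesis using C1_nonneg ln_one_plus_abs_bounds(1)[of x] by linarith
qed

text \<open>A majorant of \<open>robin - 2 * U\<close> valid at every point, not only almost
  everywhere, and of logarithmic growth only.\<close>

definition barrier :: "real \<Rightarrow> real" where
  "barrier x = 2 * ln (1 + \<bar>x\<bar>) + 2 * C\<^sub>1 + robin"

lemma barrier_meas [measurable]: "barrier \<in> borel_measurable borel"
  unfolding barrier_def by measurable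

lemma barrier_U: "robin - barrier x \<le> 2 * U x"
  using U_lower[of x] by (simp add: barrier_def)

text \<open>\<open>W\<close> grows at least quadratically, so its Cauchy averages diverge. The
  capped potential still satisfies the Euler-Lagrange inequality and has finite averages; the excess
  \<open>W - trunc_pot\<close> is kept as a reserve of confinement.\<close>

definition trunc_pot :: "real \<Rightarrow> real" where
  "trunc_pot x = min (W x) (barrier x)"

lemma trunc_pot_U: "AE x in lborel. robin - trunc_pot x \<le> 2 * U x"
  using euler_lagrange by eventually_elim (use barrier_U in \<open>auto simp: trunc_pot_def min_def\<close>)

text \<open>Chosen so that for \<open>\<bar>x\<bar> \<ge> radius\<close> half of the quadratic
  growth of \<open>W\<close> absorbs the linear bound \<open>2 * \<bar>x\<bar>\<close> for the
  logarithm in the barrier and all constants.\<close>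

definition radius :: real where
  "radius = max 1 (2 / c\<^sub>0 * (2 + \<bar>C\<^sub>0\<bar> + 2 * C\<^sub>1 + \<bar>robin\<bar>))"

lemma radius_ge_1: "1 \<le> radius"
  by (simp add: radius_def)

lemma W_minus_barrier:
  assumes "radius \<le> \<bar>x\<bar>"
  shows "c\<^sub>0 / 2 * x\<^sup>2 \<le> W x - barrier x"
proof -
  define K where "K = \<bar>C\<^sub>0\<bar> + 2 * C\<^sub>1 + \<bar>robin\<bar>"
  have K: "0 \<le> K" using C1_nonneg by (simp add: K_def)
  have x: "1 \<le> \<bar>x\<bar>" using assms radius_ge_1 by simp
  have "2 / c\<^sub>0 * (2 + K) \<le> \<bar>x\<bar>" using assms by (simp add: radius_def K_def algebra_simps)
  then have "2 + K \<le> c\<^sub>0 / 2 * \<bar>x\<bar>" using c0 by (simp add: field_simps)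
  then have "(2 + K) * \<bar>x\<bar> \<le> c\<^sub>0 / 2 * \<bar>x\<bar> * \<bar>x\<bar>" by (intro mult_right_mono) auto
  also have "\<dots> = c\<^sub>0 / 2 * x\<^sup>2" by (simp add: power2_eq_square)
  finally have "2 * \<bar>x\<bar> + K * \<bar>x\<bar> \<le> c\<^sub>0 / 2 * x\<^sup>2" by (simp add: algebra_simps)
  moreover have "K * 1 \<le> K * \<bar>x\<bar>" using K x by (intro mult_left_mono) auto
  moreover have "c\<^sub>0 * x\<^sup>2 - C\<^sub>0 \<le> W x" by (rule growth)
  moreover have "barrier x \<le> 2 * \<bar>x\<bar> + K - C\<^sub>0"
    using ln_one_plus_abs_bounds(2)[of x] abs_ge_self[of robin] abs_ge_minus_self[of "C\<^sub>0"] abs_ge_self[of "C\<^sub>0"]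
    unfolding barrier_def K_def by linarith
  ultimately show ?thesis by linarith
qed

lemma trunc_pot_le: "trunc_pot x \<le> W x"
  by (simp add: trunc_pot_def)

lemma W_minus_trunc_pot:
  "c\<^sub>0 / 2 * (indicator {x. radius < \<bar>x\<bar>} x * \<bar>x\<bar> ^ 2) \<le> W x - trunc_pot x"
  using W_minus_barrier[of x] trunc_pot_le[of x] by (auto simp: indicator_def trunc_pot_def min_def)

lemma trunc_pot_outside:
  assumes "radius \<le> \<bar>x\<bar>"
  shows "trunc_pot x = barrier x"
proof -
  have "0 \<le> c\<^sub>0 / 2 * x\<^sup>2" using c0 by simp
  then show ?thesis using W_minus_barrier[OF assms] by (simp add: trunc_pot_def min_def)
qed

text \<open>The nonnegative function \<open>W + 2 * U - robin\<close> has integral \<open>0\<close>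
  under \<open>\<mu>\<close>, hence vanishes \<open>\<mu>\<close>-almost everywhere. Beyond
  \<open>radius\<close> the barrier makes it strictly positive.\<close>

lemma AE_support: "AE x in \<mu>. \<bar>x\<bar> < radius"
proof -
  have i: "integrable \<mu> (\<lambda>x. W x + 2 * U x - robin)"
    using integrable_W integrable_U by auto
  have "(\<integral>x. W x + 2 * U x - robin \<partial>\<mu>) = 0"
    using integrable_W integrable_U by (simp add: I\<^sub>W_def robin_def)
  moreover have nn: "AE x in \<mu>. 0 \<le> W x + 2 * U x - robin"
    using AE_\<mu>[OF euler_lagrange] by auto
  ultimately have "AE x in \<mu>. W x + 2 * U x - robin = 0"
    using integral_nonneg_eq_0_iff_AE[OF i] by simp
  then show ?thesis
  proof eventually_elim
    case (elim x)
    show ?case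
    proof (rule ccontr)
      assume "\<not> \<bar>x\<bar> < radius"
      then have x: "radius \<le> \<bar>x\<bar>" by simp
      then have "0 < x\<^sup>2" using radius_ge_1 by auto
      then have "0 < c\<^sub>0 / 2 * x\<^sup>2" using c0 by simp
      then show False using W_minus_barrier[OF x] barrier_U[of x] elim by linarith
    qed
  qed
qed

lemma prob_outside: "\<mu>.prob {radius<..} = 0" "\<mu>.prob {..<-radius} = 0"
proof -
  have "AE x in \<mu>. x \<notin> {radius<..}" "AE x in \<mu>. x \<notin> {..<-radius}"
    using AE_support by (auto elim!: eventually_mono)
  then show "\<mu>.prob {radius<..} = 0" "\<mu>.prob {..<-radius} = 0"
    by (auto simp: \<mu>.prob_eq_0)
qed

text \<open>\<open>ln (1 + \<bar>x\<bar>)\<close> is subadditive, and \<open>ln (1 + u)\<close> is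
  at most \<open>2 * sqrt u\<close>.\<close>

lemma barrier_hoelder: "barrier (x + t) \<le> barrier x + 4 * sqrt \<bar>t\<bar>"
proof -
  have "1 + \<bar>x + t\<bar> \<le> (1 + \<bar>x\<bar>) * (1 + \<bar>t\<bar>)"
    using abs_triangle_ineq[of x t] mult_nonneg_nonneg[OF abs_ge_zero[of x] abs_ge_zero[of t]]
    unfolding distrib_left distrib_right by linarith
  then have "ln (1 + \<bar>x + t\<bar>) \<le> ln ((1 + \<bar>x\<bar>) * (1 + \<bar>t\<bar>))"
    by (subst ln_le_cancel_iff) (auto intro!: mult_pos_pos add_pos_nonneg)
  also have "\<dots> = ln (1 + \<bar>x\<bar>) + ln (1 + \<bar>t\<bar>)"
  proof -
    have "1 + \<bar>x\<bar> > 0" "1 + \<bar>t\<bar> > 0" by linarith+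
    then show ?thesis by (simp add: ln_mult)
  qed
  finally show ?thesis
    using ln_one_plus_le_sqrt[of "\<bar>t\<bar>"] by (simp add: barrier_def)
qed

text \<open>The bound must hold for all \<open>t\<close>, as Cauchy steps are unbounded. Short steps
  from inside the window use the Lipschitz constant of \<open>W\<close>. All others use the barrier:
  from inside, the gap \<open>D\<close> between barrier and potential is absorbed by
  \<open>sqrt \<bar>t\<bar> \<ge> 1\<close>; from outside there is no gap.\<close>

lemma trunc_pot_hoelder:
  assumes "locally_lipschitz W"
  obtains H where "0 \<le> H" "\<And>x t. trunc_pot (x + t) \<le> trunc_pot x + H * sqrt \<bar>t\<bar>"
proof -
  obtain L where L: "0 \<le> L" "\<And>x y. x \<in> {-(radius+1)..radius+1} \<Longrightarrow> y \<in> {-(radius+1)..radius+1} \<Longrightarrow> \<bar>W x - W y\<bar> \<le> L * \<bar>x - y\<bar>"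
    using locally_lipschitz_on_Icc[OF assms] by blast
  have "continuous_on {-radius..radius} (\<lambda>x. barrier x - W x)"
    unfolding barrier_def by (intro continuous_intros continuous_on_subset[OF W_cont]) auto
  then obtain D where D: "\<And>x. x \<in> {-radius..radius} \<Longrightarrow> \<bar>barrier x - W x\<bar> \<le> D"
    using continuous_on_Icc_bounded by blast
  have D0: "0 \<le> D" using D[of 0] radius_ge_1 by fastforce
  have bD: "barrier x \<le> trunc_pot x + D" for x
  proof (cases "radius \<le> \<bar>x\<bar>")
    case True
    then show ?thesis using trunc_pot_outside[of x] D0 by simp
  next
    case False
    then have "\<bar>barrier x - W x\<bar> \<le> D" by (intro D) auto
    then show ?thesis using D0 by (simp add: trunc_pot_def min_def abs_le_iff)
  qed
  have "trunc_pot (x + t) \<le> trunc_pot x + (L + 4 + D) * sqrt \<bar>t\<bar>" for x t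
  proof (cases "\<bar>t\<bar> \<le> 1 \<and> \<bar>x\<bar> \<le> radius")
    case True
    have s: "\<bar>t\<bar> \<le> sqrt \<bar>t\<bar>" using True by (intro le_sqrt_self) auto
    have "W (x + t) \<le> W x + L * \<bar>t\<bar>"
      using L(2)[of "x + t" x] True by (auto simp: abs_le_iff)
    also have "\<dots> \<le> W x + L * sqrt \<bar>t\<bar>" using s L(1) by (intro add_left_mono mult_left_mono) auto
    finally have "trunc_pot (x + t) \<le> trunc_pot x + (L + 4) * sqrt \<bar>t\<bar>"
      using barrier_hoelder[of x t] mult_nonneg_nonneg[OF L(1), of "sqrt \<bar>t\<bar>"] real_sqrt_ge_zero[of "\<bar>t\<bar>"]
      unfolding trunc_pot_def distrib_right by linarith
    then show ?thesis using mult_nonneg_nonneg[OF D0, of "sqrt \<bar>t\<bar>"] real_sqrt_ge_zero[of "\<bar>t\<bar>"]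
      unfolding distrib_right by linarith
  next
    case False
    have "barrier x \<le> trunc_pot x + D * sqrt \<bar>t\<bar>"
    proof (cases "\<bar>x\<bar> \<le> radius")
      case True
      then have "1 \<le> sqrt \<bar>t\<bar>" using False by simp
      then have "D * 1 \<le> D * sqrt \<bar>t\<bar>" using D0 by (intro mult_left_mono)
      then show ?thesis using bD[of x] by simp
    next
      case False
      then show ?thesis using trunc_pot_outside[of x] D0 by simp
    qed
    then have "trunc_pot (x + t) \<le> trunc_pot x + D * sqrt \<bar>t\<bar> + 4 * sqrt \<bar>t\<bar>"
      using barrier_hoelder[of x t] by (simp add: trunc_pot_def)
    then show ?thesis using mult_nonneg_nonneg[OF L(1), of "sqrt \<bar>t\<bar>"] by (simp add: algebra_simps)
  qed
  then show ?thesis using that[of "L + 4 + D"] L(1) D0 by simp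
qed

section \<open>Regularised logarithmic potentials\<close>

definition U_trunc :: "real \<Rightarrow> real \<Rightarrow> real" where
  "U_trunc R x = (\<integral>y. trunc_log R (x - y) \<partial>\<mu>)"

lemma \<mu>_integrable_continuous:
  assumes "continuous_on {-radius..radius} f" "f \<in> borel_measurable borel"
  shows "integrable \<mu> (f :: real \<Rightarrow> real)"
proof -
  obtain K where "\<And>x. x \<in> {-radius..radius} \<Longrightarrow> \<bar>f x\<bar> \<le> K"
    using continuous_on_Icc_bounded[OF assms(1)] by blast
  then have D: "norm (f x) \<le> K" if "\<bar>x\<bar> < radius" for x using that by (simp add: abs_less_iff)
  have "AE x in \<mu>. norm (f x) \<le> K"
    using AE_support by (rule eventually_mono) (rule D)
  then show ?thesis
    using assms(2) by (intro \<mu>.integrable_const_bound[where B=K]) auto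
qed

lemma integrable_trunc_log:
  assumes "R > 0"
  shows "integrable \<mu> (\<lambda>y. trunc_log R (x - y))"
proof (rule \<mu>_integrable_continuous)
  show "continuous_on {-radius..radius} (\<lambda>y. trunc_log R (x - y))"
    unfolding trunc_log_def
    by (intro continuous_on_diff continuous_on_const continuous_on_compose2[OF continuous_on_Ein] continuous_intros)
      (use assms in auto)
  have [measurable]: "(\<lambda>a. Ein (R * \<bar>a\<bar>)) \<in> borel_measurable borel" using assms by (intro Ein_measurable) auto
  show "(\<lambda>y. trunc_log R (x - y)) \<in> borel_measurable borel"
    unfolding trunc_log_def by measurable
qed

text \<open>Fubini's theorem for the Cauchy average of \<open>U\<close>, with the inner average
  known in closed form.\<close>

lemma poisson_U:
  assumes \<epsilon>: "\<epsilon> > 0"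
  shows "has_bochner_integral lborel (\<lambda>\<theta>. indicator half_circle \<theta> * U (x + \<epsilon> * tan \<theta>))
     (pi * (\<integral>y. - ln ((x - y)\<^sup>2 + \<epsilon>\<^sup>2) / 2 \<partial>\<mu>))"
    and "integrable \<mu> (\<lambda>y. - ln ((x - y)\<^sup>2 + \<epsilon>\<^sup>2) / 2)"
proof -
  interpret P: pair_sigma_finite \<mu> lborel by unfold_locales
  define T where "T = tan_moment"
  define f where "f = (\<lambda>(y, \<theta>). indicator half_circle \<theta> * - ln \<bar>x - y + \<epsilon> * tan \<theta>\<bar>)"
  have [measurable]: "f \<in> borel_measurable (borel \<Otimes>\<^sub>M borel)" unfolding f_def by measurable
  have pos: "(x - y)\<^sup>2 + \<epsilon>\<^sup>2 \<noteq> 0" for y using \<epsilon> by (simp add: sum_power2_eq_zero_iff)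
  show il: "integrable \<mu> (\<lambda>y. - ln ((x - y)\<^sup>2 + \<epsilon>\<^sup>2) / 2)"
    using pos by (intro \<mu>_integrable_continuous continuous_intros) auto
  have hb: "has_bochner_integral lborel (\<lambda>\<theta>. f (y, \<theta>)) (pi * (- ln ((x - y)\<^sup>2 + \<epsilon>\<^sup>2) / 2))" for y
    using has_bochner_integral_minus[OF has_bochner_integral_ln_tan[OF \<epsilon>, of "x - y"]] by (simp add: f_def)
  \<comment> \<open>If \<open>- f \<le> g\<close> and \<open>0 \<le> g\<close>, then
    \<open>\<bar>f\<bar> \<le> 2 * g + f\<close>. The right side has an explicit integral over
    \<open>\<theta>\<close>, so the singularity of the logarithm needs no separate majorant.\<close>
  let ?b = "\<lambda>y \<theta>. 2 * (indicator half_circle \<theta> * ln (1 + \<bar>x - y\<bar>)) + 4 * sqrt \<epsilon> * (indicator half_circle \<theta> * sqrt \<bar>tan \<theta>\<bar>) + f (y, \<theta>)"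
  have hB: "has_bochner_integral lborel (?b y)
      (2 * (pi * ln (1 + \<bar>x - y\<bar>)) + 4 * sqrt \<epsilon> * T + pi * (- ln ((x - y)\<^sup>2 + \<epsilon>\<^sup>2) / 2))" for y
  proof -
    show ?thesis
      unfolding T_def using hb integrable_sqrt_tan has_bochner_integral_half_circle
      by (intro has_bochner_integral_add has_bochner_integral_mult_right has_bochner_integral_mult_left has_bochner_integral_integrable)
  qed
  have le: "norm (f (y, \<theta>)) \<le> ?b y \<theta>" for y \<theta>
  proof (cases "\<theta> \<in> half_circle")
    case True
    define v where "v = x - y + \<epsilon> * tan \<theta>"
    define g where "g = ln (1 + \<bar>x - y\<bar>) + 2 * sqrt \<epsilon> * sqrt \<bar>tan \<theta>\<bar>"
    have "ln \<bar>v\<bar> \<le> ln (1 + \<bar>x - y\<bar>) + ln (1 + \<bar>\<epsilon> * tan \<theta>\<bar>)"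
      using ln_abs_diff_le[of "x - y" "- (\<epsilon> * tan \<theta>)"] by (simp add: v_def)
    also have "\<dots> \<le> ln (1 + \<bar>x - y\<bar>) + 2 * sqrt \<bar>\<epsilon> * tan \<theta>\<bar>"
      by (intro add_left_mono ln_one_plus_le_sqrt) auto
    also have "\<dots> = g" using \<epsilon> by (simp add: abs_mult real_sqrt_mult g_def)
    finally have "ln \<bar>v\<bar> \<le> g" .
    moreover have "0 \<le> g" using \<epsilon> by (simp add: g_def)
    ultimately have "\<bar>ln \<bar>v\<bar>\<bar> \<le> 2 * g - ln \<bar>v\<bar>" by linarith
    then show ?thesis using True by (simp add: f_def v_def g_def)
  qed (simp add: f_def)
  have int: "integrable (\<mu> \<Otimes>\<^sub>M lborel) f"
  proof (rule P.Fubini_integrable)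
    show "AE y in \<mu>. integrable lborel (\<lambda>\<theta>. f (y, \<theta>))"
      using hb by (auto intro: integrable.intros)
    show "integrable \<mu> (\<lambda>y. \<integral>\<theta>. norm (f (y, \<theta>)) \<partial>lborel)"
    proof (rule Bochner_Integration.integrable_bound)
      show "integrable \<mu> (\<lambda>y. 2 * (pi * ln (1 + \<bar>x - y\<bar>)) + 4 * sqrt \<epsilon> * T + pi * (- ln ((x - y)\<^sup>2 + \<epsilon>\<^sup>2) / 2))"
        by (intro Bochner_Integration.integrable_add integrable_mult_right il \<mu>_integrable_continuous continuous_intros) auto
      show "AE y in \<mu>. norm (\<integral>\<theta>. norm (f (y, \<theta>)) \<partial>lborel) \<le> norm (2 * (pi * ln (1 + \<bar>x - y\<bar>)) + 4 * sqrt \<epsilon> * T + pi * (- ln ((x - y)\<^sup>2 + \<epsilon>\<^sup>2) / 2))"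
      proof (intro AE_I2)
        fix y
        have "(\<integral>\<theta>. norm (f (y, \<theta>)) \<partial>lborel) \<le> (\<integral>\<theta>. ?b y \<theta> \<partial>lborel)"
          by (intro integral_mono le integrable_norm integrable.intros[OF hb] integrable.intros[OF hB])
        moreover have "0 \<le> (\<integral>\<theta>. norm (f (y, \<theta>)) \<partial>lborel)" by (intro Bochner_Integration.integral_nonneg) auto
        ultimately show "norm (\<integral>\<theta>. norm (f (y, \<theta>)) \<partial>lborel) \<le> norm (2 * (pi * ln (1 + \<bar>x - y\<bar>)) + 4 * sqrt \<epsilon> * T + pi * (- ln ((x - y)\<^sup>2 + \<epsilon>\<^sup>2) / 2))"
          unfolding has_bochner_integral_integral_eq[OF hB] by simp
      qed
    qed measurable
  qed measurable
  have int': "integrable (\<mu> \<Otimes>\<^sub>M lborel) (\<lambda>(y, \<theta>). f (y, \<theta>))" using int by simp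
  have inner: "(\<integral>y. f (y, \<theta>) \<partial>\<mu>) = indicator half_circle \<theta> * U (x + \<epsilon> * tan \<theta>)" for \<theta>
    by (simp add: f_def U_def algebra_simps)
  have "(\<integral>\<theta>. (\<integral>y. f (y, \<theta>) \<partial>\<mu>) \<partial>lborel) = (\<integral>y. (\<integral>\<theta>. f (y, \<theta>) \<partial>lborel) \<partial>\<mu>)"
    using P.Fubini_integral[OF int'] by simp
  also have "\<dots> = (\<integral>y. pi * (- ln ((x - y)\<^sup>2 + \<epsilon>\<^sup>2) / 2) \<partial>\<mu>)"
    using has_bochner_integral_integral_eq[OF hb] by simp
  also have "\<dots> = pi * (\<integral>y. - ln ((x - y)\<^sup>2 + \<epsilon>\<^sup>2) / 2 \<partial>\<mu>)"
    by (rule integral_mult_right_zero)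
  finally show "has_bochner_integral lborel (\<lambda>\<theta>. indicator half_circle \<theta> * U (x + \<epsilon> * tan \<theta>))
     (pi * (\<integral>y. - ln ((x - y)\<^sup>2 + \<epsilon>\<^sup>2) / 2 \<partial>\<mu>))"
    using P.integrable_snd[OF int'] unfolding inner by (simp add: has_bochner_integral_iff)
qed

text \<open>The truncated kernel dominates the Poisson regularisation of \<open>- ln\<close>, and averaging the
  Euler-Lagrange inequality over the Cauchy distribution costs only the modulus of continuity
  of the potential.\<close>

lemma truncated_euler_lagrange:
  assumes H: "0 \<le> H" "\<And>x t. trunc_pot (x + t) \<le> trunc_pot x + H * sqrt \<bar>t\<bar>" and R: "R > 0"
  shows "robin - trunc_pot x - H * tan_moment * sqrt (sqrt 2 / R) \<le> 2 * U_trunc R x"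
proof -
  define T where "T = tan_moment"
  \<comment> \<open>The scale at which the Poisson regularisation is exactly the lower bound for
    \<open>trunc_log R\<close>.\<close>
  define \<epsilon> where "\<epsilon> = sqrt 2 / R"
  have \<epsilon>: "\<epsilon> > 0" "\<epsilon>\<^sup>2 = 2 / R\<^sup>2" using R by (auto simp: \<epsilon>_def power_divide)
  define u where "u = (\<integral>y. - ln ((x - y)\<^sup>2 + \<epsilon>\<^sup>2) / 2 \<partial>\<mu>)"
  note P = poisson_U[OF \<epsilon>(1), of x]
  have T0: "0 \<le> T" unfolding T_def by (intro Bochner_Integration.integral_nonneg) auto
  have "u \<le> U_trunc R x"
    unfolding u_def U_trunc_def using trunc_log_ge[OF R] R
    by (intro integral_mono P(2) integrable_trunc_log) (auto simp: \<epsilon>(2))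
  have l: "has_bochner_integral lborel (\<lambda>\<theta>. (robin - trunc_pot x) * indicator half_circle \<theta> - H * sqrt \<epsilon> * (indicator half_circle \<theta> * sqrt \<bar>tan \<theta>\<bar>))
     ((robin - trunc_pot x) * pi - H * sqrt \<epsilon> * T)"
    unfolding T_def using has_bochner_integral_half_circle integrable_sqrt_tan
    by (intro has_bochner_integral_diff has_bochner_integral_mult_right has_bochner_integral_integrable)
  have r: "has_bochner_integral lborel (\<lambda>\<theta>. 2 * (indicator half_circle \<theta> * U (x + \<epsilon> * tan \<theta>))) (2 * (pi * u))"
    unfolding u_def using P(1) by (rule has_bochner_integral_mult_right)
  have "(\<integral>\<theta>. (robin - trunc_pot x) * indicator half_circle \<theta> - H * sqrt \<epsilon> * (indicator half_circle \<theta> * sqrt \<bar>tan \<theta>\<bar>) \<partial>lborel)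
     \<le> (\<integral>\<theta>. 2 * (indicator half_circle \<theta> * U (x + \<epsilon> * tan \<theta>)) \<partial>lborel)"
  proof (rule integral_mono_AE)
    show "AE \<theta> in lborel. (robin - trunc_pot x) * indicator half_circle \<theta> - H * sqrt \<epsilon> * (indicator half_circle \<theta> * sqrt \<bar>tan \<theta>\<bar>)
      \<le> 2 * (indicator half_circle \<theta> * U (x + \<epsilon> * tan \<theta>))"
      using AE_tan[OF trunc_pot_U \<epsilon>(1), of x]
    proof eventually_elim
      case (elim \<theta>)
      show ?case
      proof (cases "\<theta> \<in> half_circle")
        case True
        have "sqrt \<bar>\<epsilon> * tan \<theta>\<bar> = sqrt \<epsilon> * sqrt \<bar>tan \<theta>\<bar>" using \<epsilon>(1) by (simp add: abs_mult real_sqrt_mult)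
        then show ?thesis using elim True H(2)[of x "\<epsilon> * tan \<theta>"] by (simp add: mult.assoc)
      qed simp
    qed
  qed (rule integrable.intros[OF l], rule integrable.intros[OF r])
  then have "(robin - trunc_pot x) * pi - H * sqrt \<epsilon> * T \<le> 2 * (pi * u)"
    unfolding has_bochner_integral_integral_eq[OF l] has_bochner_integral_integral_eq[OF r] .
  \<comment> \<open>Normalising the average divides the error by \<open>pi\<close>; giving this
    factor away keeps the statement free of it.\<close>
  moreover have "H * sqrt \<epsilon> * T * 1 \<le> H * sqrt \<epsilon> * T * pi"
    using H(1) \<epsilon>(1) T0 pi_ge_two by (intro mult_left_mono) auto
  ultimately have "(robin - trunc_pot x - H * T * sqrt \<epsilon>) * pi \<le> (2 * u) * pi"
    by (simp add: algebra_simps)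
  then have "robin - trunc_pot x - H * T * sqrt \<epsilon> \<le> 2 * u"
    by (rule mult_right_le_imp_le) simp
  with \<open>u \<le> U_trunc R x\<close> show ?thesis unfolding T_def \<epsilon>_def by linarith
qed

end

subsection \<open>The energy of a configuration\<close>

lemma (in two_distributions) energy_dist_nonneg:
  assumes "0 \<le> R" "integrable \<alpha> (\<lambda>x. x)" "integrable \<beta> (\<lambda>x. x)"
  shows "0 \<le> energy_dist R"
proof -
  have "0 \<le> (\<integral>s. indicator {0<..R} s * (2 * lap_norm_sq s) \<partial>lborel)"
    by (intro Bochner_Integration.integral_nonneg mult_nonneg_nonneg) auto
  then show ?thesis
    using has_bochner_integral_integral_eq[OF has_bochner_integral_energy_dist[OF assms]] by simp
qed

lemma real_distribution_empirical:
  assumes "N \<ge> 1"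
  shows "real_distribution (empirical_measure N x)"
proof -
  interpret u: prob_space "uniform_count_measure {..<N}"
    using assms by (intro prob_space_uniform_count_measure) (auto simp: lessThan_empty_iff)
  have "prob_space (empirical_measure N x)"
    unfolding empirical_measure_def by (intro u.prob_space_distr measurableI) auto
  then show ?thesis
    by (simp add: real_distribution_def real_distribution_axioms_def empirical_measure_def)
qed

lemma
  assumes "f \<in> borel_measurable borel"
  shows integral_empirical: "(\<integral>u. f u \<partial>empirical_measure N x) = (\<Sum>i<N. f (x i)) / real N" (is ?A)
    and integrable_empirical: "integrable (empirical_measure N x) (f :: real \<Rightarrow> real)" (is ?B)
proof -
  have m: "x \<in> uniform_count_measure {..<N} \<rightarrow>\<^sub>M borel"
    by (intro measurableI) auto
  show ?A
    unfolding empirical_measure_def using assms m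
    by (subst integral_distr) (auto simp: integral_uniform_count_measure)
  show ?B
    unfolding empirical_measure_def using assms m
    by (subst integrable_distr_eq) (auto simp: uniform_count_measure_def intro!: integrable_point_measure_finite)
qed

lemma sum_symmetric_square:
  assumes "\<And>i j. f i j = f j (i :: nat)"
  shows "(\<Sum>i<N. \<Sum>j<N. f i j :: real) = (\<Sum>j<N. f j j) + 2 * (\<Sum>j<N. \<Sum>i<j. f i j)"
proof (induction N)
  case (Suc N)
  have "(\<Sum>i<Suc N. \<Sum>j<Suc N. f i j) = (\<Sum>i<N. \<Sum>j<N. f i j) + (\<Sum>i<N. f i N) + (\<Sum>j<N. f N j) + f N N"
    by (simp add: sum.distrib)
  also have "(\<Sum>j<N. f N j) = (\<Sum>i<N. f i N)" by (intro sum.cong assms) auto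
  finally show ?case using Suc by simp
qed simp

context equilibrium
begin

lemma U_trunc_le:
  assumes R: "R > 0"
  shows "integral\<^sup>L \<mu> (U_trunc R) \<le> I\<^sub>L"
proof -
  interpret T: two_distributions \<mu> \<mu> by unfold_locales
  have id: "integrable \<mu> (\<lambda>x. x)" using integrable_abs_\<mu> by (simp add: integrable_abs_iff)
  have Ui: "U_trunc R x = Ein_const + ln R - (\<integral>y. Ein (R * \<bar>x - y\<bar>) \<partial>\<mu>)" for x
    unfolding U_trunc_def trunc_log_def
    using T.integrable_Ein(1)[OF _ id id, of R x] R by (simp add: \<mu>.prob_space[simplified])
  have i: "integrable \<mu> (U_trunc R)"
    using T.integrable_Ein(2)[OF _ id id, of R] R unfolding Ui[abs_def] by simp
  have "integral\<^sup>L \<mu> (U_trunc R) \<le> integral\<^sup>L \<mu> U"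
  proof (intro integral_mono_AE i integrable_U)
    show "AE x in \<mu>. U_trunc R x \<le> U x"
      using \<mu>\<mu>.AE_integrable_fst[OF integrable_neg_log]
    proof eventually_elim
      case (elim x)
      have "AE y in \<mu>. trunc_log R (x - y) \<le> neg_log x y"
      proof -
        have "AE y in \<mu>. y \<noteq> x" using AE_lborel_singleton by (rule AE_\<mu>)
        then show ?thesis using trunc_log_le[OF R] by (auto elim!: eventually_mono)
      qed
      then show ?case
        unfolding U_trunc_def U_def using elim by (intro integral_mono_AE integrable_trunc_log R)
    qed
  qed
  then show "integral\<^sup>L \<mu> (U_trunc R) \<le> I\<^sub>L" using integrable_U(2) by simp
qed

text \<open>Completing the square around \<open>\<mu>\<close>: the truncated energy of the empirical
  measure is the energy of its difference from \<open>\<mu>\<close>, plus twice the cross term,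
  minus the self-energy of \<open>\<mu>\<close>. Truncation only lowers the pair interactions and
  the self-energy, while each of the \<open>N\<close> diagonal terms costs
  \<open>1 + ln R\<close>.\<close>

lemma gas_energy_lower_aux:
  assumes N: "N \<ge> 1" and x: "inj_on x {..<N}" and R: "R \<ge> 1"
  shows "real N * real N * two_distributions.energy_dist (empirical_measure N x) \<mu> R + 2 * real N * (\<Sum>i<N. U_trunc R (x i)) - real N * real N * I\<^sub>L
    \<le> 2 * pair_energy N x + real N * (1 + ln R)"
proof -
  interpret \<alpha>: real_distribution "empirical_measure N x" using N by (rule real_distribution_empirical)
  interpret T: two_distributions "empirical_measure N x" \<mu> by unfold_locales
  interpret \<mu>T: two_distributions \<mu> \<mu> by unfold_locales
  interpret \<alpha>T: two_distributions "empirical_measure N x" "empirical_measure N x" by unfold_locales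
  have R0: "R > 0" "0 \<le> R" using R by auto
  have N0: "real N > 0" using N by simp
  note Ein_measurable[OF R0(2), measurable]
  have id: "integrable \<mu> (\<lambda>x. x)" using integrable_abs_\<mu> by (simp add: integrable_abs_iff)
  define K where "K = Ein_const + ln R"
  have Ui: "U_trunc R u = K - (\<integral>y. Ein (R * \<bar>u - y\<bar>) \<partial>\<mu>)" for u
    unfolding U_trunc_def trunc_log_def K_def
    using \<mu>T.integrable_Ein(1)[OF _ id id, of R u] R0 by (simp add: \<mu>.prob_space[simplified])
  have mU [measurable]: "U_trunc R \<in> borel_measurable borel" unfolding Ui[abs_def] by measurable
  have 1: "\<mu>T.Ein_energy R \<ge> K - I\<^sub>L"
  proof -
    have "integral\<^sup>L \<mu> (U_trunc R) = K - \<mu>T.Ein_energy R"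
      unfolding Ui[abs_def] \<mu>T.Ein_energy_def using \<mu>T.integrable_Ein(2)[OF _ id id, of R] R0
      by (simp add: \<mu>.prob_space[simplified])
    then show ?thesis using U_trunc_le[OF R0(1)] by simp
  qed
  have 2: "real N * T.Ein_energy R = real N * K - (\<Sum>i<N. U_trunc R (x i))"
    unfolding T.Ein_energy_def using N0 by (subst integral_empirical) (simp_all add: Ui sum_subtractf)
  have 3: "real N * real N * \<alpha>T.Ein_energy R = (\<Sum>i<N. \<Sum>j<N. Ein (R * \<bar>x i - x j\<bar>))"
  proof -
    have "\<alpha>T.Ein_energy R = (\<Sum>i<N. (\<Sum>j<N. Ein (R * \<bar>x i - x j\<bar>)) / real N) / real N"
      unfolding \<alpha>T.Ein_energy_def by (subst integral_empirical, measurable, subst integral_empirical) auto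
    then show ?thesis using N0 by (simp add: sum_divide_distrib[symmetric])
  qed
  have "(\<Sum>i<N. \<Sum>j<N. trunc_log R (x i - x j)) \<le> real N * (1 + ln R) + 2 * pair_energy N x"
  proof -
    have "(\<Sum>i<N. \<Sum>j<N. trunc_log R (x i - x j)) = (\<Sum>j<N. trunc_log R 0) + 2 * (\<Sum>j<N. \<Sum>i<j. trunc_log R (x i - x j))"
      by (subst sum_symmetric_square) (auto simp: trunc_log_def abs_minus_commute)
    also have "\<dots> \<le> (\<Sum>j<N. 1 + ln R) + 2 * pair_energy N x"
    proof (intro add_mono mult_left_mono sum_mono trunc_log_0 R0 trunc_log_le)
      fix i j assume "j \<in> {..<N}" "i \<in> {..<j}"
      then show "x i - x j \<noteq> 0" using inj_onD[OF x, of i j] by auto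
    qed auto
    finally show ?thesis by simp
  qed
  moreover have "(\<Sum>i<N. \<Sum>j<N. trunc_log R (x i - x j)) = real N * real N * K - (\<Sum>i<N. \<Sum>j<N. Ein (R * \<bar>x i - x j\<bar>))"
    by (simp add: trunc_log_def K_def sum_subtractf)
  ultimately have 4: "real N * real N * K - real N * real N * \<alpha>T.Ein_energy R
     \<le> real N * (1 + ln R) + 2 * pair_energy N x"
    using 3 by simp
  have "real N * real N * T.energy_dist R = 2 * real N * (real N * T.Ein_energy R) - real N * real N * \<alpha>T.Ein_energy R - real N * real N * \<mu>T.Ein_energy R"
    by (simp add: T.energy_dist_def algebra_simps)
  also have "\<dots> = 2 * real N * (real N * K) - 2 * real N * (\<Sum>i<N. U_trunc R (x i)) - real N * real N * \<alpha>T.Ein_energy R - real N * real N * \<mu>T.Ein_energy R"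
    unfolding 2 by (simp add: algebra_simps)
  finally have 5: "real N * real N * T.energy_dist R + 2 * real N * (\<Sum>i<N. U_trunc R (x i))
     = 2 * (real N * real N * K) - real N * real N * \<alpha>T.Ein_energy R - real N * real N * \<mu>T.Ein_energy R"
    by simp
  have "real N * real N * (K - I\<^sub>L) \<le> real N * real N * \<mu>T.Ein_energy R"
    using 1 by (intro mult_left_mono) auto
  then have "real N * real N * K - real N * real N * I\<^sub>L \<le> real N * real N * \<mu>T.Ein_energy R"
    by (simp add: right_diff_distrib)
  then show ?thesis using 4 5 by linarith
qed

text \<open>Half of the excess \<open>W - trunc_pot\<close> pays for the second moment outside the
  window in the bound for \<open>W1\<close>. The other half stays in the conclusion, where it will
  make the Gibbs weight integrable.\<close>

lemma gas_energy_lower: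
  assumes "locally_lipschitz W"
  obtains \<kappa> C where "0 < \<kappa>" "0 \<le> C"
    "\<And>N x \<theta>. N \<ge> 1 \<Longrightarrow> inj_on x {..<N} \<Longrightarrow> 0 \<le> \<theta> \<Longrightarrow> ennreal \<theta> \<le> W1 (empirical_measure N x) \<mu> \<Longrightarrow>
      (real N)\<^sup>2 * (I\<^sub>W + I\<^sub>L) + \<kappa> * (real N)\<^sup>2 * \<theta>\<^sup>2 + real N / 2 * (\<Sum>i<N. W (x i) - trunc_pot (x i)) - C * real N * ln (1 + real N)
      \<le> 2 * pair_energy N x + real N * (\<Sum>i<N. W (x i))"
proof -
  obtain H where H: "0 \<le> H" "\<And>x t. trunc_pot (x + t) \<le> trunc_pot x + H * sqrt \<bar>t\<bar>"
    using trunc_pot_hoelder[OF assms] by blast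
  define T where "T = tan_moment"
  have T0: "0 \<le> T" unfolding T_def by (intro Bochner_Integration.integral_nonneg) auto
  define M where "M = radius"
  define K\<^sub>1 where "K\<^sub>1 = 6 * M * (1 + 2 * M)\<^sup>2"
  define K\<^sub>2 where "K\<^sub>2 = (12 * M\<^sup>2 + 3) * (2 / c\<^sub>0)"
  have M: "1 \<le> M" by (simp add: M_def radius_ge_1)
  have "0 < 12 * M\<^sup>2 + 3" using zero_le_power2[of M] by linarith
  then have K: "0 < K\<^sub>1" "0 < K\<^sub>2"
    using M c0 by (auto simp: K\<^sub>1_def K\<^sub>2_def intro!: mult_pos_pos divide_pos_pos simp del: distrib_left_numeral)
  \<comment> \<open>The two bounds spend at most the whole energy distance and at most half of the
    potential excess.\<close>
  define \<kappa> where "\<kappa> = min (1 / K\<^sub>1) (1 / (2 * K\<^sub>2))"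
  define A where "A = 2 * H * T + 1"
  \<comment> \<open>\<open>A\<close> bounds the errors linear in \<open>N\<close>, from smoothing
    and from the diagonal. It is doubled because \<open>ln (1 + n) \<ge> 1 / 2\<close>; the summand
    \<open>2\<close> pays for \<open>ln R = 2 * ln n\<close>.\<close>
  define C where "C = 2 * A + 2"
  have \<kappa>: "0 < \<kappa>" "\<kappa> * K\<^sub>1 \<le> 1" "\<kappa> * K\<^sub>2 \<le> 1 / 2"
  proof -
    show "0 < \<kappa>" using K by (simp add: \<kappa>_def)
    have "\<kappa> * K\<^sub>1 \<le> 1 / K\<^sub>1 * K\<^sub>1" using K by (intro mult_right_mono) (auto simp: \<kappa>_def)
    then show "\<kappa> * K\<^sub>1 \<le> 1" using K by simp
    have "\<kappa> * K\<^sub>2 \<le> 1 / (2 * K\<^sub>2) * K\<^sub>2" using K by (intro mult_right_mono) (auto simp: \<kappa>_def)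
    then show "\<kappa> * K\<^sub>2 \<le> 1 / 2" using K by simp
  qed
  have A0: "0 \<le> A" using H(1) T0 by (simp add: A_def)
  show ?thesis
  proof (rule that[of \<kappa> C])
    show "0 < \<kappa>" by (rule \<kappa>)
    show "0 \<le> C" using A0 by (simp add: C_def)
    fix N :: nat and x \<theta>
    assume N: "N \<ge> 1" and x: "inj_on x {..<N}" and \<theta>: "0 \<le> \<theta>" and W1: "ennreal \<theta> \<le> W1 (empirical_measure N x) \<mu>"
    interpret \<alpha>: real_distribution "empirical_measure N x" using N by (rule real_distribution_empirical)
    interpret T: two_distributions "empirical_measure N x" \<mu> by unfold_locales
    define n where "n = real N"
    have n: "1 \<le> n" using N by (simp add: n_def)
    \<comment> \<open>A smoothing error of order \<open>1 / sqrt R\<close> for each point has to be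
      \<open>O(1 / n)\<close>, as it is multiplied by \<open>n\<^sup>2\<close> in total; the
      diagonal feels \<open>R\<close> only through its logarithm.\<close>
    define R where "R = n * n"
    have R: "1 \<le> R" using n mult_mono[of 1 n 1 n] by (simp add: R_def)
    define E where "E = T.energy_dist R"
    define s where "s = (\<Sum>i<N. W (x i) - trunc_pot (x i))"
    have id: "integrable \<mu> (\<lambda>x. x)" using integrable_abs_\<mu> by (simp add: integrable_abs_iff)
    have sq: "integrable (empirical_measure N x) (\<lambda>x. x\<^sup>2)" "integrable (empirical_measure N x) (\<lambda>x. x)"
      by (intro integrable_empirical; simp)+
    have E0: "0 \<le> E" unfolding E_def using R sq id by (intro T.energy_dist_nonneg) auto
    have s0: "0 \<le> s" unfolding s_def using trunc_pot_le by (intro sum_nonneg) simp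
    have far: "n * T.far_moment 2 M \<le> 2 / c\<^sub>0 * s"
    proof -
      have "n * T.far_moment 2 M = (\<Sum>i<N. indicator {x. M < \<bar>x\<bar>} (x i) * \<bar>x i\<bar>\<^sup>2)"
        unfolding T.far_moment_def using n by (subst integral_empirical) (auto simp: n_def)
      also have "\<dots> \<le> (\<Sum>i<N. 2 / c\<^sub>0 * (W (x i) - trunc_pot (x i)))"
      proof (rule sum_mono)
        show "indicator {x. M < \<bar>x\<bar>} (x i) * \<bar>x i\<bar>\<^sup>2 \<le> 2 / c\<^sub>0 * (W (x i) - trunc_pot (x i))" for i
          using W_minus_trunc_pot[of "x i"] c0 unfolding M_def by (simp add: field_simps)
      qed
      finally show ?thesis by (simp add: s_def sum_distrib_left)
    qed
    have th: "\<kappa> * (n * n) * \<theta>\<^sup>2 \<le> n * n * E + n / 2 * s"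
    proof -
      have "ennreal \<theta> \<le> ennreal (T.tail_dist M + T.far_moment 1 M)"
        by (rule order_trans[OF W1 T.W1_le_tail_dist[OF sq(1) M]]) (use prob_outside in \<open>simp_all add: M_def\<close>)
      moreover have "0 \<le> T.tail_dist M + T.far_moment 1 M"
        using T.tail_dist_nonneg by (intro add_nonneg_nonneg) (auto simp: T.far_moment_def intro!: Bochner_Integration.integral_nonneg)
      ultimately have "\<theta> \<le> T.tail_dist M + T.far_moment 1 M" by (simp add: ennreal_le_iff)
      then have "\<theta>\<^sup>2 \<le> (T.tail_dist M + T.far_moment 1 M)\<^sup>2" using \<theta> by (intro power_mono)
      also have "\<dots> \<le> K\<^sub>1 * E + (12 * M\<^sup>2 + 3) * T.far_moment 2 M"
        unfolding K\<^sub>1_def E_def using prob_outside by (intro T.energy_dist_ge sq id R M) (simp add: M_def)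
      finally have "n * \<theta>\<^sup>2 \<le> n * (K\<^sub>1 * E + (12 * M\<^sup>2 + 3) * T.far_moment 2 M)" using n by (intro mult_left_mono) auto
      also have "\<dots> = K\<^sub>1 * (n * E) + (12 * M\<^sup>2 + 3) * (n * T.far_moment 2 M)" by (simp add: algebra_simps)
      also have "\<dots> \<le> K\<^sub>1 * (n * E) + (12 * M\<^sup>2 + 3) * (2 / c\<^sub>0 * s)"
        using far by (intro add_left_mono mult_left_mono) auto
      also have "\<dots> = K\<^sub>1 * (n * E) + K\<^sub>2 * s" by (simp add: K\<^sub>2_def)
      finally have "\<kappa> * (n * \<theta>\<^sup>2) \<le> \<kappa> * (K\<^sub>1 * (n * E) + K\<^sub>2 * s)" using \<kappa>(1) by (intro mult_left_mono) auto
      also have "\<dots> = \<kappa> * K\<^sub>1 * (n * E) + \<kappa> * K\<^sub>2 * s" by (simp add: algebra_simps)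
      also have "\<dots> \<le> 1 * (n * E) + 1 / 2 * s"
        using \<kappa> n E0 s0 by (intro add_mono mult_right_mono) auto
      finally have "n * (\<kappa> * (n * \<theta>\<^sup>2)) \<le> n * (1 * (n * E) + 1 / 2 * s)" using n by (intro mult_left_mono) auto
      then show ?thesis by (simp add: algebra_simps)
    qed
    have err: "H * T * sqrt (sqrt 2 / R) \<le> 2 * H * T / n"
    proof -
      have "sqrt 2 \<le> 4" by (rule real_le_lsqrt) auto
      then have "sqrt 2 / R \<le> 4 / R" using R by (intro divide_right_mono) auto
      also have "\<dots> = (2 / n)\<^sup>2" by (simp add: R_def power2_eq_square)
      finally have "sqrt (sqrt 2 / R) \<le> 2 / n" using n by (intro real_le_lsqrt) auto
      then have "H * T * sqrt (sqrt 2 / R) \<le> H * T * (2 / n)" using H(1) T0 by (intro mult_left_mono) auto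
      then show ?thesis by (simp add: mult_ac)
    qed
    have "(\<Sum>i<N. robin - trunc_pot (x i) - 2 * H * T / n) \<le> (\<Sum>i<N. 2 * U_trunc R (x i))"
    proof (intro sum_mono)
      fix i
      show "robin - trunc_pot (x i) - 2 * H * T / n \<le> 2 * U_trunc R (x i)"
        using truncated_euler_lagrange[OF H, of R "x i"] R err by (simp add: T_def)
    qed
    then have "n * (\<Sum>i<N. robin - trunc_pot (x i) - 2 * H * T / n) \<le> n * (\<Sum>i<N. 2 * U_trunc R (x i))"
      using n by (intro mult_left_mono) auto
    also have "n * (\<Sum>i<N. robin - trunc_pot (x i) - 2 * H * T / n) = n * n * robin - n * (\<Sum>i<N. trunc_pot (x i)) - n * (2 * H * T)"
    proof -
      have "(\<Sum>i<N. robin - trunc_pot (x i) - 2 * H * T / n) = n * robin - (\<Sum>i<N. trunc_pot (x i)) - n * (2 * H * T / n)"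
        by (simp add: sum_subtractf n_def)
      also have "n * (2 * H * T / n) = 2 * H * T" using n by simp
      finally show ?thesis by (simp only: right_diff_distrib mult.assoc)
    qed
    also have "n * (\<Sum>i<N. 2 * U_trunc R (x i)) = 2 * n * (\<Sum>i<N. U_trunc R (x i))"
      by (simp add: sum_distrib_left mult_ac)
    finally have EL: "n * n * robin - n * (\<Sum>i<N. trunc_pot (x i)) - n * (2 * H * T) \<le> 2 * n * (\<Sum>i<N. U_trunc R (x i))" .
    have aux: "n * n * E + 2 * n * (\<Sum>i<N. U_trunc R (x i)) - n * n * I\<^sub>L \<le> 2 * pair_energy N x + n * (1 + ln R)"
      unfolding n_def E_def by (rule gas_energy_lower_aux[OF N x R])
    have lnR: "ln R = 2 * ln n" using n by (simp add: R_def ln_mult)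
    have ln1: "1 / 2 \<le> ln (1 + n)"
    proof -
      have "1 / 2 \<le> ln (2 :: real)" using ln2_ge_two_thirds by simp
      also have "\<dots> \<le> ln (1 + n)" using n by (subst ln_le_cancel_iff) auto
      finally show ?thesis .
    qed
    have C_le: "n * (2 * H * T) + n * (1 + ln R) \<le> C * n * ln (1 + n)"
    proof -
      have "ln n \<le> ln (1 + n)" using n by (subst ln_le_cancel_iff) auto
      moreover have "A * 1 \<le> A * (2 * ln (1 + n))" using A0 ln1 by (intro mult_left_mono) auto
      ultimately have "A + 2 * ln n \<le> C * ln (1 + n)" by (simp add: C_def algebra_simps)
      then have "n * (A + 2 * ln n) \<le> n * (C * ln (1 + n))" using n by (intro mult_left_mono) auto
      then show ?thesis by (simp add: A_def lnR algebra_simps)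
    qed
    have sW: "n * s = n * (\<Sum>i<N. W (x i)) - n * (\<Sum>i<N. trunc_pot (x i))"
      by (simp add: s_def sum_subtractf right_diff_distrib)
    have rob: "n * n * robin = n * n * (I\<^sub>W + I\<^sub>L) + n * n * I\<^sub>L" by (simp add: robin_def algebra_simps)
    have half: "n * s = n / 2 * s + n / 2 * s" by simp
    have "n * n * (I\<^sub>W + I\<^sub>L) + \<kappa> * (n * n) * \<theta>\<^sup>2 + n / 2 * s - C * n * ln (1 + n)
      \<le> 2 * pair_energy N x + n * (\<Sum>i<N. W (x i))"
      using th EL aux C_le sW rob half by linarith
    then show "(real N)\<^sup>2 * (I\<^sub>W + I\<^sub>L) + \<kappa> * (real N)\<^sup>2 * \<theta>\<^sup>2 + real N / 2 * (\<Sum>i<N. W (x i) - trunc_pot (x i)) - C * real N * ln (1 + real N)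
      \<le> 2 * pair_energy N x + real N * (\<Sum>i<N. W (x i))"
      by (simp add: n_def s_def power2_eq_square)
  qed
qed

end

subsection \<open>Gibbs measures\<close>

lemma lebN_component: "i < N \<Longrightarrow> (\<lambda>x. x i) \<in> borel_measurable (lebN N)"
  using measurable_component_singleton[of i "{..<N}" "\<lambda>_. lborel"] by (simp add: lebN_def)

lemma gibbs_weight_measurable [measurable]:
  assumes [measurable]: "V \<in> borel_measurable borel"
  shows "gibbs_weight V \<beta> N \<in> borel_measurable (lebN N)"
proof -
  note lebN_component [measurable]
  have "(\<lambda>x. \<bar>x i - x j\<bar> powr \<beta>) \<in> borel_measurable (lebN N)" if "j < N" "i < j" for i j
  proof -
    have "i < N" using that by simp
    then show ?thesis using that by measurable
  qed
  then have "(\<lambda>x. \<Prod>j<N. \<Prod>i<j. \<bar>x i - x j\<bar> powr \<beta>) \<in> borel_measurable (lebN N)"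
    by (intro borel_measurable_prod) auto
  moreover have "(\<lambda>x. \<Sum>i<N. V (x i)) \<in> borel_measurable (lebN N)"
    by (intro borel_measurable_sum) auto
  ultimately show ?thesis
    unfolding gibbs_weight_def[abs_def] by measurable
qed

lemma gibbs_weight_not_inj:
  assumes "\<not> inj_on x {..<N}"
  shows "gibbs_weight V \<beta> N x = 0"
proof -
  obtain i j where "i < N" "j < N" "i \<noteq> j" "x i = x j"
    using assms by (auto simp: inj_on_def)
  then obtain i j where "i < j" "j < N" "x i = x j"
    by (cases i j rule: linorder_cases) auto
  then have "(\<Prod>i<j. \<bar>x i - x j\<bar> powr \<beta>) = 0" by (intro prod_zero) auto
  then have "(\<Prod>j<N. \<Prod>i<j. \<bar>x i - x j\<bar> powr \<beta>) = 0"
    using \<open>j < N\<close> by (intro prod_zero) auto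
  then show ?thesis by (simp add: gibbs_weight_def)
qed

lemma gibbs_weight_inj:
  assumes "inj_on x {..<N}"
  shows "gibbs_weight V \<beta> N x = exp (- \<beta> * pair_energy N x - real N * (\<Sum>i<N. V (x i)))"
proof -
  have "(\<Prod>j<N. \<Prod>i<j. \<bar>x i - x j\<bar> powr \<beta>) = (\<Prod>j<N. \<Prod>i<j. exp (- \<beta> * neg_log (x i) (x j)))"
  proof (intro prod.cong refl)
    fix i j assume "j \<in> {..<N}" "i \<in> {..<j}"
    then have "x i - x j \<noteq> 0" using inj_onD[OF assms, of i j] by auto
    then show "\<bar>x i - x j\<bar> powr \<beta> = exp (- \<beta> * neg_log (x i) (x j))" by (simp add: powr_def)
  qed
  also have "\<dots> = exp (- \<beta> * pair_energy N x)"
    by (simp add: exp_sum[symmetric] sum_distrib_left)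
  finally show ?thesis
    by (simp add: gibbs_weight_def exp_add[symmetric] exp_diff[symmetric] del: exp_of_nat_mult)
qed

lemma ennreal_integral_le_nn_integral:
  assumes "integrable M f"
  shows "ennreal (integral\<^sup>L M f) \<le> (\<integral>\<^sup>+x. ennreal (f x) \<partial>M)"
proof -
  have "(\<integral>\<^sup>+x. ennreal (f x) \<partial>M) < \<top>"
    using assms by (auto simp: real_integrable_def less_top)
  moreover have "integral\<^sup>L M f \<le> enn2real (\<integral>\<^sup>+x. ennreal (f x) \<partial>M)"
    using real_lebesgue_integral_def[OF assms] by simp
  ultimately show ?thesis by (metis ennreal_enn2real ennreal_leI)
qed

text \<open>Jensen's inequality from the tangent to \<open>exp\<close> at the mean. With an
  \<open>ennreal\<close> integral on the right, \<open>exp (Y x)\<close> may fail to be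
  integrable.\<close>

lemma (in prob_space) exp_expectation_le:
  assumes "integrable M (Y :: 'a \<Rightarrow> real)"
  shows "ennreal (exp (expectation Y)) \<le> (\<integral>\<^sup>+x. ennreal (exp (Y x)) \<partial>M)"
proof -
  define m where "m = expectation Y"
  have "exp m = expectation (\<lambda>x. exp m * (1 + (Y x - m)))"
    using assms by (simp add: m_def prob_space)
  then have "ennreal (exp m) \<le> (\<integral>\<^sup>+x. ennreal (exp m * (1 + (Y x - m))) \<partial>M)"
    using ennreal_integral_le_nn_integral[of M "\<lambda>x. exp m * (1 + (Y x - m))"] assms by simp
  also have "\<dots> \<le> (\<integral>\<^sup>+x. ennreal (exp (Y x)) \<partial>M)"
  proof (intro nn_integral_mono ennreal_leI)
    fix x
    have "exp m * (1 + (Y x - m)) \<le> exp m * exp (Y x - m)"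
      by (intro mult_left_mono exp_ge_add_one_self) auto
    then show "exp m * (1 + (Y x - m)) \<le> exp (Y x)" by (simp add: exp_add[symmetric])
  qed
  finally show ?thesis by (simp add: m_def)
qed

context equilibrium
begin

lemma \<mu>_fold: "density lborel (\<lambda>x. ennreal (\<rho> x)) = \<mu>"
  by (simp add: \<mu>_eq)

lemma product_prob_space_\<mu>: "product_prob_space (\<lambda>_::nat. \<mu>)"
  by (intro product_prob_spaceI \<mu>.prob_space_axioms)

abbreviation Pow_\<mu> :: "nat \<Rightarrow> (nat \<Rightarrow> real) measure" where
  "Pow_\<mu> N \<equiv> (\<Pi>\<^sub>M i\<in>{..<N}. \<mu>)"

lemma PiM_density: "density (lebN N) (\<lambda>x. \<Prod>i<N. ennreal (\<rho> (x i))) = (Pow_\<mu> N)"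
proof -
  interpret P: product_prob_space "\<lambda>_::nat. \<mu>" by (rule product_prob_space_\<mu>)
  interpret L: product_sigma_finite "\<lambda>_::nat. lborel :: real measure" by unfold_locales
  note lebN_component [measurable]
  have m: "(\<lambda>x. \<Prod>i<N. ennreal (\<rho> (x i))) \<in> borel_measurable (lebN N)"
    by (intro borel_measurable_prod_ennreal) auto
  show ?thesis
  proof (rule P.PiM_eqI)
    show "sets (density (lebN N) (\<lambda>x. \<Prod>i<N. ennreal (\<rho> (x i)))) = sets (Pow_\<mu> N)"
      by (auto simp: lebN_def intro!: sets_PiM_cong)
    fix A assume A: "\<And>i. i \<in> {..<N} \<Longrightarrow> A i \<in> sets \<mu>"
    have AE: "Pi\<^sub>E {..<N} A \<in> sets (lebN N)"
      unfolding lebN_def using A by (intro sets_PiM_I_finite) auto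
    have "emeasure (density (lebN N) (\<lambda>x. \<Prod>i<N. ennreal (\<rho> (x i)))) (Pi\<^sub>E {..<N} A)
      = (\<integral>\<^sup>+x. (\<Prod>i<N. ennreal (\<rho> (x i))) * indicator (Pi\<^sub>E {..<N} A) x \<partial>lebN N)"
      by (rule emeasure_density[OF m AE])
    also have "\<dots> = (\<integral>\<^sup>+x. (\<Prod>i<N. ennreal (\<rho> (x i)) * indicator (A i) (x i)) \<partial>lebN N)"
    proof (rule nn_integral_cong)
      fix x assume x: "x \<in> space (lebN N)"
      have "(\<Prod>i<N. indicator (A i) (x i) :: ennreal) = indicator (Pi\<^sub>E {..<N} A) x"
      proof (cases "x \<in> Pi\<^sub>E {..<N} A")
        case True
        then have "\<forall>i\<in>{..<N}. indicator (A i) (x i) = (1 :: ennreal)" by (simp add: PiE_iff)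
        then have "(\<Prod>i<N. indicator (A i) (x i) :: ennreal) = 1" by (rule prod.neutral)
        then show ?thesis using True by simp
      next
        case False
        then obtain i where "i < N" "x i \<notin> A i" using x unfolding lebN_def space_PiM PiE_iff by blast
        then have "\<exists>i\<in>{..<N}. indicator (A i) (x i) = (0 :: ennreal)" by (intro bexI[of _ i]) auto
        then have "(\<Prod>i<N. indicator (A i) (x i) :: ennreal) = 0" by (rule prod_zero[rotated]) simp
        then show ?thesis using False by simp
      qed
      then show "(\<Prod>i<N. ennreal (\<rho> (x i))) * indicator (Pi\<^sub>E {..<N} A) x = (\<Prod>i<N. ennreal (\<rho> (x i)) * indicator (A i) (x i))"
        by (simp add: prod.distrib)
    qed
    also have "\<dots> = (\<Prod>i<N. \<integral>\<^sup>+u. ennreal (\<rho> u) * indicator (A i) u \<partial>lborel)"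
      unfolding lebN_def using A by (intro L.product_nn_integral_prod) auto
    also have "\<dots> = (\<Prod>i<N. emeasure \<mu> (A i))"
      using A unfolding \<mu>_fold[symmetric] by (intro prod.cong refl) (simp add: emeasure_density)
    finally show "emeasure (density (lebN N) (\<lambda>x. \<Prod>i<N. ennreal (\<rho> (x i)))) (Pi\<^sub>E {..<N} A) = (\<Prod>i<N. emeasure \<mu> (A i))" .
  qed auto
qed

lemma distr_PiM_pair:
  fixes N :: nat
  assumes ij: "i < N" "j < N" "i \<noteq> j"
  shows "distr (Pow_\<mu> N) (\<mu> \<Otimes>\<^sub>M \<mu>) (\<lambda>x. (x i, x j)) = \<mu> \<Otimes>\<^sub>M \<mu>"
proof -
  interpret P: product_prob_space "\<lambda>_::nat. \<mu>" by (rule product_prob_space_\<mu>)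
  have [measurable]: "(\<lambda>x. x i) \<in> (Pow_\<mu> N) \<rightarrow>\<^sub>M \<mu>" "(\<lambda>x. x j) \<in> (Pow_\<mu> N) \<rightarrow>\<^sub>M \<mu>"
    using ij by auto
  show ?thesis
  proof (rule pair_measure_eqI[symmetric])
    fix A B assume A: "A \<in> sets \<mu>" and B: "B \<in> sets \<mu>"
    define E where "E k = (if k = i then A else if k = j then B else UNIV)" for k
    have "(\<lambda>x. (x i, x j)) -` (A \<times> B) \<inter> space (Pow_\<mu> N) = Pi\<^sub>E {..<N} E"
      using ij by (auto simp: E_def space_PiM PiE_def Pi_def split: if_splits)
    then have "emeasure (distr (Pow_\<mu> N) (\<mu> \<Otimes>\<^sub>M \<mu>) (\<lambda>x. (x i, x j))) (A \<times> B) = emeasure (Pow_\<mu> N) (Pi\<^sub>E {..<N} E)"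
      using A B by (subst emeasure_distr) auto
    also have "\<dots> = (\<Prod>k<N. emeasure \<mu> (E k))"
      using A B by (intro P.emeasure_PiM) (auto simp: E_def)
    also have "\<dots> = (\<Prod>k\<in>{i, j}. emeasure \<mu> (E k))"
      using ij \<mu>.emeasure_space_1 by (intro prod.mono_neutral_right) (auto simp: E_def)
    also have "\<dots> = emeasure \<mu> A * emeasure \<mu> B" using ij by (simp add: E_def)
    finally show "emeasure \<mu> A * emeasure \<mu> B = emeasure (distr (Pow_\<mu> N) (\<mu> \<Otimes>\<^sub>M \<mu>) (\<lambda>x. (x i, x j))) (A \<times> B)" by simp
  qed (auto intro: \<mu>.sigma_finite_measure_axioms)
qed

lemma has_bochner_integral_PiM_component:
  fixes N :: nat
  assumes i: "i < N" and f: "integrable \<mu> (f :: real \<Rightarrow> real)"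
  shows "has_bochner_integral (Pow_\<mu> N) (\<lambda>x. f (x i)) (integral\<^sup>L \<mu> f)"
proof -
  have d: "distr (Pow_\<mu> N) \<mu> (\<lambda>x. x i) = \<mu>"
    using i \<mu>.prob_space_axioms by (intro distr_PiM_component) auto
  have T: "(\<lambda>x. x i) \<in> (Pow_\<mu> N) \<rightarrow>\<^sub>M \<mu>" using i by auto
  have D: "integrable (distr (Pow_\<mu> N) \<mu> (\<lambda>x. x i)) f" "integral\<^sup>L (distr (Pow_\<mu> N) \<mu> (\<lambda>x. x i)) f = integral\<^sup>L \<mu> f"
    unfolding d using f by auto
  have m: "f \<in> borel_measurable \<mu>" using f by simp
  show ?thesis
    using integrable_distr[OF T D(1)] integral_distr[OF T m] D(2) by (simp add: has_bochner_integral_iff)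
qed

lemma has_bochner_integral_PiM_neg_log:
  fixes N :: nat
  assumes ij: "i < N" "j < N" "i \<noteq> j"
  shows "has_bochner_integral (Pow_\<mu> N) (\<lambda>x. neg_log (x i) (x j)) I\<^sub>L"
proof -
  let ?D = "distr (Pow_\<mu> N) (\<mu> \<Otimes>\<^sub>M \<mu>) (\<lambda>x. (x i, x j))"
  have T: "(\<lambda>x. (x i, x j)) \<in> (Pow_\<mu> N) \<rightarrow>\<^sub>M \<mu> \<Otimes>\<^sub>M \<mu>" using ij by (intro measurable_Pair) auto
  have m: "(\<lambda>(x, y). neg_log x y) \<in> borel_measurable (\<mu> \<Otimes>\<^sub>M \<mu>)" by measurable
  have D: "integrable ?D (\<lambda>(x, y). neg_log x y)" "integral\<^sup>L ?D (\<lambda>(x, y). neg_log x y) = I\<^sub>L"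
    unfolding distr_PiM_pair[OF ij] using integrable_neg_log by (auto simp: I\<^sub>L_def)
  show ?thesis
    using integrable_distr[OF T D(1)] integral_distr[OF T m] D(2) by (simp add: has_bochner_integral_iff)
qed

lemma AE_PiM_inj: "AE x in (Pow_\<mu> N). inj_on x {..<N}" for N :: nat
proof -
  have "AE x in (Pow_\<mu> N). x i \<noteq> x j" if ij: "i < N" "j < N" "i \<noteq> j" for i j
  proof -
    have [measurable]: "(\<lambda>x. (x i, x j)) \<in> (Pow_\<mu> N) \<rightarrow>\<^sub>M \<mu> \<Otimes>\<^sub>M \<mu>" using ij by (intro measurable_Pair) auto
    have "AE p in distr (Pow_\<mu> N) (\<mu> \<Otimes>\<^sub>M \<mu>) (\<lambda>x. (x i, x j)). fst p \<noteq> snd p"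
      unfolding distr_PiM_pair[OF ij] by (rule AE_off_diagonal)
    then have "AE x in (Pow_\<mu> N). fst (x i, x j) \<noteq> snd (x i, x j)"
      by (rule AE_distrD[rotated]) measurable
    then show ?thesis by simp
  qed
  then have "AE x in (Pow_\<mu> N). \<forall>i\<in>{..<N}. \<forall>j\<in>{..<N}. i \<noteq> j \<longrightarrow> x i \<noteq> x j"
    by (intro AE_finite_allI) auto
  then show ?thesis by eventually_elim (auto simp: inj_on_def)
qed

text \<open>The Gibbs variational bound. \<open>Y\<close> is the exponent of the weight minus the
  logarithm of the product density, so its mean combines energy and entropy. The
  \<open>N * (N - 1) / 2\<close> pairs miss half a diagonal of \<open>I\<^sub>L\<close>; this and
  the entropy give the term linear in \<open>N\<close>.\<close>

lemma partition_function_lower: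
  assumes ent: "integrable \<mu> (\<lambda>x. ln (\<rho> x))" and V: "\<And>x. W x = 2 * V x / \<beta>" and \<beta>: "\<beta> > 0"
  shows "ennreal (exp (- (\<beta> / 2) * ((real N)\<^sup>2 * (I\<^sub>W + I\<^sub>L)) - (\<bar>\<integral>x. ln (\<rho> x) \<partial>\<mu>\<bar> + \<beta> * \<bar>I\<^sub>L\<bar>) * real N)) \<le> partition_function V \<beta> N"
proof -
  interpret P: product_prob_space "\<lambda>_::nat. \<mu>" by (rule product_prob_space_\<mu>)
  let ?P = "Pow_\<mu> N"
  interpret PP: prob_space ?P by (intro prob_space_PiM \<mu>.prob_space_axioms)
  define h where "h = (\<integral>x. ln (\<rho> x) \<partial>\<mu>)"
  have VW: "V = (\<lambda>x. \<beta> / 2 * W x)" using V \<beta> by (auto simp: fun_eq_iff)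
  have [measurable]: "V \<in> borel_measurable borel" unfolding VW by measurable
  define Y where "Y x = - \<beta> * pair_energy N x - real N * (\<Sum>i<N. V (x i)) - (\<Sum>i<N. ln (\<rho> (x i)))" for x :: "nat \<Rightarrow> real"
  have iV: "integrable \<mu> V" "integral\<^sup>L \<mu> V = \<beta> / 2 * I\<^sub>W" using integrable_W by (auto simp: VW I\<^sub>W_def)
  have "has_bochner_integral ?P Y (- \<beta> * (\<Sum>j<N. \<Sum>i<j. I\<^sub>L) - real N * (\<Sum>i<N. \<beta> / 2 * I\<^sub>W) - (\<Sum>i<N. h))"
    unfolding Y_def h_def iV(2)[symmetric]
    by (intro has_bochner_integral_diff has_bochner_integral_mult_right has_bochner_integral_sum
        has_bochner_integral_PiM_neg_log has_bochner_integral_PiM_component ent iV) auto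
  moreover have "- \<beta> * (\<Sum>j<N. \<Sum>i<j. I\<^sub>L) - real N * (\<Sum>i<N. \<beta> / 2 * I\<^sub>W) - (\<Sum>i<N. h)
    = - (\<beta> / 2) * ((real N)\<^sup>2 * (I\<^sub>W + I\<^sub>L)) + \<beta> / 2 * real N * I\<^sub>L - real N * h"
  proof -
    have *: "(\<Sum>j<N. \<Sum>i<j. I\<^sub>L) = real N * (real N - 1) / 2 * I\<^sub>L"
      by (induction N) (simp_all add: field_simps)
    show ?thesis unfolding * by (simp add: algebra_simps power2_eq_square diff_divide_distrib)
  qed
  ultimately have Y: "has_bochner_integral ?P Y (- (\<beta> / 2) * ((real N)\<^sup>2 * (I\<^sub>W + I\<^sub>L)) + \<beta> / 2 * real N * I\<^sub>L - real N * h)"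
    by (simp only:)
  have [measurable]: "Y \<in> borel_measurable ?P" using Y by (auto simp: has_bochner_integral_iff)
  have sp: "sets ?P = sets (lebN N)" "space ?P = space (lebN N)"
    using arg_cong[OF PiM_density[of N], of sets] arg_cong[OF PiM_density[of N], of space] by auto
  have [measurable]: "Y \<in> borel_measurable (lebN N)"
    using \<open>Y \<in> borel_measurable ?P\<close> by (simp add: measurable_def sp)
  note lebN_component [measurable]
  have m: "(\<lambda>x. \<Prod>i<N. ennreal (\<rho> (x i))) \<in> borel_measurable (lebN N)"
    by (intro borel_measurable_prod_ennreal) auto
  have [measurable]: "Measurable.pred (lebN N) (\<lambda>x. inj_on x {..<N})"
  proof -
    have "Measurable.pred (lebN N) (\<lambda>x. x i \<noteq> x j)" if "i < N" "j < N" for i j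
      unfolding pred_def using lebN_component[OF that(1)] lebN_component[OF that(2)] by (rule borel_measurable_neq)
    then have "Measurable.pred (lebN N) (\<lambda>x. \<forall>i\<in>{..<N}. \<forall>j\<in>{..<N}. i \<noteq> j \<longrightarrow> x i \<noteq> x j)"
      by (intro pred_intros_finite) auto
    moreover have "(\<lambda>x. inj_on x {..<N}) = (\<lambda>x. \<forall>i\<in>{..<N}. \<forall>j\<in>{..<N}. i \<noteq> j \<longrightarrow> x i \<noteq> (x j :: real))"
      by (auto simp: inj_on_def fun_eq_iff)
    ultimately show ?thesis by (simp only:)
  qed
  have "ennreal (exp (PP.expectation Y)) \<le> (\<integral>\<^sup>+x. ennreal (exp (Y x)) \<partial>?P)"
    using Y by (intro PP.exp_expectation_le) (auto simp: has_bochner_integral_iff)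
  \<comment> \<open>Collisions are removed before the comparison with the weight: there
    \<open>neg_log\<close> is \<open>0\<close> and \<open>exp (Y x)\<close> positive, while the
    weight vanishes.\<close>
  also have "\<dots> = (\<integral>\<^sup>+x. (if inj_on x {..<N} then ennreal (exp (Y x)) else 0) \<partial>?P)"
    using AE_PiM_inj[of N] by (intro nn_integral_cong_AE) (auto elim!: eventually_mono)
  also have "\<dots> = (\<integral>\<^sup>+x. (\<Prod>i<N. ennreal (\<rho> (x i))) * (if inj_on x {..<N} then ennreal (exp (Y x)) else 0) \<partial>lebN N)"
    unfolding PiM_density[symmetric] using m by (intro nn_integral_density) measurable
  also have "\<dots> \<le> partition_function V \<beta> N"
    unfolding partition_function_def
  proof (intro nn_integral_mono)
    fix x :: "nat \<Rightarrow> real"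
    show "(\<Prod>i<N. ennreal (\<rho> (x i))) * (if inj_on x {..<N} then ennreal (exp (Y x)) else 0) \<le> ennreal (gibbs_weight V \<beta> N x)"
    proof (cases "inj_on x {..<N} \<and> (\<forall>i<N. 0 < \<rho> (x i))")
      case True
      then have "exp (\<Sum>i<N. ln (\<rho> (x i))) = (\<Prod>i<N. \<rho> (x i))" by (simp add: exp_sum)
      moreover have "(\<Prod>i<N. \<rho> (x i)) > 0" using True by (intro prod_pos) auto
      moreover have "\<forall>i\<in>{..<N}. \<rho> (x i) \<noteq> 0" using True by auto
      ultimately have "(\<Prod>i<N. \<rho> (x i)) * exp (Y x) = gibbs_weight V \<beta> N x"
        using True unfolding Y_def exp_diff[of _ "\<Sum>i<N. ln (\<rho> (x i))"] by (simp add: gibbs_weight_inj)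
      then show ?thesis
        using True \<rho>_nonneg by (simp add: prod_ennreal ennreal_mult[symmetric] prod_nonneg)
    next
      \<comment> \<open>Where some \<open>\<rho> (x i)\<close> is \<open>0\<close> the value
        \<open>ln 0 = 0\<close> in \<open>Y\<close> is meaningless, but the density factor
        vanishes.\<close>
      case False
      show ?thesis
      proof (cases "inj_on x {..<N}")
        case True
        with False obtain i where "i < N" "\<not> 0 < \<rho> (x i)" by blast
        then have "\<exists>i\<in>{..<N}. ennreal (\<rho> (x i)) = 0" using \<rho>_nonneg[of "x i"] by (intro bexI[of _ i]) auto
        then have "(\<Prod>i<N. ennreal (\<rho> (x i))) = 0" by (rule prod_zero[rotated]) simp
        then show ?thesis by (simp only: mult_zero_left zero_le)
      qed simp
    qed
  qed
  finally have "ennreal (exp (PP.expectation Y)) \<le> partition_function V \<beta> N" .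
  moreover have "- (\<beta> / 2) * ((real N)\<^sup>2 * (I\<^sub>W + I\<^sub>L)) - (\<bar>h\<bar> + \<beta> * \<bar>I\<^sub>L\<bar>) * real N \<le> PP.expectation Y"
  proof -
    have "real N * h \<le> real N * \<bar>h\<bar>" by (intro mult_left_mono) auto
    moreover have "- (\<beta> / 2 * real N * I\<^sub>L) \<le> \<beta> / 2 * real N * \<bar>I\<^sub>L\<bar>"
    proof -
      have "\<beta> / 2 * real N * (- I\<^sub>L) \<le> \<beta> / 2 * real N * \<bar>I\<^sub>L\<bar>" using \<beta> by (intro mult_left_mono) auto
      then show ?thesis by simp
    qed
    moreover have "0 \<le> \<beta> / 2 * real N * \<bar>I\<^sub>L\<bar>" using \<beta> by simp
    ultimately show ?thesis
      unfolding has_bochner_integral_integral_eq[OF Y] by (simp add: algebra_simps)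
  qed
  then have "ennreal (exp (- (\<beta> / 2) * ((real N)\<^sup>2 * (I\<^sub>W + I\<^sub>L)) - (\<bar>h\<bar> + \<beta> * \<bar>I\<^sub>L\<bar>) * real N)) \<le> ennreal (exp (PP.expectation Y))"
    by (intro ennreal_leI) simp
  ultimately show ?thesis unfolding h_def by (rule order_trans[rotated])
qed

end

section \<open>The upper bound under the Gibbs measure\<close>

lemma integrable_exp_neg_square:
  assumes "a > 0"
  shows "integrable lborel (\<lambda>x::real. exp (- a * x\<^sup>2))"
proof -
  define \<sigma> where "\<sigma> = sqrt (1 / (2 * a))"
  have \<sigma>: "\<sigma> > 0" "\<sigma>\<^sup>2 = 1 / (2 * a)" using assms by (auto simp: \<sigma>_def)
  have "integrable lborel (\<lambda>x. sqrt (2 * pi * \<sigma>\<^sup>2) * normal_density 0 \<sigma> x)"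
    using \<sigma>(1) by (intro integrable_mult_right integrable_normal_density)
  moreover have "sqrt (2 * pi * \<sigma>\<^sup>2) * normal_density 0 \<sigma> x = exp (- a * x\<^sup>2)" for x
    using \<sigma> assms by (simp add: normal_density_def mult.commute)
  ultimately show ?thesis by simp
qed

lemma integrable_of_eintegral_finite:
  assumes "g \<in> borel_measurable M" "\<bar>eintegral M (\<lambda>x. ereal (g x))\<bar> \<noteq> \<infinity>"
  shows "integrable M g"
proof -
  define a where "a = (\<integral>\<^sup>+x. ennreal (g x) \<partial>M)"
  define b where "b = (\<integral>\<^sup>+x. ennreal (- g x) \<partial>M)"
  have "eintegral M (\<lambda>x. ereal (g x)) = enn2ereal a - enn2ereal b"
    by (simp add: eintegral_def a_def b_def e2ennreal_ereal)
  then have ab: "\<bar>enn2ereal a - enn2ereal b\<bar> \<noteq> \<infinity>" using assms(2) by simp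
  then have "a \<noteq> \<infinity>" by (cases b) auto
  moreover from this ab have "b \<noteq> \<infinity>" by (cases a) (auto simp: enn2ereal_ennreal)
  ultimately show ?thesis using assms(1) by (simp add: real_integrable_def a_def b_def)
qed

lemma quadratic_growth:
  assumes "continuous_on UNIV V" "Liminf at_infinity (\<lambda>x::real. ereal (V x / x\<^sup>2)) > 0"
  obtains c C where "0 < c" "\<And>x. c * x\<^sup>2 - C \<le> V x"
proof -
  obtain c where c: "0 < ereal c" "ereal c < Liminf at_infinity (\<lambda>x::real. ereal (V x / x\<^sup>2))"
    using ereal_dense2[OF assms(2)] by auto
  then have "\<forall>\<^sub>F x in at_infinity. ereal c < ereal (V x / x\<^sup>2)"
    by (intro less_LiminfD)
  then obtain b where b: "\<And>x. b \<le> \<bar>x\<bar> \<Longrightarrow> c < V x / x\<^sup>2"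
    by (auto simp: eventually_at_infinity)
  define M where "M = max b 1"
  obtain D where D: "\<And>x. x \<in> {-M..M} \<Longrightarrow> \<bar>V x\<bar> \<le> D"
    using continuous_on_Icc_bounded[OF continuous_on_subset[OF assms(1)], of "-M" M] by blast
  have "c * x\<^sup>2 - (c * M\<^sup>2 + \<bar>D\<bar>) \<le> V x" for x
  proof (cases "M \<le> \<bar>x\<bar>")
    case True
    then have "c < V x / x\<^sup>2" "x \<noteq> 0" using b[of x] by (auto simp: M_def)
    then have "c * x\<^sup>2 < V x" by (simp add: pos_less_divide_eq)
    moreover have "0 \<le> c * M\<^sup>2" using c(1) by simp
    ultimately show ?thesis by linarith
  next
    case False
    then have "\<bar>V x\<bar> \<le> D" by (intro D) auto
    moreover have "x\<^sup>2 \<le> M\<^sup>2" using False by (intro power2_le_iff_abs_le[THEN iffD2]) (auto simp: M_def)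
    then have "c * x\<^sup>2 \<le> c * M\<^sup>2" using c(1) by (intro mult_left_mono) auto
    ultimately show ?thesis by linarith
  qed
  then show ?thesis using that c(1) by auto
qed

lemma locally_lipschitz_cmult:
  assumes "locally_lipschitz V"
  shows "locally_lipschitz (\<lambda>x. c * V x)"
  unfolding locally_lipschitz_def
proof
  fix x
  obtain r L where "r > 0" "L-lipschitz_on (ball x r) V"
    using assms unfolding locally_lipschitz_def by blast
  then have "(\<bar>c\<bar> * L)-lipschitz_on (ball x r) (\<lambda>x. c * V x)"
    using lipschitz_on_cmult_real[of L "ball x r" V c] by simp
  then show "\<exists>r>0. \<exists>L. L-lipschitz_on (ball x r) (\<lambda>x. c * V x)"
    using \<open>r > 0\<close> by blast
qed

context equilibrium
begin

text \<open>The one-particle integral that remains after the energy bound. The reserve of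
  confinement is nonnegative inside the window and quadratic outside, where it gives a
  Gaussian.\<close>

lemma integrable_exp_neg_excess:
  assumes "0 < a"
  shows "integrable lborel (\<lambda>u. exp (- a * (W u - trunc_pot u)))"
proof (rule Bochner_Integration.integrable_bound)
  show "integrable lborel (\<lambda>u. indicator {-radius..radius} u + exp (- (a * (c\<^sub>0 / 2)) * u\<^sup>2))"
    using assms c0 by (intro Bochner_Integration.integrable_add integrable_exp_neg_square) auto
  have "exp (- a * (W u - trunc_pot u)) \<le> indicator {-radius..radius} u + exp (- (a * (c\<^sub>0 / 2)) * u\<^sup>2)" for u
  proof (cases "\<bar>u\<bar> \<le> radius")
    case True
    have "exp (- a * (W u - trunc_pot u)) \<le> 1" using assms trunc_pot_le[of u] by simp
    moreover have "indicator {-radius..radius} u = (1 :: real)" using True by (simp add: indicator_def abs_le_iff)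
    ultimately show ?thesis using exp_ge_zero[of "- (a * (c\<^sub>0 / 2)) * u\<^sup>2"] by linarith
  next
    case False
    then have "c\<^sub>0 / 2 * u\<^sup>2 \<le> W u - trunc_pot u" using W_minus_trunc_pot[of u] by simp
    then have "a * (c\<^sub>0 / 2 * u\<^sup>2) \<le> a * (W u - trunc_pot u)" using assms by (intro mult_left_mono) auto
    then show ?thesis by (simp add: add_increasing mult.assoc)
  qed
  then show "AE u in lborel. norm (exp (- a * (W u - trunc_pot u))) \<le> norm (indicator {-radius..radius} u + exp (- (a * (c\<^sub>0 / 2)) * u\<^sup>2))"
    by (intro AE_I2) (simp add: abs_of_nonneg)
  show "(\<lambda>u. exp (- a * (W u - trunc_pot u))) \<in> borel_measurable lborel"
    unfolding trunc_pot_def by measurable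
qed

text \<open>On \<open>A\<close> the energy bound dominates the weight by a constant times a product
  of one-particle factors, whose integral over all configurations factorises. The leading term of
  order \<open>N\<^sup>2\<close> cancels against the lower bound \<open>z\<close> for the partition
  function.\<close>

lemma gibbs_measure_le:
  assumes ent: "integrable \<mu> (\<lambda>x. ln (\<rho> x))" and V: "\<And>x. W x = 2 * V x / \<beta>" and \<beta>: "\<beta> > 0"
    and N: "N \<ge> 1"
    and low: "\<And>x. inj_on x {..<N} \<Longrightarrow> x \<in> A \<Longrightarrow> (real N)\<^sup>2 * (I\<^sub>W + I\<^sub>L) + r + real N / 2 * (\<Sum>i<N. W (x i) - trunc_pot (x i))
      \<le> 2 * pair_energy N x + real N * (\<Sum>i<N. W (x i))"
  shows "measure (gibbs V \<beta> N) A \<le> exp (- (\<beta> / 2) * r + (\<bar>\<integral>x. ln (\<rho> x) \<partial>\<mu>\<bar> + \<beta> * \<bar>I\<^sub>L\<bar>) * real N)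
    * (\<integral>u. exp (- (\<beta> / 4) * (W u - trunc_pot u)) \<partial>lborel) ^ N"
proof (cases "A \<in> sets (gibbs V \<beta> N)")
  \<comment> \<open>A nonmeasurable set has \<open>measure\<close> equal to \<open>0\<close>. This
    case covers the event in \<open>W1\<close> without a proof of its measurability.\<close>
  case False
  then show ?thesis by (simp add: measure_notin_sets Bochner_Integration.integral_nonneg)
next
  case True
  interpret L: product_sigma_finite "\<lambda>_::nat. lborel :: real measure" by unfold_locales
  have VW: "V = (\<lambda>x. \<beta> / 2 * W x)" using V \<beta> by (auto simp: fun_eq_iff)
  have [measurable]: "V \<in> borel_measurable borel" unfolding VW by measurable
  define g where "g u = exp (- (\<beta> / 4) * (W u - trunc_pot u))" for u
  have gi: "integrable lborel g" unfolding g_def[abs_def] using \<beta> by (intro integrable_exp_neg_excess) auto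
  have g0: "0 \<le> g u" for u by (simp add: g_def)
  define D where "D = \<bar>\<integral>x. ln (\<rho> x) \<partial>\<mu>\<bar> + \<beta> * \<bar>I\<^sub>L\<bar>"
  define z where "z = exp (- (\<beta> / 2) * ((real N)\<^sup>2 * (I\<^sub>W + I\<^sub>L)) - D * real N)"
  define e where "e = exp (- (\<beta> / 2) * r + D * real N)"
  have Z: "ennreal z \<le> partition_function V \<beta> N"
    unfolding z_def D_def by (rule partition_function_lower[OF ent V \<beta>])
  have weight: "gibbs_weight V \<beta> N x \<le> z * (e * (\<Prod>i<N. g (x i)))" if "x \<in> A" for x
  proof (cases "inj_on x {..<N}")
    case False
    then show ?thesis using g0 by (simp add: gibbs_weight_not_inj z_def e_def prod_nonneg)
  next
    case True
    define s where "s = (\<Sum>i<N. W (x i) - trunc_pot (x i))"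
    have s0: "0 \<le> s" unfolding s_def using trunc_pot_le by (intro sum_nonneg) simp
    have "- \<beta> * pair_energy N x - real N * (\<Sum>i<N. V (x i))
      = - (\<beta> / 2) * (2 * pair_energy N x + real N * (\<Sum>i<N. W (x i)))"
    proof -
      have "(\<Sum>i<N. V (x i)) = \<beta> / 2 * (\<Sum>i<N. W (x i))" by (simp add: VW sum_distrib_left)
      then show ?thesis by (simp add: algebra_simps)
    qed
    also have "\<dots> \<le> - (\<beta> / 2) * ((real N)\<^sup>2 * (I\<^sub>W + I\<^sub>L) + r + real N / 2 * s)"
      using low[OF True that] \<beta> unfolding s_def by (intro mult_left_mono_neg) auto
    \<comment> \<open>Lowering \<open>real N / 2\<close> to \<open>1 / 2\<close> makes the
      one-particle factor \<open>g\<close> independent of \<open>N\<close>, so that its integral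
      contributes only a fixed constant to the power \<open>N\<close>.\<close>
    also have "\<dots> \<le> - (\<beta> / 2) * ((real N)\<^sup>2 * (I\<^sub>W + I\<^sub>L) + r + 1 / 2 * s)"
      using N \<beta> s0 by (intro mult_left_mono_neg add_left_mono mult_right_mono) auto
    also have "\<dots> = (- (\<beta> / 2) * ((real N)\<^sup>2 * (I\<^sub>W + I\<^sub>L)) - D * real N) + (- (\<beta> / 2) * r + D * real N) + (- (\<beta> / 4) * s)"
      by (simp add: algebra_simps)
    finally have "gibbs_weight V \<beta> N x \<le> exp \<dots>"
      unfolding gibbs_weight_inj[OF True] by (subst exp_le_cancel_iff)
    also have "\<dots> = z * (e * exp (- (\<beta> / 4) * s))"
      by (simp only: exp_add z_def e_def mult.assoc)
    also have "exp (- (\<beta> / 4) * s) = (\<Prod>i<N. g (x i))"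
      by (simp add: s_def g_def sum_distrib_left exp_sum)
    finally show ?thesis .
  qed
  have "emeasure (gibbs V \<beta> N) A = (\<integral>\<^sup>+x. ennreal (gibbs_weight V \<beta> N x) / partition_function V \<beta> N * indicator A x \<partial>lebN N)"
    unfolding gibbs_def using True by (intro emeasure_density) (auto simp: gibbs_def)
  also have "\<dots> \<le> (\<integral>\<^sup>+x. ennreal e * (\<Prod>i<N. ennreal (g (x i))) \<partial>lebN N)"
  proof (rule nn_integral_mono)
    fix x
    show "ennreal (gibbs_weight V \<beta> N x) / partition_function V \<beta> N * indicator A x \<le> ennreal e * (\<Prod>i<N. ennreal (g (x i)))"
    proof (cases "x \<in> A")
      case True
      have z: "0 < z" by (simp add: z_def)
      \<comment> \<open>The value \<open>\<top>\<close> is allowed for the partition function; its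
        inverse is then \<open>0\<close>.\<close>
      have iZ: "inverse (partition_function V \<beta> N) \<le> inverse (ennreal z)"
      proof (cases "partition_function V \<beta> N")
        case (real w)
        then have "z \<le> w" using Z by (simp add: ennreal_le_iff)
        then show ?thesis using real z by (simp add: inverse_ennreal ennreal_leI)
      qed simp
      have P: "0 \<le> e * (\<Prod>i<N. g (x i))" using g0 by (simp add: e_def prod_nonneg)
      have "ennreal (gibbs_weight V \<beta> N x) / partition_function V \<beta> N \<le> ennreal (z * (e * (\<Prod>i<N. g (x i)))) / ennreal z"
        unfolding divide_ennreal_def
        using weight[OF True] by (intro mult_mono ennreal_leI iZ) auto
      also have "\<dots> = ennreal (e * (\<Prod>i<N. g (x i)))"
        using z P by (simp add: divide_ennreal)
      also have "\<dots> = ennreal e * (\<Prod>i<N. ennreal (g (x i)))"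
        using g0 by (simp add: e_def ennreal_mult prod_nonneg prod_ennreal)
      finally show ?thesis using True by simp
    qed simp
  qed
  also have "\<dots> = ennreal e * (\<integral>\<^sup>+x. (\<Prod>i<N. ennreal (g (x i))) \<partial>lebN N)"
  proof (rule nn_integral_cmult)
    note lebN_component [measurable]
    have [measurable]: "g \<in> borel_measurable borel" using gi by simp
    show "(\<lambda>x. \<Prod>i<N. ennreal (g (x i))) \<in> borel_measurable (lebN N)"
      by (intro borel_measurable_prod_ennreal) auto
  qed
  also have "(\<integral>\<^sup>+x. (\<Prod>i<N. ennreal (g (x i))) \<partial>lebN N) = (\<Prod>i<N. \<integral>\<^sup>+u. ennreal (g u) \<partial>lborel)"
    unfolding lebN_def using gi by (intro L.product_nn_integral_prod) auto
  also have "\<dots> = ennreal ((integral\<^sup>L lborel g) ^ N)"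
    using nn_integral_eq_integral[OF gi] g0 by (simp add: ennreal_power Bochner_Integration.integral_nonneg)
  also have "ennreal e * \<dots> = ennreal (e * (integral\<^sup>L lborel g) ^ N)"
    using g0 by (simp add: ennreal_mult e_def Bochner_Integration.integral_nonneg)
  finally have "measure (gibbs V \<beta> N) A \<le> e * (integral\<^sup>L lborel g) ^ N"
    unfolding measure_def using g0 by (intro enn2real_leI) (auto simp: e_def Bochner_Integration.integral_nonneg)
  then show ?thesis by (simp add: e_def D_def g_def[abs_def])
qed

end

theorem theorem1p6:
  fixes V :: "real \<Rightarrow> real" and \<beta> :: real and \<mu> :: "real measure"
  assumes "\<beta> > 0"
    and "admissible_potential V"
    and "is_equilibrium_measure (\<lambda>x. 2 * V x / \<beta>) \<mu>"
    and "\<bar>classical_entropy \<mu>\<bar> \<noteq> \<infinity>"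
  shows "\<exists>u>0. \<exists>v>0. \<forall>N::nat. \<forall>\<theta>::real.
    N \<ge> 1 \<longrightarrow> \<theta> > v * sqrt (ln (1 + real N) / real N) \<longrightarrow>
      measure (gibbs V \<beta> N)
        {x \<in> space (gibbs V \<beta> N). W1 (empirical_measure N x) \<mu> \<ge> ennreal \<theta>}
      \<le> exp (- u * (real N)\<^sup>2 * \<theta>\<^sup>2)"
proof -
  note \<beta> = assms(1)
  define W where "W = (\<lambda>x. 2 * V x / \<beta>)"
  define \<rho> where "\<rho> = (\<lambda>x. enn2real (RN_deriv lborel \<mu> x))"
  have V_cont: "continuous_on UNIV V" and V_inf: "Liminf at_infinity (\<lambda>x. ereal (V x / x\<^sup>2)) > 0"
    and V_lip: "locally_lipschitz V"
    using assms(2) by (auto simp: admissible_potential_def)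
  obtain c C where c: "0 < c" "\<And>x. c * x\<^sup>2 - C \<le> V x"
    using quadratic_growth[OF V_cont V_inf] by blast
  have \<mu>: "prob_space \<mu>" "sets \<mu> = sets borel"
    using assms(3) by (auto simp: is_equilibrium_measure_def prob_measures_def)
  interpret p: prob_space \<mu> by (rule \<mu>)
  have ac: "absolutely_continuous lborel \<mu>"
    using assms(4) by (auto simp: classical_entropy_def split: if_splits)
  have \<rho>_meas [measurable]: "\<rho> \<in> borel_measurable borel"
    unfolding \<rho>_def using borel_measurable_RN_deriv[of lborel \<mu>] by measurable
  have "density lborel (\<lambda>x. ennreal (\<rho> x)) = density lborel (RN_deriv lborel \<mu>)"
  proof (rule density_cong)
    have "AE x in lborel. RN_deriv lborel \<mu> x \<noteq> \<infinity>"
      using ac \<mu> p.sigma_finite_measure_axioms by (intro sigma_finite_measure.RN_deriv_finite[OF sigma_finite_lborel]) auto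
    then show "AE x in lborel. ennreal (\<rho> x) = RN_deriv lborel \<mu> x"
      by eventually_elim (simp add: \<rho>_def less_top)
  qed auto
  also have "\<dots> = \<mu>"
    using ac \<mu> by (intro sigma_finite_measure.density_RN_deriv[OF sigma_finite_lborel]) auto
  finally have \<mu>_eq: "\<mu> = density lborel (\<lambda>x. ennreal (\<rho> x))" by simp
  interpret equilibrium W \<rho> \<mu> "2 * c / \<beta>" "2 * C / \<beta>"
  proof
    show "continuous_on UNIV W" unfolding W_def using \<beta> V_cont by (intro continuous_intros) auto
    show "0 < 2 * c / \<beta>" using \<beta> c by simp
    show "2 * c / \<beta> * x\<^sup>2 - 2 * C / \<beta> \<le> W x" for x
      using divide_right_mono[OF c(2)[of x], of "\<beta> / 2"] \<beta> by (simp add: W_def field_simps)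
    show "is_equilibrium_measure W \<mu>" using assms(3) by (simp add: W_def)
  qed (use \<mu>_eq in \<open>auto simp: \<rho>_def\<close>)
  have lip: "locally_lipschitz W"
    using locally_lipschitz_cmult[OF V_lip, of "2 / \<beta>"] by (simp add: W_def)
  have ent: "integrable \<mu> (\<lambda>x. ln (\<rho> x))"
  proof -
    have "integrable lborel (\<lambda>x. \<rho> x * ln (\<rho> x))"
      using assms(4) ac by (intro integrable_of_eintegral_finite) (simp_all add: classical_entropy_def \<rho>_def Let_def)
    then have "integrable (density lborel (\<lambda>x. ennreal (\<rho> x))) (\<lambda>x. ln (\<rho> x))"
      using \<rho>_nonneg by (subst integrable_density) auto
    then show ?thesis by (simp only: \<mu>_eq[symmetric])
  qed
  obtain \<kappa> K where \<kappa>: "0 < \<kappa>" "0 \<le> K" and low: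
    "\<And>N x \<theta>. N \<ge> 1 \<Longrightarrow> inj_on x {..<N} \<Longrightarrow> 0 \<le> \<theta> \<Longrightarrow> ennreal \<theta> \<le> W1 (empirical_measure N x) \<mu> \<Longrightarrow>
      (real N)\<^sup>2 * (I\<^sub>W + I\<^sub>L) + \<kappa> * (real N)\<^sup>2 * \<theta>\<^sup>2 + real N / 2 * (\<Sum>i<N. W (x i) - trunc_pot (x i)) - K * real N * ln (1 + real N)
      \<le> 2 * pair_energy N x + real N * (\<Sum>i<N. W (x i))"
    using gas_energy_lower[OF lip] by blast
  \<comment> \<open>The maximum with \<open>1\<close> makes \<open>ln G\<close> nonnegative.\<close>
  define G where "G = max 1 (\<integral>u. exp (- (\<beta> / 4) * (W u - trunc_pot u)) \<partial>lborel)"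
  define D where "D = \<bar>\<integral>x. ln (\<rho> x) \<partial>\<mu>\<bar> + \<beta> * \<bar>I\<^sub>L\<bar>"
  \<comment> \<open>Collects all errors as a multiple of \<open>N * ln (1 + N)\<close>. The factor
    \<open>2\<close> comes from \<open>ln (1 + n) \<ge> 1 / 2\<close>, applied to the errors linear
    in \<open>N\<close>.\<close>
  define B where "B = \<beta> / 2 * K + 2 * (D + ln G)"
  \<comment> \<open>Half of the rate \<open>\<beta> / 2 * \<kappa>\<close>; the other half absorbs
    the errors.\<close>
  define u where "u = \<beta> / 4 * \<kappa>"
  \<comment> \<open>Large enough for \<open>B \<le> u * v\<^sup>2\<close>, which is what makes the
    errors at most \<open>u * N\<^sup>2 * \<theta>\<^sup>2\<close> above the threshold. The summand
    \<open>1\<close> keeps \<open>v\<close> positive if \<open>B = 0\<close>.\<close>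
  define v where "v = sqrt (B / u) + 1"
  have G: "1 \<le> G" by (simp add: G_def)
  have D: "0 \<le> D" using \<beta> by (simp add: D_def)
  have DG: "0 \<le> D + ln G" using D G by simp
  have B: "0 \<le> B" using \<beta> \<kappa> DG by (simp add: B_def)
  have u: "0 < u" using \<beta> \<kappa> by (simp add: u_def)
  have v: "0 < v" "B \<le> u * v\<^sup>2"
  proof -
    show "0 < v" using B u by (simp add: v_def add_nonneg_pos)
    have "B / u \<le> v\<^sup>2" using B u by (simp add: v_def power2_sum)
    then show "B \<le> u * v\<^sup>2" using u by (simp add: pos_divide_le_eq mult.commute)
  qed
  have main: "measure (gibbs V \<beta> N) {x \<in> space (gibbs V \<beta> N). W1 (empirical_measure N x) \<mu> \<ge> ennreal \<theta>}
      \<le> exp (- u * (real N)\<^sup>2 * \<theta>\<^sup>2)" if N: "N \<ge> 1" and \<theta>: "\<theta> > v * sqrt (ln (1 + real N) / real N)" for N :: nat and \<theta> :: real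
  proof -
    define n where "n = real N"
    define l where "l = ln (1 + n)"
    have n: "1 \<le> n" using N by (simp add: n_def)
    have l: "1 / 2 \<le> l"
    proof -
      have "1 / 2 \<le> ln (2 :: real)" using ln2_ge_two_thirds by simp
      also have "\<dots> \<le> l" unfolding l_def using n by (subst ln_le_cancel_iff) auto
      finally show ?thesis .
    qed
    have s0: "0 \<le> v * sqrt (l / n)" using v n l by simp
    then have \<theta>0: "0 \<le> \<theta>" using \<theta> by (simp add: n_def l_def)
    have "(v * sqrt (l / n))\<^sup>2 \<le> \<theta>\<^sup>2" using s0 \<theta> by (intro power_mono) (auto simp: n_def l_def)
    then have "v\<^sup>2 * (l / n) \<le> \<theta>\<^sup>2" using n l by (simp add: power_mult_distrib)
    then have "n\<^sup>2 * (v\<^sup>2 * (l / n)) \<le> n\<^sup>2 * \<theta>\<^sup>2" by (intro mult_left_mono) auto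
    then have "v\<^sup>2 * (n * l) \<le> n\<^sup>2 * \<theta>\<^sup>2" using n by (simp add: power2_eq_square mult_ac)
    then have "u * (v\<^sup>2 * (n * l)) \<le> u * (n\<^sup>2 * \<theta>\<^sup>2)" using u by (intro mult_left_mono) auto
    moreover have "B * (n * l) \<le> u * v\<^sup>2 * (n * l)" using v n l by (intro mult_right_mono) auto
    ultimately have Bn: "B * (n * l) \<le> u * (n\<^sup>2 * \<theta>\<^sup>2)" by (simp add: mult_ac)
    let ?r = "\<kappa> * n\<^sup>2 * \<theta>\<^sup>2 - K * n * l"
    let ?A = "{x \<in> space (gibbs V \<beta> N). W1 (empirical_measure N x) \<mu> \<ge> ennreal \<theta>}"
    have "measure (gibbs V \<beta> N) ?A \<le> exp (- (\<beta> / 2) * ?r + D * n)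
        * (\<integral>u. exp (- (\<beta> / 4) * (W u - trunc_pot u)) \<partial>lborel) ^ N"
      unfolding D_def n_def
    proof (rule gibbs_measure_le[OF ent _ \<beta> N])
      show "W x = 2 * V x / \<beta>" for x by (simp add: W_def)
      fix x assume "inj_on x {..<N}" "x \<in> {x \<in> space (gibbs V \<beta> N). W1 (empirical_measure N x) \<mu> \<ge> ennreal \<theta>}"
      then show "(real N)\<^sup>2 * (I\<^sub>W + I\<^sub>L) + (\<kappa> * (real N)\<^sup>2 * \<theta>\<^sup>2 - K * real N * l) + real N / 2 * (\<Sum>i<N. W (x i) - trunc_pot (x i))
        \<le> 2 * pair_energy N x + real N * (\<Sum>i<N. W (x i))"
        using low[OF N _ \<theta>0, of x] by (simp add: l_def n_def)
    qed
    also have "\<dots> \<le> exp (- (\<beta> / 2) * ?r + D * n) * G ^ N"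
      by (intro mult_left_mono power_mono) (auto simp: G_def intro!: Bochner_Integration.integral_nonneg)
    also have "G ^ N = exp (n * ln G)"
      using G by (simp add: n_def exp_of_nat_mult)
    also have "exp (- (\<beta> / 2) * ?r + D * n) * exp (n * ln G) = exp (- (\<beta> / 2) * ?r + D * n + n * ln G)"
      by (simp add: exp_add)
    also have "\<dots> \<le> exp (- u * n\<^sup>2 * \<theta>\<^sup>2)"
    proof (subst exp_le_cancel_iff)
      have "n * (D + ln G) * 1 \<le> n * (D + ln G) * (2 * l)" using n DG l by (intro mult_left_mono) auto
      then have "\<beta> / 2 * (K * n * l) + D * n + n * ln G \<le> B * (n * l)"
        by (simp add: B_def algebra_simps)
      moreover have "- (\<beta> / 2) * ?r = - 2 * (u * (n\<^sup>2 * \<theta>\<^sup>2)) + \<beta> / 2 * (K * n * l)"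
        by (simp add: u_def algebra_simps)
      moreover have "- u * n\<^sup>2 * \<theta>\<^sup>2 = - (u * (n\<^sup>2 * \<theta>\<^sup>2))" by simp
      ultimately show "- (\<beta> / 2) * ?r + D * n + n * ln G \<le> - u * n\<^sup>2 * \<theta>\<^sup>2"
        using Bn by linarith
    qed
    finally show ?thesis by (simp add: n_def)
  qed
  show ?thesis using main u v(1) by blast
qed

end
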